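(* Let $\mathcal{X}$ be a compact metric space, let $n,m\in\mathbb{N}$, and let $\vec{A} = (A_1, \dots, A_m)$ and $\vec{B} = (B_1, \dots, B_m)$ be abelian families in $C(\mathcal{X}, M_n(\mathbb{C}))$. Then the following are equivalent: (1) $\vec{A} \prec_{\mathrm{pt}} \vec{B}$. (2) $\vec{A} \prec_{\mathrm{tr}} \vec{B}$. (3) $\vec{A} \prec_{\mathrm{tr}, \mathrm{pt}} \vec{B}$. (4) $\vec{A} \in \overline{\mathrm{conv}}(\mathcal{U}(\vec{B}))$.
   Context: $C(\mathcal{X},M_n(\mathbb{C}))$ is the unital C$^*$-algebra of continuous functions from $\mathcal{X}$ to the $n\times n$ complex matrices. For a unital C$^*$-algebra $\mathfrak{A}$, an abelian family in $\mathfrak{A}$ is an $m$-tuple $\vec{A}=(A_1,\dots,A_m)\in\mathfrak{A}^m$ of pairwise commuting self-adjoint elements. For continuous $f:\mathbb{R}^m\to\mathbb{R}$, $f(A_1,\dots,A_m)$ is defined by the joint continuous functional calculus. The (joint) unitary orbit is $\mathcal{U}(\vec{A})=\{(U^*A_1U,\dots,U^*A_mU) : U\in\mathfrak{A}\text{ unitary}\}\subseteq\mathfrak{A}^m$; $\mathrm{conv}(\mathcal{U}(\vec{A}))$ is its convex hull and $\overline{\mathrm{conv}}(\mathcal{U}(\vec{A}))$ is the norm closure of this convex hull in $\mathfrak{A}^m$. Tracial majorization: a tracial state on $\mathfrak{A}$ is a unital positive linear functional $\tau$ with $\tau(AB)=\tau(BA)$. For abelian families in $\mathfrak{A}$, $\vec{A}\prec_{\mathrm{tr}}\vec{B}$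 means $\tau(f(A_1,\dots,A_m))\le\tau(f(B_1,\dots,B_m))$ for every tracial state $\tau$ on $\mathfrak{A}$ and every continuous convex $f:\mathbb{R}^m\to\mathbb{R}$. Doubly stochastic majorization in $M_n(\mathbb{C})$: $DS_n$ is the set of $n\times n$ matrices with non-negative entries all of whose row sums and column sums equal $1$. If $\vec{A},\vec{B}$ are abelian families in $M_n(\mathbb{C})$, simultaneously diagonalize: $A_j=U^*D_jU$, $B_j=V^*D_j'V$ with $U,V$ unitary and $D_j,D_j'$ diagonal ($1\le j\le m$). Let $A$ and $B$ be the $n\times m$ matrices whose $j$-th columns are the diagonals of $D_j$ and $D_j'$ respectively. Then $\vec{A}\prec\vec{B}$ means there is $X\in DS_n$ with $XB=A$ (this does not depend on the chosen diagonalizations). For abelian families in $C(\mathcal{X},M_n(\mathbb{C}))$, write $\vec{A}(x)=(A_1(x),\dots,A_m(x))$. Then $\vec{A}\prec_{\mathrm{pt}}\vec{B}$ means $\vec{A}(x)\prec\vec{B}(x)$ for every $x\in\mathcal{X}$, and $\vec{A}\prec_{\mathrm{tr},\mathrm{pt}}\vec{B}$ means $\vec{A}(x)\prec_{\mathrm{tr}}\vec{B}(x)$ in $M_n(\mathbb{C})$ for every $x\in\mathcal{X}$. *)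

theory Defs
  imports "HOL-Analysis.Analysis" "HOL-Algebra.Module"
begin

section \<open>Unital C*-algebras as records\<close>

text \<open>
  The structure of a unital C*-algebra is carried by a record, so that the notions below are
  defined once for an arbitrary algebra and can be applied both to the matrix algebra and to the
  algebra of continuous matrix-valued functions on a compact space.  An \<open>m\<close>-tuple of elements
  is a function on a finite index type of cardinality \<open>m\<close>.
\<close>

record 'a cstar = "(complex, 'a) module" +
  star :: "'a \<Rightarrow> 'a"
  nrm :: "'a \<Rightarrow> real"

definition abelian_family :: "('a, 'k) cstar_scheme \<Rightarrow> ('m::finite \<Rightarrow> 'a) \<Rightarrow> bool" where
  "abelian_family \<AA> A \<longleftrightarrow>
     (\<forall>j. A j \<in> carrier \<AA> \<and> star \<AA> (A j) = A j) \<and>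
     (\<forall>i j. A i \<otimes>\<^bsub>\<AA>\<^esub> A j = A j \<otimes>\<^bsub>\<AA>\<^esub> A i)"

definition unitaries :: "('a, 'k) cstar_scheme \<Rightarrow> 'a set" where
  "unitaries \<AA> = {U \<in> carrier \<AA>. star \<AA> U \<otimes>\<^bsub>\<AA>\<^esub> U = \<one>\<^bsub>\<AA>\<^esub> \<and> U \<otimes>\<^bsub>\<AA>\<^esub> star \<AA> U = \<one>\<^bsub>\<AA>\<^esub>}"

definition unitary_orbit :: "('a, 'k) cstar_scheme \<Rightarrow> ('m::finite \<Rightarrow> 'a) \<Rightarrow> ('m \<Rightarrow> 'a) set" where
  "unitary_orbit \<AA> A = (\<lambda>U j. star \<AA> U \<otimes>\<^bsub>\<AA>\<^esub> A j \<otimes>\<^bsub>\<AA>\<^esub> U) ` unitaries \<AA>"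

definition tuple_convex :: "('a, 'k) cstar_scheme \<Rightarrow> ('m::finite \<Rightarrow> 'a) set \<Rightarrow> bool" where
  "tuple_convex \<AA> S \<longleftrightarrow>
     (\<forall>P\<in>S. \<forall>Q\<in>S. \<forall>u v. 0 \<le> u \<longrightarrow> 0 \<le> v \<longrightarrow> u + v = 1 \<longrightarrow>
        (\<lambda>j. (complex_of_real u \<odot>\<^bsub>\<AA>\<^esub> P j) \<oplus>\<^bsub>\<AA>\<^esub> (complex_of_real v \<odot>\<^bsub>\<AA>\<^esub> Q j)) \<in> S)"

definition tuple_conv :: "('a, 'k) cstar_scheme \<Rightarrow> ('m::finite \<Rightarrow> 'a) set \<Rightarrow> ('m \<Rightarrow> 'a) set" where
  "tuple_conv \<AA> S = tuple_convex \<AA> hull S"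

text \<open>The norm on tuples is the maximum of the norms of the entries.\<close>

definition tuple_closure :: "('a, 'k) cstar_scheme \<Rightarrow> ('m::finite \<Rightarrow> 'a) set \<Rightarrow> ('m \<Rightarrow> 'a) set" where
  "tuple_closure \<AA> S =
     {P. (\<forall>j. P j \<in> carrier \<AA>) \<and> (\<forall>e>0. \<exists>Q\<in>S. \<forall>j. nrm \<AA> (P j \<ominus>\<^bsub>\<AA>\<^esub> Q j) < e)}"


section \<open>Joint continuous functional calculus\<close>

definition cstar_subalgebra :: "('a, 'k) cstar_scheme \<Rightarrow> 'a set \<Rightarrow> bool" where
  "cstar_subalgebra \<AA> S \<longleftrightarrow>
     S \<subseteq> carrier \<AA> \<and> \<one>\<^bsub>\<AA>\<^esub> \<in> S \<and>
     (\<forall>a\<in>S. \<forall>b\<in>S. a \<oplus>\<^bsub>\<AA>\<^esub> b \<in> S \<and> a \<otimes>\<^bsub>\<AA>\<^esub> b \<in> S) \<and>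
     (\<forall>c. \<forall>a\<in>S. c \<odot>\<^bsub>\<AA>\<^esub> a \<in> S) \<and>
     (\<forall>a\<in>S. star \<AA> a \<in> S) \<and>
     (\<forall>a\<in>carrier \<AA>. (\<forall>e>0. \<exists>b\<in>S. nrm \<AA> (a \<ominus>\<^bsub>\<AA>\<^esub> b) < e) \<longrightarrow> a \<in> S)"

definition generated_cstar :: "('a, 'k) cstar_scheme \<Rightarrow> 'a set \<Rightarrow> 'a set" where
  "generated_cstar \<AA> G = cstar_subalgebra \<AA> hull G"

definition character_on :: "('a, 'k) cstar_scheme \<Rightarrow> 'a set \<Rightarrow> ('a \<Rightarrow> complex) \<Rightarrow> bool" where
  "character_on \<AA> S h \<longleftrightarrow>
     h \<one>\<^bsub>\<AA>\<^esub> = 1 \<and>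
     (\<forall>a\<in>S. \<forall>b\<in>S. h (a \<oplus>\<^bsub>\<AA>\<^esub> b) = h a + h b \<and> h (a \<otimes>\<^bsub>\<AA>\<^esub> b) = h a * h b) \<and>
     (\<forall>c. \<forall>a\<in>S. h (c \<odot>\<^bsub>\<AA>\<^esub> a) = c * h a) \<and>
     (\<forall>a\<in>S. h (star \<AA> a) = cnj (h a))"

text \<open>
  For an abelian family \<open>A\<close>, the Gelfand transform identifies the commutative C*-algebra
  generated by the unit and the \<open>A j\<close> with the continuous functions on its character space.  The
  element \<open>f(A)\<close> is the one whose Gelfand transform sends a character \<open>h\<close> to
  \<open>f (h (A 1), \<dots>, h (A m))\<close>; the numbers \<open>h (A j)\<close> are real because the \<open>A j\<close> are
  self-adjoint.
\<close>

definition functional_calculus ::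
    "('a, 'k) cstar_scheme \<Rightarrow> (real^'m \<Rightarrow> real) \<Rightarrow> ('m::finite \<Rightarrow> 'a) \<Rightarrow> 'a" where
  "functional_calculus \<AA> f A =
     (THE T. T \<in> generated_cstar \<AA> (range A) \<and>
        (\<forall>h. character_on \<AA> (generated_cstar \<AA> (range A)) h \<longrightarrow>
           h T = complex_of_real (f (\<chi> j. Re (h (A j))))))"


section \<open>Tracial majorization\<close>

definition tracial_state :: "('a, 'k) cstar_scheme \<Rightarrow> ('a \<Rightarrow> complex) \<Rightarrow> bool" where
  "tracial_state \<AA> \<tau> \<longleftrightarrow>
     (\<forall>a\<in>carrier \<AA>. \<forall>b\<in>carrier \<AA>. \<tau> (a \<oplus>\<^bsub>\<AA>\<^esub> b) = \<tau> a + \<tau> b) \<and>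
     (\<forall>c. \<forall>a\<in>carrier \<AA>. \<tau> (c \<odot>\<^bsub>\<AA>\<^esub> a) = c * \<tau> a) \<and>
     (\<forall>a\<in>carrier \<AA>. \<tau> (star \<AA> a \<otimes>\<^bsub>\<AA>\<^esub> a) \<in> \<real>\<^sub>\<ge>\<^sub>0) \<and>
     \<tau> \<one>\<^bsub>\<AA>\<^esub> = 1 \<and>
     (\<forall>a\<in>carrier \<AA>. \<forall>b\<in>carrier \<AA>. \<tau> (a \<otimes>\<^bsub>\<AA>\<^esub> b) = \<tau> (b \<otimes>\<^bsub>\<AA>\<^esub> a))"

text \<open>
  The values \<open>\<tau> (f(A))\<close> are real, as \<open>f(A)\<close> is self-adjoint; \<open>Re\<close> only moves them to the
  type of real numbers.
\<close>

definition tr_majorized ::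
    "('a, 'k) cstar_scheme \<Rightarrow> ('m::finite \<Rightarrow> 'a) \<Rightarrow> ('m \<Rightarrow> 'a) \<Rightarrow> bool" where
  "tr_majorized \<AA> A B \<longleftrightarrow>
     (\<forall>\<tau> (f :: real^'m \<Rightarrow> real).
        tracial_state \<AA> \<tau> \<longrightarrow> continuous_on UNIV f \<longrightarrow> convex_on UNIV f \<longrightarrow>
        Re (\<tau> (functional_calculus \<AA> f A)) \<le> Re (\<tau> (functional_calculus \<AA> f B)))"


section \<open>Matrix algebras and algebras of continuous matrix-valued functions\<close>

definition adjoint_mat :: "complex^'n^'n \<Rightarrow> complex^'n^'n" where
  "adjoint_mat M = (\<chi> i j. cnj (M $ j $ i))"

text \<open>
  Addition, zero and unit are the library operations.  The library norm on \<^typ>\<open>complex^'n^'n\<close>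
  is the Frobenius norm, so the C*-norm is given separately as the operator norm.
\<close>

definition matrix_algebra :: "(complex^'n^'n) cstar" where
  "matrix_algebra =
     \<lparr>carrier = UNIV, mult = (**), one = mat 1, zero = 0, add = (+),
      smult = (\<lambda>c M. \<chi> i j. c * M $ i $ j),
      star = adjoint_mat,
      nrm = (\<lambda>M. onorm ((*v) M))\<rparr>"

text \<open>
  Continuity refers to the library topology of \<^typ>\<open>complex^'n^'n\<close>, which is the operator norm
  topology.  Functions are extensional on \<open>X\<close>, so equality in the algebra is equality on \<open>X\<close>.
  The \<open>0\<close> inserted in the supremum only matters for empty \<open>X\<close>.
\<close>

definition cont_matrix_algebra :: "'x::metric_space set \<Rightarrow> ('x \<Rightarrow> complex^'n^'n) cstar" where
  "cont_matrix_algebra X =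
     \<lparr>carrier = {F \<in> extensional X. continuous_on X F},
      mult = (\<lambda>F G. \<lambda>x\<in>X. F x \<otimes>\<^bsub>matrix_algebra\<^esub> G x),
      one = (\<lambda>x\<in>X. \<one>\<^bsub>matrix_algebra\<^esub>),
      zero = (\<lambda>x\<in>X. \<zero>\<^bsub>matrix_algebra\<^esub>),
      add = (\<lambda>F G. \<lambda>x\<in>X. F x \<oplus>\<^bsub>matrix_algebra\<^esub> G x),
      smult = (\<lambda>c F. \<lambda>x\<in>X. c \<odot>\<^bsub>matrix_algebra\<^esub> F x),
      star = (\<lambda>F. \<lambda>x\<in>X. star matrix_algebra (F x)),
      nrm = (\<lambda>F. Sup (insert 0 ((\<lambda>x. nrm matrix_algebra (F x)) ` X)))\<rparr>"


section \<open>Doubly stochastic and pointwise majorization\<close>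

definition doubly_stochastic :: "(real^'n^'n) set" where
  "doubly_stochastic =
     {S. (\<forall>i j. 0 \<le> S $ i $ j) \<and> (\<forall>i. (\<Sum>j\<in>UNIV. S $ i $ j) = 1) \<and>
         (\<forall>j. (\<Sum>i\<in>UNIV. S $ i $ j) = 1)}"

definition diagonal_mat :: "complex^'n^'n \<Rightarrow> bool" where
  "diagonal_mat D \<longleftrightarrow> (\<forall>i j. i \<noteq> j \<longrightarrow> D $ i $ j = 0)"

text \<open>The \<open>j\<close>-th column of \<open>diag_columns D\<close> is the diagonal of \<open>D j\<close>.\<close>

definition diag_columns :: "('m::finite \<Rightarrow> complex^'n^'n) \<Rightarrow> complex^'m^'n" where
  "diag_columns D = (\<chi> i j. D j $ i $ i)"

definition diagonalization ::
    "('m::finite \<Rightarrow> complex^'n^'n) \<Rightarrow> complex^'n^'n \<Rightarrow> ('m \<Rightarrow> complex^'n^'n) \<Rightarrow> bool" where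
  "diagonalization A U D \<longleftrightarrow>
     U \<in> unitaries matrix_algebra \<and>
     (\<forall>j. diagonal_mat (D j) \<and> A j = adjoint_mat U ** D j ** U)"

text \<open>
  Two simultaneous diagonalizations of the same family differ by a permutation of the rows of
  \<open>diag_columns\<close>, so the choice of diagonalizations is immaterial.
\<close>

definition ds_majorized ::
    "('m::finite \<Rightarrow> complex^'n^'n) \<Rightarrow> ('m \<Rightarrow> complex^'n^'n) \<Rightarrow> bool" where
  "ds_majorized A B \<longleftrightarrow>
     (\<exists>U V D D'. diagonalization A U D \<and> diagonalization B V D' \<and>
        (\<exists>S\<in>doubly_stochastic.
           map_matrix complex_of_real S ** diag_columns D' = diag_columns D))"

definition pt_majorized ::
    "'x set \<Rightarrow> ('m::finite \<Rightarrow> 'x \<Rightarrow> complex^'n^'n) \<Rightarrow> ('m \<Rightarrow> 'x \<Rightarrow> complex^'n^'n) \<Rightarrow> bool" where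
  "pt_majorized X A B \<longleftrightarrow> (\<forall>x\<in>X. ds_majorized (\<lambda>j. A j x) (\<lambda>j. B j x))"

definition tr_pt_majorized ::
    "'x set \<Rightarrow> ('m::finite \<Rightarrow> 'x \<Rightarrow> complex^'n^'n) \<Rightarrow> ('m \<Rightarrow> 'x \<Rightarrow> complex^'n^'n) \<Rightarrow> bool" where
  "tr_pt_majorized X A B \<longleftrightarrow>
     (\<forall>x\<in>X. tr_majorized matrix_algebra (\<lambda>j. A j x) (\<lambda>j. B j x))"

end

theory Submission
  imports Defs
begin

text \<open>
  At a point, both (1) and (3) say that \<open>\<Sum>f(\<alpha>\<^sub>i) \<le> \<Sum>f(\<beta>\<^sub>i)\<close> for all continuous convex
  \<open>f\<close>, where \<open>\<alpha>\<^sub>i\<close>, \<open>\<beta>\<^sub>i\<close> are the joint eigenvalues; the passage to a doubly stochastic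
  matrix is a separation argument.  A tracial state of \<open>C(X, M\<^sub>n)\<close> only depends on the
  pointwise trace, which reduces (2) to (3).  The diagonals of unitary conjugates of \<open>B(x)\<close>, in
  a basis diagonalizing \<open>A(x)\<close>, are images of the joint eigenvalues of \<open>B(x)\<close> under doubly
  stochastic matrices, and compactness of the latter gives (1) from (4).

  For (4) from (1), Birkhoff's theorem writes \<open>A(x)\<close> as an average of conjugates of \<open>B(x)\<close> by
  constant unitaries, which approximates \<open>A\<close> near \<open>x\<close>.  The local averages are glued with
  scalar functions \<open>\<phi>\<close>.  Since constant unitaries are joined by paths to the identity,
  \<open>\<phi> U\<^sup>*BU + (1 - \<phi>) V\<^sup>*BV\<close> is a limit of uniform averages of conjugates by unitary
  functions running through a path from \<open>V\<close> to \<open>U\<close>.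
\<close>

section \<open>Adjoints, unitaries and diagonal matrices\<close>

text \<open>\<open>functional_calculus\<close> is a definite description that quantifies over all
  characters of a generated algebra, so before any trace can be computed it has to be matched with
  the spectral formula, in M_n(C) and in C(X, M_n(C)). Over X the obstacle is that joint
  eigenvectors cannot in general be chosen continuously. Diagonalizations are therefore picked point
  by point, and continuity of f(A) is recovered by polynomial approximation, since a polynomial in
  the A_j is continuous whatever was picked. For (4) the obstacle is that a convex hull only admits
  constant weights, while gluing local averages needs weights depending on x. The path from V to U
  removes it: the coefficients of the average stay constant, and it is the position on the path that
  varies with x, so that a fraction of about phi(x) of the terms sits at the end U and the others at
  V. Such a path exists when both unitary functions contract to the identity, and the functions
  obtained along it contract as well, so all conjugations are kept within this class.\<close>

lemma adjoint_mat_nth [simp]: "adjoint_mat M $ i $ j = cnj (M $ j $ i)"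
  by (simp add: adjoint_mat_def)

lemma adjoint_mat_adjoint_mat [simp]: "adjoint_mat (adjoint_mat M) = M"
  by (simp add: vec_eq_iff)

lemma adjoint_mat_mult: "adjoint_mat (M ** N) = adjoint_mat N ** adjoint_mat M"
  by (simp add: vec_eq_iff matrix_matrix_mult_def mult.commute)

lemma adjoint_mat_one [simp]: "adjoint_mat (mat 1) = mat 1"
  by (simp add: vec_eq_iff mat_def)

lemma adjoint_mat_add: "adjoint_mat (M + N) = adjoint_mat M + adjoint_mat N"
  by (simp add: vec_eq_iff)

lemma adjoint_mat_diff: "adjoint_mat (M - N) = adjoint_mat M - adjoint_mat N"
  by (simp add: vec_eq_iff)

lemma adjoint_mat_scaleR: "adjoint_mat (r *\<^sub>R M) = r *\<^sub>R adjoint_mat M"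
  by (simp add: vec_eq_iff)

lemma unitary_matrix_iff:
  "U \<in> unitaries matrix_algebra \<longleftrightarrow> adjoint_mat U ** U = mat 1 \<and> U ** adjoint_mat U = mat 1"
  by (simp add: unitaries_def matrix_algebra_def)

lemma unitary_matrixI: "U ** adjoint_mat U = mat 1 \<Longrightarrow> U \<in> unitaries matrix_algebra"
  by (simp add: unitary_matrix_iff matrix_left_right_inverse)

lemma unitary_adjoint_mult:
  assumes "U \<in> unitaries matrix_algebra"
  shows "adjoint_mat U ** U = mat 1" "U ** adjoint_mat U = mat 1"
    "adjoint_mat U ** (U ** M) = M" "U ** (adjoint_mat U ** M) = M"
  using assms by (auto simp: unitary_matrix_iff matrix_mul_assoc)

lemma unitary_matrix_mult:
  assumes "U \<in> unitaries matrix_algebra" "V \<in> unitaries matrix_algebra"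
  shows "U ** V \<in> unitaries matrix_algebra"
  using assms
  by (auto intro!: unitary_matrixI simp: adjoint_mat_mult matrix_mul_assoc[symmetric] unitary_adjoint_mult)

lemma unitary_matrix_adjoint:
  "U \<in> unitaries matrix_algebra \<Longrightarrow> adjoint_mat U \<in> unitaries matrix_algebra"
  by (auto intro!: unitary_matrixI simp: unitary_adjoint_mult)

lemma unitary_matrix_one: "mat 1 \<in> unitaries matrix_algebra"
  by (rule unitary_matrixI) simp

definition diag_matrix :: "('n \<Rightarrow> complex) \<Rightarrow> complex^'n^'n" where
  "diag_matrix d = (\<chi> i j. if i = j then d i else 0)"

lemma diag_matrix_nth: "diag_matrix d $ i $ j = (if i = j then d i else 0)"
  by (simp add: diag_matrix_def)

lemma diag_matrix_mult_left: "(diag_matrix d ** M) $ i $ j = d i * M $ i $ j"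
  for M :: "complex^'n::finite^'n"
  by (simp add: matrix_matrix_mult_def diag_matrix_nth if_distrib[of "\<lambda>x. x * _"] cong: if_cong)

lemma diag_matrix_mult_right: "(M ** diag_matrix d) $ i $ j = M $ i $ j * d j"
  for M :: "complex^'n::finite^'n"
  by (simp add: matrix_matrix_mult_def diag_matrix_nth if_distrib[of "\<lambda>x. _ * x"] cong: if_cong)

lemma diag_matrix_mult: "diag_matrix c ** diag_matrix d = diag_matrix (\<lambda>i. c i * d i)"
  for c :: "'n::finite \<Rightarrow> complex"
  by (simp add: vec_eq_iff diag_matrix_mult_left diag_matrix_nth)

lemma diag_matrix_add: "diag_matrix c + diag_matrix d = diag_matrix (\<lambda>i. c i + d i)"
  by (simp add: vec_eq_iff diag_matrix_nth)

lemma diag_matrix_one: "diag_matrix (\<lambda>i. 1) = mat 1"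
  by (simp add: vec_eq_iff diag_matrix_nth mat_def)

lemma adjoint_diag_matrix: "adjoint_mat (diag_matrix d) = diag_matrix (\<lambda>i. cnj (d i))"
  by (simp add: vec_eq_iff diag_matrix_nth)

lemma diagonal_mat_eq: "diagonal_mat D \<Longrightarrow> D = diag_matrix (\<lambda>i. D $ i $ i)"
  by (simp add: diagonal_mat_def vec_eq_iff diag_matrix_nth)

lemma diagonal_mat_diag_matrix: "diagonal_mat (diag_matrix d)"
  by (simp add: diagonal_mat_def diag_matrix_nth)

section \<open>Simultaneous diagonalization\<close>

text \<open>A maximiser of the Rayleigh quotient on the unit sphere of \<open>W\<close> must be an
  eigenvector, since moving it against its residual \<open>r\<close> would otherwise raise the
  quotient; invariance keeps \<open>r\<close> in \<open>W\<close>. The inner product is real, so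
  that complex matrices are covered by viewing C^n as a real Euclidean space.\<close>

lemma selfadjoint_eigenvector:
  fixes f :: "'a::euclidean_space \<Rightarrow> 'a"
  assumes f: "linear f" and W: "subspace W" "f ` W \<subseteq> W" "W \<noteq> {0}"
    and sa: "\<And>x y. inner (f x) y = inner x (f y)"
  obtains x c where "x \<in> W" "x \<noteq> 0" "f x = c *\<^sub>R x"
proof -
  let ?S = "sphere 0 1 \<inter> W"
  obtain w where w: "w \<in> W" "w \<noteq> 0"
    using W subspace_0 by blast
  then have "(1 / norm w) *\<^sub>R w \<in> ?S"
    using W by (auto intro: subspace_scale)
  moreover have "compact ?S"
    by (intro compact_Int_closed compact_sphere closed_subspace W(1))
  moreover have "continuous_on ?S (\<lambda>x. inner x (f x))"
    using linear_continuous_on[OF linear_conv_bounded_linear[THEN iffD1, OF f]]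
    by (intro continuous_intros) auto
  ultimately obtain x where x: "x \<in> ?S" and max: "\<And>y. y \<in> ?S \<Longrightarrow> inner y (f y) \<le> inner x (f x)"
    using continuous_attains_sup[of ?S "\<lambda>x. inner x (f x)"] by (metis empty_iff)
  define \<mu> where "\<mu> = inner x (f x)"
  have le: "inner y (f y) \<le> \<mu> * inner y y" if "y \<in> W" for y
  proof (cases "y = 0")
    case False
    then have "(1 / norm y) *\<^sub>R y \<in> ?S"
      using W that by (auto intro: subspace_scale)
    from max[OF this] have "inner y (f y) / (norm y)\<^sup>2 \<le> \<mu>"
      by (simp add: linear_scale[OF f] \<mu>_def power2_eq_square)
    then show ?thesis
      using False by (simp add: divide_simps power2_norm_eq_inner split: if_splits)
  qed simp
  have x1: "x \<in> W" "inner x x = 1"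
    using x by (auto simp: norm_eq_1)
  define r where "r = \<mu> *\<^sub>R x - f x"
  have rW: "r \<in> W"
    using W x1 by (auto simp: r_def intro!: subspace_diff subspace_scale)
  define q where "q = \<mu> * inner r r - inner r (f r)"
  have q0: "0 \<le> q"
    using le[OF rW] by (simp add: q_def)
  \<comment> \<open>Insert \<open>x - s *\<^sub>R r\<close> into \<open>le\<close>: the terms of
    order zero in \<open>s\<close> cancel and \<open>s * (s * q - 2 * inner r r)\<close>
    remains.\<close>
  have *: "2 * inner r r \<le> s * q" if "s > 0" for s
  proof -
    let ?y = "x - s *\<^sub>R r"
    have "?y \<in> W"
      using W x1 rW by (auto intro!: subspace_diff subspace_scale)
    from le[OF this] have "0 \<le> \<mu> * inner ?y ?y - inner ?y (f ?y)"
      by simp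
    also have "inner ?y ?y = 1 - 2 * s * inner x r + s^2 * inner r r"
      using x1 by (simp add: inner_diff inner_commute power2_eq_square algebra_simps)
    also have "inner ?y (f ?y) = \<mu> - 2 * s * inner (f x) r + s^2 * inner r (f r)"
      using sa[of x r] sa[of r x]
      by (simp add: linear_diff[OF f] linear_scale[OF f] inner_diff inner_commute
          power2_eq_square algebra_simps \<mu>_def)
    also have "\<mu> * (1 - 2 * s * inner x r + s^2 * inner r r) -
        (\<mu> - 2 * s * inner (f x) r + s^2 * inner r (f r)) = s * (s * q - 2 * inner r r)"
      unfolding q_def by (simp add: r_def inner_diff algebra_simps power2_eq_square)
    finally show ?thesis
      using that by (simp add: zero_le_mult_iff)
  qed
  have "inner r r = 0"
  proof (rule ccontr)
    assume "inner r r \<noteq> 0"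
    then have p: "inner r r > 0"
      by simp
    \<comment> \<open>This is \<open>*\<close> with s = |r|^2 / (q + 1), so small that s q \<le>
      |r|^2; the summand 1 covers q = 0.\<close>
    have "2 * inner r r \<le> inner r r / (q + 1) * q"
      using p q0 by (intro *) simp
    also have "\<dots> \<le> inner r r"
      using p q0 by (simp add: field_simps)
    finally show False
      using p by simp
  qed
  then have "f x = \<mu> *\<^sub>R x"
    by (simp add: r_def)
  moreover have "x \<noteq> 0"
    using x1 by auto
  ultimately show ?thesis
    using that x1 by blast
qed

section \<open>The complex inner product and joint eigenvectors\<close>

definition hermitian_inner :: "complex^'n::finite \<Rightarrow> complex^'n \<Rightarrow> complex" where
  "hermitian_inner x y = (\<Sum>i\<in>UNIV. cnj (x $ i) * y $ i)"

lemma hermitian_inner_adjoint: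
  "hermitian_inner x (M *v y) = hermitian_inner (adjoint_mat M *v x) y"
proof -
  have "hermitian_inner x (M *v y) = (\<Sum>i\<in>UNIV. \<Sum>j\<in>UNIV. cnj (x $ i) * M $ i $ j * y $ j)"
    by (simp add: hermitian_inner_def matrix_vector_mult_def sum_distrib_left mult_ac)
  also have "\<dots> = (\<Sum>j\<in>UNIV. \<Sum>i\<in>UNIV. cnj (x $ i) * M $ i $ j * y $ j)"
    by (rule sum.swap)
  also have "\<dots> = hermitian_inner (adjoint_mat M *v x) y"
    by (simp add: hermitian_inner_def matrix_vector_mult_def sum_distrib_left sum_distrib_right mult_ac)
  finally show ?thesis .
qed

lemma inner_eq_Re_hermitian_inner: "inner x y = Re (hermitian_inner x y)"
  by (simp add: inner_vec_def hermitian_inner_def inner_complex_def)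

lemma hermitian_inner_scale: 
  "hermitian_inner x (c *s y) = c * hermitian_inner x y"
  "hermitian_inner (c *s x) y = cnj c * hermitian_inner x y"
  by (simp_all add: hermitian_inner_def sum_distrib_left mult_ac)

lemma hermitian_inner_add: "hermitian_inner x (y + z) = hermitian_inner x y + hermitian_inner x z"
  by (simp add: hermitian_inner_def ring_distribs sum.distrib)

lemma hermitian_inner_commute: "hermitian_inner y x = cnj (hermitian_inner x y)"
  by (simp add: hermitian_inner_def mult.commute)

lemma hermitian_inner_self: "hermitian_inner x x = of_real ((norm x)\<^sup>2)"
proof -
  have "Im (hermitian_inner x x) = 0"
    by (metis hermitian_inner_commute Reals_cnj_iff complex_is_Real_iff)
  then show ?thesis
    by (simp add: complex_eq_iff power2_norm_eq_inner inner_eq_Re_hermitian_inner)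
qed

lemma scaleR_eq_scalar_mult_complex: "r *\<^sub>R (x::complex^'n) = of_real r *s x"
  by (simp add: vec_eq_iff scaleR_conv_of_real[where 'a=complex])

text \<open>Commuting matrices preserve each other's eigenspaces. Hence the joint eigenspace for the
  indices treated so far is invariant under the next matrix, and
  \<open>selfadjoint_eigenvector\<close> can be applied inside it.\<close>

lemma joint_eigenvector:
  fixes a :: "'m::finite \<Rightarrow> complex^'n::finite^'n"
  assumes a: "\<And>j. adjoint_mat (a j) = a j" "\<And>i j. a i ** a j = a j ** a i"
    and W: "subspace W" "\<And>c x. x \<in> W \<Longrightarrow> c *s x \<in> W" "\<And>j x. x \<in> W \<Longrightarrow> a j *v x \<in> W" "W \<noteq> {0}"
  obtains x c where "x \<in> W" "x \<noteq> 0" "\<And>j. a j *v x = c j *s x"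
proof -
  have "\<exists>c. {x \<in> W. \<forall>j\<in>J. a j *v x = c j *s x} \<noteq> {0}" if "finite J" for J
    using that
  proof (induction J rule: finite_induct)
    case empty
    then show ?case
      using W by simp
  next
    case (insert k J)
    then obtain c where c: "{x \<in> W. \<forall>j\<in>J. a j *v x = c j *s x} \<noteq> {0}" (is "?V \<noteq> _")
      by blast
    have V1: "subspace ?V"
      using W(1) unfolding subspace_def
      by (auto simp: matrix_vector_right_distrib vector_add_ldistrib
           scaleR_eq_scalar_mult_complex vector_scalar_commute vector_smult_assoc mult.commute)
    have V2: "(*v) (a k) ` ?V \<subseteq> ?V"
    proof (rule image_subsetI)
      fix x assume x: "x \<in> ?V"
      have "a j *v (a k *v x) = a k *v (a j *v x)" for j
        by (simp add: matrix_vector_mul_assoc a(2)[of j k])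
      then show "a k *v x \<in> ?V"
        using x W by (simp add: vector_scalar_commute)
    qed
    have lin: "linear ((*v) (a k))"
      by (simp add: bounded_linear.linear matrix_vector_mul_bounded_linear)
    have sa: "inner (a k *v x) y = inner x (a k *v y)" for x y
      by (simp add: inner_eq_Re_hermitian_inner hermitian_inner_adjoint[of _ "a k"] a)
    obtain x r where x: "x \<in> ?V" "x \<noteq> 0" "a k *v x = r *\<^sub>R x"
      using selfadjoint_eigenvector[OF lin V1 V2 c sa] by blast
    then have "x \<in> {x \<in> W. \<forall>j\<in>insert k J. a j *v x = (c(k := of_real r)) j *s x}"
      using insert by (auto simp: scaleR_eq_scalar_mult_complex)
    then show ?case
      using x by blast
  qed
  from this[of UNIV] obtain c where c: "{x \<in> W. \<forall>j. a j *v x = c j *s x} \<noteq> {0}"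
    by auto
  moreover have "0 \<in> {x \<in> W. \<forall>j. a j *v x = c j *s x}"
    using W(1) by (simp add: subspace_0)
  ultimately show ?thesis
    using that by blast
qed

text \<open>Vectors are collected one index at a time. The orthogonal complement of those already
  found is invariant, because the matrices are self-adjoint and the found vectors are joint
  eigenvectors; \<open>joint_eigenvector\<close> then supplies the next vector there.\<close>

lemma joint_eigenbasis:
  fixes a :: "'m::finite \<Rightarrow> complex^'n::finite^'n"
  assumes a: "\<And>j. adjoint_mat (a j) = a j" "\<And>i j. a i ** a j = a j ** a i"
  obtains u c where "\<And>i k. hermitian_inner (u i) (u k) = (if i = k then 1 else 0)"
    "\<And>i j. a j *v u i = c i j *s u (i::'n)"
proof -
  have "\<exists>u c. (\<forall>i\<in>I. \<forall>k\<in>I. hermitian_inner (u i) (u k) = (if i = k then 1 else 0)) \<and>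
     (\<forall>i\<in>I. \<forall>j. a j *v u i = c i j *s u i)" if "finite I" for I :: "'n set"
    using that
  proof (induction I rule: finite_induct)
    case (insert l I)
    from insert.IH obtain u c where
      "\<forall>i\<in>I. \<forall>k\<in>I. hermitian_inner (u i) (u k) = (if i = k then 1 else 0)"
      "\<forall>i\<in>I. \<forall>j. a j *v u i = c i j *s u i"
      by (elim exE conjE)
    then have
      u: "\<And>i k. i \<in> I \<Longrightarrow> k \<in> I \<Longrightarrow> hermitian_inner (u i) (u k) = (if i = k then 1 else 0)" and
      c: "\<And>i j. i \<in> I \<Longrightarrow> a j *v u i = c i j *s u i"
      by simp_all
    define W where "W = {w. \<forall>i\<in>I. hermitian_inner (u i) w = 0}"
    \<comment> \<open>A determinant replaces a dimension count: row \<open>l\<close> of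
      \<open>M\<close> vanishes because \<open>l\<close> is not in \<open>I\<close>, so
      \<open>M\<close> is singular, and a kernel vector is orthogonal to every \<open>u i\<close>
      with \<open>i\<close> in \<open>I\<close>.\<close>
    define M :: "complex^'n^'n" where "M = (\<chi> i k. if i \<in> I then cnj (u i $ k) else 0)"
    have "row l M = 0"
      using insert by (simp add: M_def row_def vec_eq_iff)
    then have "det M = 0"
      by (rule det_zero_row(1))
    then have "\<not> invertible M"
      by (simp add: invertible_det_nz)
    then obtain w where w: "M *v w = 0" "w \<noteq> 0"
      using matrix_left_invertible_ker[of M] by (auto simp: invertible_left_inverse)
    have "w \<in> W"
      unfolding W_def
    proof safe
      fix i assume "i \<in> I"
      then show "hermitian_inner (u i) w = 0"
        using arg_cong[OF w(1), of "\<lambda>v. v $ i"]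
        by (simp add: M_def matrix_vector_mult_def hermitian_inner_def)
    qed
    then have W0: "W \<noteq> {0}"
      using w by blast
    have Wa: "a j *v x \<in> W" if "x \<in> W" for j x
      using that by (auto simp: W_def hermitian_inner_adjoint a c hermitian_inner_scale)
    have Ws: "subspace W"
      by (auto simp: subspace_def W_def hermitian_inner_add scaleR_eq_scalar_mult_complex hermitian_inner_scale)
         (simp add: hermitian_inner_def)
    have Wc: "r *s x \<in> W" if "x \<in> W" for r x
      using that by (auto simp: W_def hermitian_inner_scale)
    obtain x d where x: "x \<in> W" "x \<noteq> 0" "\<And>j. a j *v x = d j *s x"
      by (rule joint_eigenvector[of a W, OF a Ws Wc Wa W0]) (assumption | rule that)+
    define y where "y = of_real (1 / norm x) *s x"
    then have "y = (1 / norm x) *\<^sub>R x"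
      by (simp only: scaleR_eq_scalar_mult_complex)
    then have "norm y = 1"
      using x by simp
    then have y: "hermitian_inner y y = 1"
      by (simp add: hermitian_inner_self)
    have yu: "hermitian_inner (u i) y = 0" "hermitian_inner y (u i) = 0" if "i \<in> I" for i
      using x(1) that by (auto simp: y_def W_def hermitian_inner_scale hermitian_inner_commute[of _ "u i"])
    have yd: "a j *v y = d j *s y" for j
      by (simp add: y_def vector_scalar_commute x vector_smult_assoc mult.commute)
    have "hermitian_inner ((u(l := y)) i) ((u(l := y)) k) = (if i = k then 1 else 0)"
      if "i \<in> insert l I" "k \<in> insert l I" for i k
      using insert.hyps(2) u y yu that by auto
    moreover have "a j *v (u(l := y)) i = (c(l := d)) i j *s (u(l := y)) i" if "i \<in> insert l I" for i j
      using insert.hyps(2) c yd that by auto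
    ultimately show ?case
      by (intro exI[of _ "u(l := y)"] exI[of _ "c(l := d)"]) (intro conjI ballI allI)
  qed simp
  from this[OF finite, of UNIV] obtain u c where
    "\<forall>i\<in>UNIV :: 'n set. \<forall>k\<in>UNIV. hermitian_inner (u i) (u k) = (if i = k then 1 else 0)"
    "\<forall>i\<in>UNIV. \<forall>j. a j *v u i = c i j *s u i"
    by (elim exE conjE)
  then show ?thesis
    using that[of u c] by simp
qed

theorem simultaneous_diagonalization:
  fixes a :: "'m::finite \<Rightarrow> complex^'n::finite^'n"
  assumes "abelian_family matrix_algebra a"
  obtains U D where "diagonalization a U D"
proof -
  have a: "adjoint_mat (a j) = a j" "a i ** a j = a j ** a i" for i j
    using assms by (auto simp: abelian_family_def matrix_algebra_def)
  obtain u c where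
    u: "\<And>i k. hermitian_inner (u i) (u k) = (if i = k then 1 else 0)" and
    c: "\<And>i j. a j *v u i = c i j *s u (i::'n)"
    by (rule joint_eigenbasis[of a, OF a]) (rule that)
  \<comment> \<open>The conjugates make the columns of \<open>adjoint_mat U\<close> the eigenvectors
    themselves.\<close>
  define U :: "complex^'n^'n" where "U = (\<chi> i k. cnj (u i $ k))"
  have "U ** adjoint_mat U = mat 1"
    using u by (simp add: vec_eq_iff matrix_matrix_mult_def U_def mat_def hermitian_inner_def)
  then have U: "U \<in> unitaries matrix_algebra"
    by (rule unitary_matrixI)
  have "(a j ** adjoint_mat U) $ i $ k = (a j *v u k) $ i" for i j k
    by (simp add: matrix_matrix_mult_def matrix_vector_mult_def U_def)
  then have "(a j ** adjoint_mat U) $ i $ k = (adjoint_mat U ** diag_matrix (\<lambda>i. c i j)) $ i $ k" for i j k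
    by (simp add: c diag_matrix_mult_right U_def mult.commute)
  then have "a j ** adjoint_mat U = adjoint_mat U ** diag_matrix (\<lambda>i. c i j)" for j
    by (simp add: vec_eq_iff)
  then have "a j = adjoint_mat U ** diag_matrix (\<lambda>i. c i j) ** U" for j
    using U by (metis matrix_mul_assoc matrix_mul_rid unitary_adjoint_mult(1))
  then have "diagonalization a U (\<lambda>j. diag_matrix (\<lambda>i. c i j))"
    by (simp add: diagonalization_def U diagonal_mat_diag_matrix)
  then show ?thesis
    by (rule that)
qed

lemma diagonalization_real:
  fixes a :: "'m::finite \<Rightarrow> complex^'n::finite^'n"
  assumes d: "diagonalization a U D" and sa: "\<And>j. adjoint_mat (a j) = a j"
  shows "D j = diag_matrix (\<lambda>i. of_real (Re (D j $ i $ i)))"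
proof -
  have U: "U \<in> unitaries matrix_algebra" and a: "a j = adjoint_mat U ** D j ** U" and dD: "diagonal_mat (D j)"
    using d by (auto simp: diagonalization_def)
  have D: "D j = U ** a j ** adjoint_mat U"
    using U by (simp add: a matrix_mul_assoc[symmetric] unitary_adjoint_mult)
  have "adjoint_mat (D j) = D j"
    by (simp add: D adjoint_mat_mult sa matrix_mul_assoc)
  then have "cnj (D j $ i $ i) = D j $ i $ i" for i
    by (metis adjoint_mat_nth)
  then have "D j $ i $ i = of_real (Re (D j $ i $ i))" for i
    by (metis Reals_cnj_iff of_real_Re)
  then show ?thesis
    using diagonal_mat_eq[OF dD] by simp
qed

section \<open>The two algebras\<close>

lemma matrix_algebra_simps [simp]:
  "carrier matrix_algebra = UNIV"
  "M \<otimes>\<^bsub>matrix_algebra\<^esub> N = M ** N"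
  "\<one>\<^bsub>matrix_algebra\<^esub> = mat 1"
  "\<zero>\<^bsub>matrix_algebra\<^esub> = 0"
  "M \<oplus>\<^bsub>matrix_algebra\<^esub> N = M + N"
  "star matrix_algebra M = adjoint_mat M"
  "nrm matrix_algebra M = onorm ((*v) M)"
  by (simp_all add: matrix_algebra_def)

lemma matrix_algebra_smult: "c \<odot>\<^bsub>matrix_algebra\<^esub> M = (\<chi> i j. c * M $ i $ j)"
  by (simp add: matrix_algebra_def)

lemma matrix_algebra_smult_of_real [simp]: "complex_of_real r \<odot>\<^bsub>matrix_algebra\<^esub> M = r *\<^sub>R M"
  by (simp add: matrix_algebra_smult vec_eq_iff scaleR_conv_of_real[where 'a=complex])

text \<open>In the record, \<ominus> is built from the inverse in the additive monoid; identifying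
  it with the subtraction of matrices requires the group laws.\<close>

lemma abelian_group_matrix_algebra: "abelian_group (matrix_algebra :: (complex^'n^'n) cstar)"
  by (rule abelian_groupI) (auto simp: add_ac intro!: exI[of _ "- _"])

lemma matrix_algebra_minus [simp]: "M \<ominus>\<^bsub>matrix_algebra\<^esub> N = M - N"
proof -
  interpret abelian_group "matrix_algebra :: (complex^'n^'n) cstar"
    by (rule abelian_group_matrix_algebra)
  have "\<ominus>\<^bsub>matrix_algebra\<^esub> N = - N"
    by (rule minus_equality) simp_all
  then show ?thesis
    by (simp add: a_minus_def)
qed

lemma cont_matrix_algebra_simps [simp]:
  "carrier (cont_matrix_algebra X) = {F \<in> extensional X. continuous_on X F}"
  "F \<otimes>\<^bsub>cont_matrix_algebra X\<^esub> G = (\<lambda>x\<in>X. F x ** G x)"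
  "\<one>\<^bsub>cont_matrix_algebra X\<^esub> = (\<lambda>x\<in>X. mat 1)"
  "\<zero>\<^bsub>cont_matrix_algebra X\<^esub> = (\<lambda>x\<in>X. 0)"
  "F \<oplus>\<^bsub>cont_matrix_algebra X\<^esub> G = (\<lambda>x\<in>X. F x + G x)"
  "c \<odot>\<^bsub>cont_matrix_algebra X\<^esub> F = (\<lambda>x\<in>X. c \<odot>\<^bsub>matrix_algebra\<^esub> F x)"
  "star (cont_matrix_algebra X) F = (\<lambda>x\<in>X. adjoint_mat (F x))"
  "nrm (cont_matrix_algebra X) F = Sup (insert 0 ((\<lambda>x. onorm ((*v) (F x))) ` X))"
  by (simp_all add: cont_matrix_algebra_def)

lemma continuous_on_restrict_iff [simp]: "continuous_on X (restrict f X) \<longleftrightarrow> continuous_on X f"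
  by (rule continuous_on_cong) auto

lemma abelian_group_cont_matrix_algebra: "abelian_group (cont_matrix_algebra X)"
proof (rule abelian_groupI)
  fix F assume "F \<in> carrier (cont_matrix_algebra X)"
  then show "\<exists>G\<in>carrier (cont_matrix_algebra X).
      G \<oplus>\<^bsub>cont_matrix_algebra X\<^esub> F = \<zero>\<^bsub>cont_matrix_algebra X\<^esub>"
    by (intro bexI[of _ "\<lambda>x\<in>X. - F x"]) (auto intro!: continuous_intros restrict_ext)
qed (auto intro!: continuous_intros ext simp: add_ac extensional_def)

lemma cont_matrix_algebra_minus:
  assumes "F \<in> carrier (cont_matrix_algebra X)" "G \<in> carrier (cont_matrix_algebra X)"
  shows "F \<ominus>\<^bsub>cont_matrix_algebra X\<^esub> G = (\<lambda>x\<in>X. F x - G x)"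
proof -
  interpret abelian_group "cont_matrix_algebra X"
    by (rule abelian_group_cont_matrix_algebra)
  have "\<ominus>\<^bsub>cont_matrix_algebra X\<^esub> G = (\<lambda>x\<in>X. - G x)"
    using assms by (intro minus_equality) (auto intro!: continuous_intros restrict_ext)
  then show ?thesis
    by (auto simp: a_minus_def intro!: restrict_ext)
qed

section \<open>Equivalence of the operator norm and the library norm\<close>

lemma norm_matrix_le_sum: "norm M \<le> (\<Sum>i\<in>UNIV. \<Sum>j\<in>UNIV. norm (M $ i $ j))"
  for M :: "complex^'m::finite^'n::finite"
proof -
  have "norm M \<le> (\<Sum>i\<in>UNIV. norm (M $ i))"
    unfolding norm_vec_def[of M] by (rule L2_set_le_sum) simp
  also have "\<dots> \<le> (\<Sum>i\<in>UNIV. \<Sum>j\<in>UNIV. norm (M $ i $ j))"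
    by (intro sum_mono) (simp add: norm_vec_def L2_set_le_sum)
  finally show ?thesis .
qed

lemma matrix_entry_norm_le: "norm (M $ i $ j) \<le> norm M"
  for M :: "complex^'n::finite^'n"
  by (meson Finite_Cartesian_Product.norm_nth_le order_trans)

text \<open>An entry is a component of the image of a unit axis vector, so the operator norm bounds
  it; there are n^2 entries. Constants are kept crude throughout, as only convergence
  matters.\<close>

lemma norm_le_onorm_mult:
  "norm M \<le> real CARD('n) * real CARD('n) * onorm ((*v) M)" for M :: "complex^'n::finite^'n"
proof -
  have "norm (M $ i $ j) \<le> onorm ((*v) M)" for i j
  proof -
    have "M $ i $ j = (M *v axis j 1) $ i"
      by (simp add: matrix_vector_mult_def axis_def if_distrib[of "\<lambda>x. _ * x"] cong: if_cong)
    then have "norm (M $ i $ j) \<le> norm (M *v axis j 1)"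
      by (simp add: Finite_Cartesian_Product.norm_nth_le)
    also have "\<dots> \<le> onorm ((*v) M) * norm (axis j (1::complex))"
      by (rule onorm) (rule matrix_vector_mul_bounded_linear)
    also have "norm (axis j (1::complex)) = 1"
      by (simp add: norm_vec_def axis_def L2_set_def if_distrib[of norm] if_distrib[of "\<lambda>x. x\<^sup>2"] cong: if_cong)
    finally show ?thesis
      by simp
  qed
  then have "(\<Sum>i\<in>UNIV. \<Sum>j\<in>UNIV. norm (M $ i $ j)) \<le> (\<Sum>i\<in>(UNIV::'n set). \<Sum>j\<in>(UNIV::'n set). onorm ((*v) M))"
    by (intro sum_mono)
  then show ?thesis
    using norm_matrix_le_sum[of M] by (simp add: mult_ac)
qed

lemma onorm_le_norm_mult:
  "onorm ((*v) M) \<le> real CARD('n) * real CARD('n) * norm M" for M :: "complex^'n::finite^'n"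
proof (rule onorm_le)
  fix x :: "complex^'n"
  have "norm (M *v x) \<le> (\<Sum>i\<in>UNIV. norm ((M *v x) $ i))"
    unfolding norm_vec_def by (rule L2_set_le_sum) simp
  also have "\<dots> \<le> (\<Sum>i\<in>(UNIV::'n set). \<Sum>j\<in>(UNIV::'n set). norm M * norm x)"
  proof (rule sum_mono)
    fix i
    have "norm ((M *v x) $ i) \<le> (\<Sum>j\<in>UNIV. norm (M $ i $ j * x $ j))"
      by (simp add: matrix_vector_mult_def norm_sum)
    also have "\<dots> \<le> (\<Sum>j\<in>(UNIV::'n set). norm M * norm x)"
      by (intro sum_mono) (simp add: norm_mult mult_mono matrix_entry_norm_le Finite_Cartesian_Product.norm_nth_le)
    finally show "norm ((M *v x) $ i) \<le> (\<Sum>j\<in>(UNIV::'n set). norm M * norm x)" .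
  qed
  finally show "norm (M *v x) \<le> real CARD('n) * real CARD('n) * norm M * norm x"
    by (simp add: mult_ac)
qed

text \<open>Compactness of \<open>X\<close> bounds the set under \<open>Sup\<close>, which is what
  makes \<open>Sup\<close> an upper bound.\<close>

lemma onorm_le_cont_norm:
  fixes F :: "'x::metric_space \<Rightarrow> complex^'n::finite^'n"
  assumes "compact X" "F \<in> carrier (cont_matrix_algebra X)" "x \<in> X"
  shows "onorm ((*v) (F x)) \<le> nrm (cont_matrix_algebra X) F"
proof -
  have "bounded (F ` X)"
    using assms by (auto intro: compact_imp_bounded compact_continuous_image)
  then obtain b where b: "\<And>x. x \<in> X \<Longrightarrow> norm (F x) \<le> b"
    by (auto simp: bounded_iff)
  have "onorm ((*v) (F x)) \<le> real CARD('n) * real CARD('n) * b" if "x \<in> X" for x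
    using onorm_le_norm_mult[of "F x"] b[OF that]
    by (meson mult_left_mono mult_nonneg_nonneg of_nat_0_le_iff order_trans)
  then have "bdd_above (insert 0 ((\<lambda>x. onorm ((*v) (F x))) ` X))"
    by (simp only: bdd_above_insert) (auto simp: bdd_above_def)
  then show ?thesis
    using assms(3) by (auto intro: cSup_upper)
qed

lemma cont_norm_le:
  assumes "\<And>x. x \<in> X \<Longrightarrow> onorm ((*v) (F x)) \<le> e" "0 \<le> e"
  shows "nrm (cont_matrix_algebra X) F \<le> e"
  using assms by (auto intro!: cSup_least)

text \<open>Every row of a unitary matrix has Euclidean norm one.\<close>

lemma norm_unitary_entry_le:
  assumes "U \<in> unitaries matrix_algebra"
  shows "norm (U $ i $ j) \<le> 1"
proof -
  have "(U ** adjoint_mat U) $ i $ i = 1"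
    using assms by (simp add: unitary_adjoint_mult mat_def)
  then have "(\<Sum>k\<in>UNIV. of_real ((norm (U $ i $ k))\<^sup>2)) = (1::complex)"
    unfolding complex_norm_square by (simp add: matrix_matrix_mult_def)
  then have "(\<Sum>k\<in>UNIV. (norm (U $ i $ k))\<^sup>2) = 1"
    by (metis (no_types, lifting) of_real_eq_1_iff of_real_sum sum.cong)
  moreover have "(norm (U $ i $ j))\<^sup>2 \<le> (\<Sum>k\<in>UNIV. (norm (U $ i $ k))\<^sup>2)"
    by (rule member_le_sum) auto
  ultimately show ?thesis
    by (simp add: power_le_one_iff abs_square_le_1)
qed

lemma norm_matrix_mult_entry_le:
  fixes M N :: "complex^'n::finite^'n"
  assumes "\<And>i j. norm (M $ i $ j) \<le> a" "\<And>i j. norm (N $ i $ j) \<le> b"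
  shows "norm ((M ** N) $ i $ j) \<le> real CARD('n) * (a * b)"
proof -
  have a: "0 \<le> a"
    using assms(1) norm_ge_zero order_trans by blast
  have "norm ((M ** N) $ i $ j) \<le> (\<Sum>k\<in>UNIV. norm (M $ i $ k * N $ k $ j))"
    by (simp add: matrix_matrix_mult_def norm_sum)
  also have "\<dots> \<le> (\<Sum>k\<in>(UNIV::'n set). a * b)"
    by (intro sum_mono) (simp add: norm_mult mult_mono assms a)
  finally show ?thesis
    by simp
qed

section \<open>Functional calculus of a diagonalized family\<close>

text \<open>A joint eigenvalue as a point of R^m. For self-adjoint families the diagonal entries are
  real by \<open>diagonalization_real\<close>, so \<open>Re\<close> discards nothing.\<close>

definition diag_point :: "('m::finite \<Rightarrow> complex^'n^'n) \<Rightarrow> 'n \<Rightarrow> real^'m" where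
  "diag_point D i = (\<chi> j. Re (D j $ i $ i))"

definition mat_calculus ::
    "complex^'n^'n \<Rightarrow> ('m::finite \<Rightarrow> complex^'n^'n) \<Rightarrow> (real^'m \<Rightarrow> real) \<Rightarrow> complex^'n::finite^'n" where
  "mat_calculus U D f =
     adjoint_mat U ** diag_matrix (\<lambda>i. complex_of_real (f (diag_point D i))) ** U"

lemma matrix_add_rdistrib: "(M + N) ** P = M ** P + N ** P"
  for M N P :: "complex^'n::finite^'n"
  by (simp add: vec_eq_iff matrix_matrix_mult_def ring_distribs sum.distrib)

lemma mat_calculus_add: "mat_calculus U D (\<lambda>x. f x + g x) = mat_calculus U D f + mat_calculus U D g"
  by (simp add: mat_calculus_def diag_matrix_add[symmetric] matrix_add_ldistrib matrix_add_rdistrib)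

lemma mat_calculus_mult:
  "U \<in> unitaries matrix_algebra \<Longrightarrow>
    mat_calculus U D (\<lambda>x. f x * g x) = mat_calculus U D f ** mat_calculus U D g"
  by (simp add: mat_calculus_def diag_matrix_mult[symmetric] matrix_mul_assoc[symmetric] unitary_adjoint_mult)

lemma diag_matrix_scaleR: "diag_matrix (\<lambda>i. complex_of_real r) = r *\<^sub>R mat 1"
  by (simp add: vec_eq_iff diag_matrix_nth mat_def scaleR_conv_of_real[where 'a=complex])

lemma matrix_mult_scaleR: "(r *\<^sub>R M) ** N = r *\<^sub>R (M ** N)" "M ** (r *\<^sub>R N) = r *\<^sub>R (M ** N)"
  for M N :: "complex^'n::finite^'n"
  by (simp_all add: vec_eq_iff matrix_matrix_mult_def scaleR_sum_right)

lemma mat_calculus_const: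
  "U \<in> unitaries matrix_algebra \<Longrightarrow> mat_calculus U D (\<lambda>x. r) = r *\<^sub>R mat 1"
  by (simp add: mat_calculus_def diag_matrix_scaleR matrix_mult_scaleR unitary_adjoint_mult)

lemma adjoint_mat_calculus: "adjoint_mat (mat_calculus U D f) = mat_calculus U D f"
  by (simp add: mat_calculus_def adjoint_mat_mult adjoint_diag_matrix matrix_mul_assoc)

lemma mat_calculus_cong:
  "(\<And>i. f (diag_point D i) = g (diag_point D i)) \<Longrightarrow> mat_calculus U D f = mat_calculus U D g"
  by (simp add: mat_calculus_def)

lemma mat_calculus_coordinate:
  assumes "diagonalization a U D" "\<And>j. adjoint_mat (a j) = a j"
  shows "mat_calculus U D (\<lambda>x. x $ j) = a j"
  using assms diagonalization_real[OF assms, of j]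
  by (simp add: mat_calculus_def diag_point_def diagonalization_def)

text \<open>Each of the two matrix products costs a factor n, by
  \<open>norm_matrix_mult_entry_le\<close>, and passing from entries to the norm costs n^2.\<close>

lemma norm_mat_calculus_diff_le:
  fixes U :: "complex^'n::finite^'n"
  assumes U: "U \<in> unitaries matrix_algebra"
    and e: "\<And>i. \<bar>f (diag_point D i) - g (diag_point D i)\<bar> \<le> e"
  shows "norm (mat_calculus U D f - mat_calculus U D g) \<le> real CARD('n) ^ 4 * e"
proof -
  have "mat_calculus U D f - mat_calculus U D g = mat_calculus U D (\<lambda>x. f x - g x)" (is "_ = ?M")
    using mat_calculus_add[of U D "\<lambda>x. f x - g x" g] by simp
  moreover have "norm (?M $ i $ j) \<le> real CARD('n) * (real CARD('n) * (1 * e) * 1)" for i j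
    unfolding mat_calculus_def
  proof (intro norm_matrix_mult_entry_le)
    have "0 \<le> e"
      \<comment> \<open>The hypothesis at any single index suffices; \<open>undefined\<close> merely
        names one.\<close>
      using e[of undefined] by linarith
    then show "norm (diag_matrix (\<lambda>i. complex_of_real (f (diag_point D i) - g (diag_point D i))) $ i $ j) \<le> e" for i j
      using e by (simp add: diag_matrix_nth del: of_real_diff)
    show "norm (adjoint_mat U $ i $ j) \<le> 1" "norm (U $ i $ j) \<le> 1" for i j
      using norm_unitary_entry_le[OF U] by simp_all
  qed
  then have "(\<Sum>i\<in>UNIV. \<Sum>j\<in>UNIV. norm (?M $ i $ j)) \<le>
      (\<Sum>i\<in>(UNIV::'n set). \<Sum>j\<in>(UNIV::'n set). real CARD('n) * (real CARD('n) * (1 * e) * 1))"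
    by (intro sum_mono)
  ultimately show ?thesis
    using norm_matrix_le_sum[of ?M] by (simp add: eval_nat_numeral mult_ac)
qed

lemma trace_mat_calculus:
  assumes "U \<in> unitaries matrix_algebra"
  shows "trace (mat_calculus U D f) = of_real (\<Sum>i\<in>UNIV. f (diag_point D i))"
proof -
  have "trace (mat_calculus U D f) = trace (U ** (adjoint_mat U ** diag_matrix (\<lambda>i. complex_of_real (f (diag_point D i)))))"
    unfolding mat_calculus_def by (rule trace_mul_sym)
  then show ?thesis
    using assms by (simp add: unitary_adjoint_mult trace_def diag_matrix_nth)
qed

text \<open>The hull is an intersection and each closure condition passes to intersections. The
  subalgebra \<open>C\<close> guarantees that the family intersected is not empty; otherwise the
  hull would be the whole type.\<close>

lemma cstar_subalgebra_generated:
  assumes "cstar_subalgebra \<AA> C" "G \<subseteq> C"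
  shows "cstar_subalgebra \<AA> (generated_cstar \<AA> G)" "G \<subseteq> generated_cstar \<AA> G"
    "generated_cstar \<AA> G \<subseteq> C"
proof -
  let ?I = "generated_cstar \<AA> G"
  show sub: "G \<subseteq> ?I" "?I \<subseteq> C"
    using assms by (auto simp: generated_cstar_def hull_subset intro: hull_minimal[THEN subsetD])
  have mem: "x \<in> ?I \<longleftrightarrow> (\<forall>S. cstar_subalgebra \<AA> S \<longrightarrow> G \<subseteq> S \<longrightarrow> x \<in> S)" for x
    by (auto simp: generated_cstar_def hull_def)
  show "cstar_subalgebra \<AA> ?I"
    unfolding cstar_subalgebra_def
  proof (intro conjI ballI allI impI)
    show "?I \<subseteq> carrier \<AA>"
      using sub(2) assms(1) by (auto simp: cstar_subalgebra_def)
    fix a assume "a \<in> carrier \<AA>" and *: "\<forall>e>0. \<exists>b\<in>?I. nrm \<AA> (a \<ominus>\<^bsub>\<AA>\<^esub> b) < e"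
    show "a \<in> ?I"
      unfolding mem
    proof (intro allI impI)
      fix S assume S: "cstar_subalgebra \<AA> S" "G \<subseteq> S"
      then have "?I \<subseteq> S"
        using mem by blast
      then have "\<forall>e>0. \<exists>b\<in>S. nrm \<AA> (a \<ominus>\<^bsub>\<AA>\<^esub> b) < e"
        using * by blast
      then show "a \<in> S"
        using S(1) \<open>a \<in> carrier \<AA>\<close> unfolding cstar_subalgebra_def by blast
    qed
  qed (auto simp: mem, (auto simp: cstar_subalgebra_def)+)
qed

lemma character_on_subset: "character_on \<AA> C h \<Longrightarrow> S \<subseteq> C \<Longrightarrow> character_on \<AA> S h"
  unfolding character_on_def by blast

text \<open>The library rule starts from arbitrary bounded linear functionals. Expanding them in the
  axis basis leaves constants and coordinates, which correspond to multiples of the unit and to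
  members of the family.\<close>

lemma real_polynomial_function_coordinate_induct [consumes 1, case_names const coordinate add mult]:
  fixes f :: "real^'m::finite \<Rightarrow> real"
  assumes "real_polynomial_function f"
    and const: "\<And>r. P (\<lambda>x. r)" and coordinate: "\<And>j. P (\<lambda>x. x $ j)"
    and add: "\<And>f g. P f \<Longrightarrow> P g \<Longrightarrow> P (\<lambda>x. f x + g x)"
    and mult: "\<And>f g. P f \<Longrightarrow> P g \<Longrightarrow> P (\<lambda>x. f x * g x)"
  shows "P f"
  using assms(1)
proof (induction rule: real_polynomial_function.induct)
  case (linear f)
  have "f = (\<lambda>x. \<Sum>j\<in>UNIV. f (axis j 1) * x $ j)"
  proof
    fix x :: "real^'m"
    have "x = (\<Sum>j\<in>UNIV. x $ j *\<^sub>R axis j 1)"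
      by (simp add: basis_expansion flip: scalar_mult_eq_scaleR)
    then have "f x = f (\<Sum>j\<in>UNIV. x $ j *\<^sub>R axis j 1)"
      by simp
    also have "\<dots> = (\<Sum>j\<in>UNIV. f (axis j 1) * x $ j)"
      using linear by (simp add: linear_sum linear_scale bounded_linear.linear mult.commute)
    finally show "f x = (\<Sum>j\<in>UNIV. f (axis j 1) * x $ j)" .
  qed
  moreover have "P (\<lambda>x. \<Sum>j\<in>J. f (axis j 1) * x $ j)" if "finite J" for J
    using that by (induction J rule: finite_induct) (simp_all add: const add mult coordinate)
  ultimately show ?case
    using finite[of UNIV] by metis
qed (auto intro: const add mult)

text \<open>What a concrete candidate \<open>\<Phi>\<close> has to satisfy to be the functional
  calculus of \<open>A\<close>; the two interpretations are for matrices and for functions on a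
  compact space. \<open>K\<close> holds the joint eigenvalues, and \<open>\<Phi> f\<close> depends
  only on \<open>f\<close> there. \<open>C\<close> is an explicitly known subalgebra around the
  generated one, with enough characters to separate its elements.\<close>

locale calculus_model =
  fixes \<AA> :: "('a, 'k) cstar_scheme" and A :: "'m::finite \<Rightarrow> 'a"
    and \<Phi> :: "(real^'m \<Rightarrow> real) \<Rightarrow> 'a" and K :: "(real^'m) set" and C :: "'a set" and b :: real
  assumes bounded_K: "bounded K"
    and subalgebra: "cstar_subalgebra \<AA> C"
    and family_in: "A j \<in> C"
    and separated: "\<lbrakk>S \<in> C; T \<in> C; \<And>h. character_on \<AA> C h \<Longrightarrow> h S = h T\<rbrakk> \<Longrightarrow> S = T"
    and in_carrier: "continuous_on UNIV f \<Longrightarrow> \<Phi> f \<in> carrier \<AA>"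
    and coordinate: "\<Phi> (\<lambda>x. x $ j) = A j"
    and const: "\<Phi> (\<lambda>x. r) = complex_of_real r \<odot>\<^bsub>\<AA>\<^esub> \<one>\<^bsub>\<AA>\<^esub>"
    and add: "continuous_on UNIV f \<Longrightarrow> continuous_on UNIV g \<Longrightarrow>
      \<Phi> (\<lambda>x. f x + g x) = \<Phi> f \<oplus>\<^bsub>\<AA>\<^esub> \<Phi> g"
    and mult: "continuous_on UNIV f \<Longrightarrow> continuous_on UNIV g \<Longrightarrow>
      \<Phi> (\<lambda>x. f x * g x) = \<Phi> f \<otimes>\<^bsub>\<AA>\<^esub> \<Phi> g"
    and star: "continuous_on UNIV f \<Longrightarrow> star \<AA> (\<Phi> f) = \<Phi> f"
    and cong: "(\<And>x. x \<in> K \<Longrightarrow> f x = g x) \<Longrightarrow> \<Phi> f = \<Phi> g"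
    and nrm_diff_le: "\<lbrakk>continuous_on UNIV f; continuous_on UNIV g; \<And>x. x \<in> K \<Longrightarrow> \<bar>f x - g x\<bar> \<le> e; 0 \<le> e\<rbrakk> \<Longrightarrow>
      nrm \<AA> (\<Phi> f \<ominus>\<^bsub>\<AA>\<^esub> \<Phi> g) \<le> b * e"
    and bound_nonneg: "0 \<le> b"
begin

abbreviation "generated \<equiv> generated_cstar \<AA> (range A)"

lemma subalgebra_generated: "cstar_subalgebra \<AA> generated" "A j \<in> generated" "generated \<subseteq> C"
proof -
  have "range A \<subseteq> C"
    using family_in by blast
  from cstar_subalgebra_generated[OF subalgebra this]
  show "cstar_subalgebra \<AA> generated" "A j \<in> generated" "generated \<subseteq> C"
    by auto
qed

definition spectral_value :: "('a \<Rightarrow> complex) \<Rightarrow> real^'m" where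
  "spectral_value h = (\<chi> j. Re (h (A j)))"

text \<open>The requirements that \<open>functional_calculus\<close> puts on the value at
  \<open>f\<close>. They are stable under sums and products, so they can be had for polynomials
  before continuous functions are treated.\<close>

definition represented :: "(real^'m \<Rightarrow> real) \<Rightarrow> bool" where
  "represented f \<longleftrightarrow> continuous_on UNIV f \<and> \<Phi> f \<in> generated \<and>
     (\<forall>h. character_on \<AA> generated h \<longrightarrow> h (\<Phi> f) = complex_of_real (f (spectral_value h)))"

lemma represented_const: "represented (\<lambda>x. r)"
  using subalgebra_generated(1)
  by (simp add: represented_def const character_on_def cstar_subalgebra_def)

lemma represented_coordinate: "represented (\<lambda>x. x $ j)"
proof -
  have "h (A j) = of_real (Re (h (A j)))" if h: "character_on \<AA> generated h" for h
  proof -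
    have "star \<AA> (A j) = A j"
      using star[of "\<lambda>x. x $ j"] by (simp add: coordinate continuous_on_component)
    then have "cnj (h (A j)) = h (A j)"
      using h subalgebra_generated(2)[of j] unfolding character_on_def by metis
    then show ?thesis
      by (metis Reals_cnj_iff of_real_Re)
  qed
  then show ?thesis
    using subalgebra_generated(2)
    by (simp add: represented_def coordinate spectral_value_def continuous_on_component)
qed

lemma represented_add: "represented f \<Longrightarrow> represented g \<Longrightarrow> represented (\<lambda>x. f x + g x)"
  using subalgebra_generated(1)
  by (auto simp: represented_def add character_on_def cstar_subalgebra_def intro!: continuous_on_add)

lemma represented_mult: "represented f \<Longrightarrow> represented g \<Longrightarrow> represented (\<lambda>x. f x * g x)"
  using subalgebra_generated(1)
  by (auto simp: represented_def mult character_on_def cstar_subalgebra_def intro!: continuous_on_mult)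

lemma represented_polynomial: "real_polynomial_function f \<Longrightarrow> represented f"
  by (induction rule: real_polynomial_function_coordinate_induct)
     (auto intro: represented_const represented_coordinate represented_add represented_mult)

text \<open>The generated algebra is norm closed and contains \<open>\<Phi> p\<close> for
  polynomials \<open>p\<close>, which approximate \<open>f\<close> uniformly on the closure of
  \<open>K\<close>.\<close>

lemma in_generated:
  assumes f: "continuous_on UNIV f"
  shows "\<Phi> f \<in> generated"
proof -
  have "\<exists>T\<in>generated. nrm \<AA> (\<Phi> f \<ominus>\<^bsub>\<AA>\<^esub> T) < e" if "e > 0" for e
  proof -
    \<comment> \<open>With \<open>b + 1\<close> in place of \<open>b\<close> the estimate
      \<open>b * d < e\<close> is strict and covers \<open>b = 0\<close>.\<close>
    define d where "d = e / (b + 1)"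
    have d: "d > 0" "b * d < e"
      using that bound_nonneg by (auto simp: d_def field_simps)
    have "compact (closure K)" "continuous_on (closure K) f"
      using bounded_K f by (auto intro: continuous_on_subset)
    then obtain p where p: "real_polynomial_function p" "\<And>x. x \<in> closure K \<Longrightarrow> \<bar>f x - p x\<bar> < d"
      using d(1) by (rule Stone_Weierstrass_real_polynomial_function) (rule that)
    then have rp: "represented p"
      by (intro represented_polynomial)
    then have "nrm \<AA> (\<Phi> f \<ominus>\<^bsub>\<AA>\<^esub> \<Phi> p) \<le> b * d"
      using p(2) d(1) f closure_subset[of K]
      by (intro nrm_diff_le) (auto simp: represented_def less_imp_le)
    then show ?thesis
      using rp d(2) unfolding represented_def by (intro bexI[of _ "\<Phi> p"]) auto
  qed
  then show ?thesis
    using subalgebra_generated(1) in_carrier[OF f] unfolding cstar_subalgebra_def by blast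
qed

lemma character_of_calculus_real:
  assumes "character_on \<AA> generated h" "continuous_on UNIV f"
  shows "h (\<Phi> f) = of_real (Re (h (\<Phi> f)))"
proof -
  have "cnj (h (\<Phi> f)) = h (\<Phi> f)"
    using assms star[of f] in_generated[of f] unfolding character_on_def by metis
  then show ?thesis
    by (metis Reals_cnj_iff of_real_Re)
qed

text \<open>
  If \<open>p\<close> is a polynomial with \<open>|f - p| \<le> e\<close> on the joint spectrum and at the point
  \<open>spectral_value h\<close>, then \<open>e\<^sup>2 - (f - p)\<^sup>2\<close> is a square there, whence \<open>|h (f - p)| \<le> e\<close>.
\<close>

lemma character_of_calculus:
  assumes h: "character_on \<AA> generated h" and f: "continuous_on UNIV f"
  shows "h (\<Phi> f) = of_real (f (spectral_value h))"
proof -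
  let ?l = "spectral_value h"
  have hadd: "h (\<Phi> (\<lambda>x. u x + v x)) = h (\<Phi> u) + h (\<Phi> v)"
    and hmult: "h (\<Phi> (\<lambda>x. u x * v x)) = h (\<Phi> u) * h (\<Phi> v)"
    if "continuous_on UNIV u" "continuous_on UNIV v" for u v
    using h in_generated that by (simp_all add: character_on_def add mult)
  have "\<bar>Re (h (\<Phi> f)) - f ?l\<bar> \<le> 2 * e" if "e > 0" for e
  proof -
    \<comment> \<open>The point belonging to \<open>h\<close> is not known to lie in the closure of
      \<open>K\<close>, so the approximation is demanded there separately.\<close>
    have "compact (closure (insert ?l K))" "continuous_on (closure (insert ?l K)) f"
      using bounded_K f by (auto intro: continuous_on_subset)
    then obtain p where p: "real_polynomial_function p" "\<And>x. x \<in> closure (insert ?l K) \<Longrightarrow> \<bar>f x - p x\<bar> < e"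
      using \<open>e > 0\<close> by (rule Stone_Weierstrass_real_polynomial_function) (rule that)
    then have le: "\<bar>f x - p x\<bar> < e" if "x \<in> insert ?l K" for x
      using that closure_subset by blast
    have rp: "represented p"
      using p by (intro represented_polynomial)
    define d where "d = (\<lambda>x. f x - p x)"
    \<comment> \<open>\<open>character_on\<close> asks for no continuity of \<open>h\<close>, so the
      bound on the value at \<open>d\<close> has to come from an algebraic identity. The
      \<open>max 0\<close> keeps \<open>g\<close> continuous on the whole space, where |d| may
      exceed e; on \<open>K\<close> it never does.\<close>
    define g where "g = (\<lambda>x. sqrt (max 0 (e\<^sup>2 - (d x)\<^sup>2)))"
    have d: "continuous_on UNIV d"
      using rp f unfolding d_def represented_def by (intro continuous_intros) auto
    then have g: "continuous_on UNIV g"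
      unfolding g_def by (intro continuous_intros)
    have "\<Phi> (\<lambda>x. g x * g x + d x * d x) = \<Phi> (\<lambda>x. e\<^sup>2)"
    proof (rule cong)
      fix x assume "x \<in> K"
      then have "\<bar>d x\<bar> \<le> e"
        using le by (simp add: d_def less_imp_le)
      then have "(d x)\<^sup>2 \<le> e\<^sup>2"
        by (rule abs_le_square_iff[THEN iffD1, of "d x" e, OF order_trans]) simp
      then show "g x * g x + d x * d x = e\<^sup>2"
        by (simp add: g_def flip: power2_eq_square)
    qed
    moreover have "h (\<Phi> (\<lambda>x. e\<^sup>2)) = of_real (e\<^sup>2)"
      using represented_const[of "e\<^sup>2"] h by (simp add: represented_def del: of_real_power)
    moreover have "h (\<Phi> (\<lambda>x. g x * g x + d x * d x)) = h (\<Phi> g) * h (\<Phi> g) + h (\<Phi> d) * h (\<Phi> d)"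
      using d g by (simp add: hadd hmult continuous_on_mult)
    ultimately have "h (\<Phi> g) * h (\<Phi> g) + h (\<Phi> d) * h (\<Phi> d) = of_real (e\<^sup>2)"
      by simp
    then have "of_real (Re (h (\<Phi> g)) * Re (h (\<Phi> g)) + Re (h (\<Phi> d)) * Re (h (\<Phi> d))) = complex_of_real (e\<^sup>2)"
      using character_of_calculus_real[OF h g] character_of_calculus_real[OF h d]
      by (metis of_real_add of_real_mult)
    then have "Re (h (\<Phi> g)) * Re (h (\<Phi> g)) + Re (h (\<Phi> d)) * Re (h (\<Phi> d)) = e\<^sup>2"
      by (simp only: of_real_eq_iff)
    then have "(Re (h (\<Phi> d)))\<^sup>2 \<le> e\<^sup>2"
      by (metis le_add_same_cancel2 power2_eq_square zero_le_square)
    then have "\<bar>Re (h (\<Phi> d))\<bar> \<le> e"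
      using \<open>e > 0\<close> by (metis abs_le_square_iff abs_of_pos)
    moreover have "h (\<Phi> f) = h (\<Phi> d) + of_real (p ?l)"
      using hadd[OF d, of p] rp h by (simp add: d_def represented_def)
    ultimately show ?thesis
      using le[of ?l] by simp
  qed
  from this[of "e / 2" for e] have "\<bar>Re (h (\<Phi> f)) - f ?l\<bar> \<le> 0 + e" if "e > 0" for e
    using that by simp
  then have "\<bar>Re (h (\<Phi> f)) - f ?l\<bar> \<le> 0"
    by (rule field_le_epsilon)
  then show ?thesis
    using character_of_calculus_real[OF h f] by simp
qed

text \<open>Existence is \<open>in_generated\<close> with \<open>character_of_calculus\<close>. For
  uniqueness, characters of \<open>C\<close> restrict to characters of the generated algebra, and
  those of \<open>C\<close> already separate.\<close>

theorem functional_calculus_eq: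
  assumes "continuous_on UNIV f"
  shows "functional_calculus \<AA> f A = \<Phi> f"
  unfolding functional_calculus_def
proof (rule the_equality)
  show "\<Phi> f \<in> generated \<and> (\<forall>h. character_on \<AA> generated h \<longrightarrow>
      h (\<Phi> f) = complex_of_real (f (\<chi> j. Re (h (A j)))))"
    using assms by (auto simp: in_generated character_of_calculus spectral_value_def)
next
  fix T assume T: "T \<in> generated \<and> (\<forall>h. character_on \<AA> generated h \<longrightarrow>
      h T = complex_of_real (f (\<chi> j. Re (h (A j)))))"
  show "T = \<Phi> f"
  proof (rule separated)
    show "T \<in> C" "\<Phi> f \<in> C"
      using T in_generated[OF assms] subalgebra_generated(3) by auto
    fix h assume "character_on \<AA> C h"
    then have "character_on \<AA> generated h"
      using subalgebra_generated(3) by (rule character_on_subset)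
    then show "h T = h (\<Phi> f)"
      using T character_of_calculus[of h, OF _ assms] unfolding spectral_value_def by metis
  qed
qed

end

section \<open>The calculus for single matrices and for continuous matrix-valued functions\<close>

lemma continuous_on_matrix_mult [continuous_intros]:
  fixes f g :: "'a::topological_space \<Rightarrow> complex^'n::finite^'n"
  assumes "continuous_on S f" "continuous_on S g"
  shows "continuous_on S (\<lambda>x. f x ** g x)"
  unfolding matrix_matrix_mult_def using assms by (intro continuous_intros)

lemma continuous_on_adjoint_mat [continuous_intros]:
  fixes f :: "'a::topological_space \<Rightarrow> complex^'n::finite^'n"
  assumes "continuous_on S f"
  shows "continuous_on S (\<lambda>x. adjoint_mat (f x))"
  unfolding adjoint_mat_def using assms by (intro continuous_intros)

lemma continuous_on_uniform_approx:
  fixes f :: "'a::topological_space \<Rightarrow> 'b::metric_space"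
  assumes "\<And>e. e > 0 \<Longrightarrow> \<exists>g. continuous_on S g \<and> (\<forall>x\<in>S. dist (g x) (f x) < e)"
  shows "continuous_on S f"
proof -
  have "\<forall>n. \<exists>g. continuous_on S g \<and> (\<forall>x\<in>S. dist (g x) (f x) < inverse (real (Suc n)))"
    using assms by simp
  then obtain g where g: "\<And>n. continuous_on S (g n)"
    "\<And>n x. x \<in> S \<Longrightarrow> dist (g n x) (f x) < inverse (real (Suc n))"
    by metis
  have "uniform_limit S g f sequentially"
  proof (rule uniform_limitI)
    fix e :: real assume "e > 0"
    then obtain N where N: "inverse (real (Suc N)) < e"
      using reals_Archimedean by blast
    have "dist (g n x) (f x) < e" if "N \<le> n" "x \<in> S" for n x
    proof -
      have "inverse (real (Suc n)) \<le> inverse (real (Suc N))"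
        using that by (intro le_imp_inverse_le) auto
      then show ?thesis
        using g(2)[OF that(2), of n] N by linarith
    qed
    then show "\<forall>\<^sub>F n in sequentially. \<forall>x\<in>S. dist (g n x) (f x) < e"
      unfolding eventually_sequentially by blast
  qed
  then show ?thesis
    by (rule uniform_limit_theorem[rotated]) (auto simp: g)
qed

lemma onorm_mat_calculus_diff_le:
  fixes U :: "complex^'n::finite^'n"
  assumes "U \<in> unitaries matrix_algebra"
    and "\<And>i. \<bar>f (diag_point D i) - g (diag_point D i)\<bar> \<le> e"
  shows "onorm ((*v) (mat_calculus U D f - mat_calculus U D g)) \<le> real CARD('n) ^ 6 * e"
proof -
  have "onorm ((*v) (mat_calculus U D f - mat_calculus U D g))
      \<le> real CARD('n) * real CARD('n) * norm (mat_calculus U D f - mat_calculus U D g)"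
    by (rule onorm_le_norm_mult)
  also have "\<dots> \<le> real CARD('n) * real CARD('n) * (real CARD('n) ^ 4 * e)"
    using assms by (intro mult_left_mono norm_mat_calculus_diff_le) auto
  finally show ?thesis
    by (simp add: eval_nat_numeral mult_ac)
qed

text \<open>The matrices that are diagonal in the orthonormal basis given by \<open>U\<close>. For
  unitary \<open>U\<close> this is the ambient subalgebra \<open>C\<close> of
  \<open>calculus_model\<close>: every diagonal entry is a character, and together these entries
  determine the matrix.\<close>

definition diagonal_in :: "complex^'n::finite^'n \<Rightarrow> (complex^'n^'n) set" where
  "diagonal_in U = {T. diagonal_mat (U ** T ** adjoint_mat U)}"

lemma conj_mult:
  assumes "U \<in> unitaries matrix_algebra"
  shows "U ** (S ** T) ** adjoint_mat U = (U ** S ** adjoint_mat U) ** (U ** T ** adjoint_mat U)"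
  using assms by (simp add: matrix_mul_assoc[symmetric] unitary_adjoint_mult)

lemma conj_add: "U ** (S + T) ** adjoint_mat U = U ** S ** adjoint_mat U + U ** T ** adjoint_mat U"
  by (simp add: matrix_add_ldistrib matrix_add_rdistrib)

lemma conj_smult: "(U ** (c \<odot>\<^bsub>matrix_algebra\<^esub> T) ** adjoint_mat U) $ i $ j = c * (U ** T ** adjoint_mat U) $ i $ j"
  by (simp add: matrix_algebra_smult matrix_matrix_mult_def sum_distrib_left sum_distrib_right mult_ac)

lemma conj_adjoint: "U ** adjoint_mat T ** adjoint_mat U = adjoint_mat (U ** T ** adjoint_mat U)"
  by (simp add: adjoint_mat_mult matrix_mul_assoc)

lemma diagonal_mat_one: "diagonal_mat (mat 1)" and mat_one_diag: "mat 1 $ i $ i = 1"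
  by (simp_all add: diagonal_mat_def mat_def)

lemma diagonal_mat_mult:
  fixes S T :: "complex^'n::finite^'n"
  assumes "diagonal_mat S" "diagonal_mat T"
  shows "diagonal_mat (S ** T)" "(S ** T) $ i $ i = S $ i $ i * T $ i $ i"
proof -
  have "S ** T = diag_matrix (\<lambda>i. S $ i $ i * T $ i $ i)"
    using assms[THEN diagonal_mat_eq] diag_matrix_mult by metis
  then show "diagonal_mat (S ** T)" "(S ** T) $ i $ i = S $ i $ i * T $ i $ i"
    by (simp_all add: diagonal_mat_diag_matrix diag_matrix_nth)
qed

lemma closed_diagonal_in: "closed (diagonal_in U)"
proof -
  have "continuous_on UNIV (\<lambda>T. (U ** T ** adjoint_mat U) $ i $ j)" for i j
    by (intro continuous_intros)
  then have "closed {T. (U ** T ** adjoint_mat U) $ i $ j = 0}" for i j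
    by (intro closed_Collect_eq) auto
  then have "closed (\<Inter>i. \<Inter>j\<in>-{i}. {T. (U ** T ** adjoint_mat U) $ i $ j = 0})"
    by (intro closed_INT ballI)
  also have "(\<Inter>i. \<Inter>j\<in>-{i}. {T. (U ** T ** adjoint_mat U) $ i $ j = 0}) = diagonal_in U"
    by (auto simp: diagonal_in_def diagonal_mat_def)
  finally show ?thesis .
qed

lemma closure_diagonal_in: "closure (diagonal_in U) = diagonal_in U"
  by (rule closure_closed) (rule closed_diagonal_in)

lemma onorm_closure:
  fixes T :: "complex^'n::finite^'n"
  assumes "\<And>e. e > 0 \<Longrightarrow> \<exists>S\<in>A. onorm ((*v) (T - S)) < e"
  shows "T \<in> closure A"
  unfolding closure_approachable
proof (intro allI impI)
  fix e :: real assume "e > 0"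
  let ?c = "real CARD('n) * real CARD('n)"
  obtain S where S: "S \<in> A" "onorm ((*v) (T - S)) < e / ?c"
    using assms[of "e / ?c"] \<open>e > 0\<close> by auto
  have "norm (T - S) \<le> ?c * onorm ((*v) (T - S))"
    by (rule norm_le_onorm_mult)
  also have "\<dots> < e"
    using S(2) by (simp add: field_simps)
  finally show "\<exists>S\<in>A. dist S T < e"
    using S(1) by (auto simp: dist_norm norm_minus_commute)
qed

lemma diagonal_in_eqI:
  assumes U: "U \<in> unitaries matrix_algebra" and ST: "S \<in> diagonal_in U" "T \<in> diagonal_in U"
    and eq: "\<And>i. (U ** S ** adjoint_mat U) $ i $ i = (U ** T ** adjoint_mat U) $ i $ i"
  shows "S = T"
proof -
  have "U ** S ** adjoint_mat U = U ** T ** adjoint_mat U"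
    using ST[unfolded diagonal_in_def mem_Collect_eq, THEN diagonal_mat_eq] eq by simp
  then have "adjoint_mat U ** (U ** S ** adjoint_mat U) ** U = adjoint_mat U ** (U ** T ** adjoint_mat U) ** U"
    by simp
  then show ?thesis
    using U by (simp add: matrix_mul_assoc[symmetric] unitary_adjoint_mult)
qed

lemma diagonalization_unitary: "diagonalization a U D \<Longrightarrow> U \<in> unitaries matrix_algebra"
  by (simp add: diagonalization_def)

lemma diagonalization_diagonal_in: "diagonalization a U D \<Longrightarrow> a j \<in> diagonal_in U"
  by (auto simp: diagonalization_def diagonal_in_def matrix_mul_assoc[symmetric] unitary_adjoint_mult)

theorem matrix_functional_calculus:
  fixes a :: "'m::finite \<Rightarrow> complex^'n::finite^'n"
  assumes a: "abelian_family matrix_algebra a" and d: "diagonalization a U D"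
    and f: "continuous_on UNIV f"
  shows "functional_calculus matrix_algebra f a = mat_calculus U D f"
proof -
  have U: "U \<in> unitaries matrix_algebra"
    using d by (rule diagonalization_unitary)
  have sa: "adjoint_mat (a j) = a j" for j
    using a by (simp add: abelian_family_def)
  let ?C = "diagonal_in U"
  interpret calculus_model matrix_algebra a "mat_calculus U D" "range (diag_point D)" ?C
    "real CARD('n) ^ 6"
  proof
    show "bounded (range (diag_point D))"
      by (simp add: finite_imp_bounded)
    show "cstar_subalgebra matrix_algebra ?C"
      unfolding cstar_subalgebra_def
    proof (intro conjI ballI allI impI)
      show "\<one>\<^bsub>matrix_algebra\<^esub> \<in> ?C"
        using U by (simp add: diagonal_in_def unitary_adjoint_mult diagonal_mat_one)
      fix T assume "\<forall>e>0. \<exists>S\<in>?C. nrm matrix_algebra (T \<ominus>\<^bsub>matrix_algebra\<^esub> S) < e"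
      then have "T \<in> closure ?C"
        by (intro onorm_closure) simp
      then show "T \<in> ?C"
        by (simp add: closure_diagonal_in)
    qed (auto simp: diagonal_in_def conj_mult[OF U] diagonal_mat_mult conj_add conj_adjoint,
         auto simp: diagonal_mat_def conj_smult)
    show "a j \<in> ?C" for j
      using d by (rule diagonalization_diagonal_in)
    fix S T assume ST: "S \<in> ?C" "T \<in> ?C" and *: "\<And>h. character_on matrix_algebra ?C h \<Longrightarrow> h S = h T"
    have char: "character_on matrix_algebra ?C (\<lambda>T. (U ** T ** adjoint_mat U) $ i $ i)" for i
      unfolding character_on_def
    proof (intro conjI ballI allI)
      show "(U ** \<one>\<^bsub>matrix_algebra\<^esub> ** adjoint_mat U) $ i $ i = 1"
        using U by (simp add: unitary_adjoint_mult mat_one_diag)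
    qed (simp_all add: diagonal_in_def conj_mult[OF U] diagonal_mat_mult conj_add conj_adjoint conj_smult)
    show "S = T"
      using *[OF char] by (intro diagonal_in_eqI[OF U ST])
  next
    fix f g :: "real^'m \<Rightarrow> real" and e :: real
    assume *: "\<And>x. x \<in> range (diag_point D) \<Longrightarrow> \<bar>f x - g x\<bar> \<le> e"
    show "nrm matrix_algebra (mat_calculus U D f \<ominus>\<^bsub>matrix_algebra\<^esub> mat_calculus U D g)
      \<le> real CARD('n) ^ 6 * e"
      unfolding matrix_algebra_simps matrix_algebra_minus
      by (intro onorm_mat_calculus_diff_le U *) simp
  qed (use U in \<open>auto simp: mat_calculus_coordinate[OF d sa] mat_calculus_const mat_calculus_add
      mat_calculus_mult adjoint_mat_calculus intro: mat_calculus_cong\<close>)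
  show ?thesis
    using f by (rule functional_calculus_eq)
qed

lemma cont_abelian_family_at:
  assumes "abelian_family (cont_matrix_algebra X) A" "x \<in> X"
  shows "abelian_family matrix_algebra (\<lambda>j. A j x)"
proof -
  have "(star (cont_matrix_algebra X) (A j)) x = A j x"
    "(A i \<otimes>\<^bsub>cont_matrix_algebra X\<^esub> A j) x = (A j \<otimes>\<^bsub>cont_matrix_algebra X\<^esub> A i) x" for i j
    using assms(1) by (simp_all only: abelian_family_def)
  then show ?thesis
    using assms(2) by (simp add: abelian_family_def)
qed

text \<open>\<open>D j\<close> is a unitary conjugate of \<open>a j\<close>, which costs n^2, and
  the m coordinates are summed. The bound sees only the size of \<open>a\<close>, so on a compact
  space one bound serves all points.\<close>

lemma norm_diag_point_le:
  fixes a :: "'m::finite \<Rightarrow> complex^'n::finite^'n"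
  assumes d: "diagonalization a U D" and b: "\<And>j. norm (a j) \<le> b"
  shows "norm (diag_point D i) \<le> real CARD('m) * (real CARD('n) * real CARD('n) * b)"
proof -
  have U: "U \<in> unitaries matrix_algebra"
    using d by (rule diagonalization_unitary)
  have "norm (D j $ i $ i) \<le> real CARD('n) * (real CARD('n) * (1 * b) * 1)" for j
  proof -
    have "D j = U ** a j ** adjoint_mat U"
      using d by (simp add: diagonalization_def matrix_mul_assoc[symmetric] unitary_adjoint_mult)
    then show ?thesis
      using norm_unitary_entry_le[OF U] order_trans[OF matrix_entry_norm_le b]
      by (simp only:) (intro norm_matrix_mult_entry_le, auto)
  qed
  then have "\<bar>diag_point D i $ j\<bar> \<le> real CARD('n) * real CARD('n) * b" for j
    using abs_Re_le_cmod[of "D j $ i $ i"] order_trans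
    by (simp add: diag_point_def mult.assoc) blast
  then have "(\<Sum>j\<in>UNIV. \<bar>diag_point D i $ j\<bar>) \<le> (\<Sum>j\<in>(UNIV::'m set). real CARD('n) * real CARD('n) * b)"
    by (intro sum_mono)
  then show ?thesis
    using norm_le_l1_cart[of "diag_point D i"] by simp
qed

text \<open>Nothing is assumed about how \<open>U x\<close> and \<open>D x\<close> depend on
  \<open>x\<close>. For a polynomial the pointwise calculus is a polynomial in the continuous
  \<open>A j\<close>; for continuous \<open>f\<close> it is a uniform limit of such functions,
  because the union of all joint spectra is bounded.\<close>

theorem cont_functional_calculus:
  fixes A :: "'m::finite \<Rightarrow> 'x::metric_space \<Rightarrow> complex^'n::finite^'n"
  assumes X: "compact X" and A: "abelian_family (cont_matrix_algebra X) A"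
    and d: "\<And>x. x \<in> X \<Longrightarrow> diagonalization (\<lambda>j. A j x) (U x) (D x)"
    and f: "continuous_on UNIV f"
  shows "functional_calculus (cont_matrix_algebra X) f A = (\<lambda>x\<in>X. mat_calculus (U x) (D x) f)"
    "continuous_on X (\<lambda>x. mat_calculus (U x) (D x) f)"
proof -
  have U: "U x \<in> unitaries matrix_algebra" if "x \<in> X" for x
    using d[OF that] by (rule diagonalization_unitary)
  have sa: "adjoint_mat (A j x) = A j x" if "x \<in> X" for j x
    using cont_abelian_family_at[OF A that] by (simp add: abelian_family_def)
  have AX: "A j \<in> extensional X" "continuous_on X (A j)" for j
    using A by (auto simp: abelian_family_def)
  let ?\<Phi> = "\<lambda>f. \<lambda>x\<in>X. mat_calculus (U x) (D x) f"
  let ?C = "{F \<in> carrier (cont_matrix_algebra X). \<forall>x\<in>X. F x \<in> diagonal_in (U x)}"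
  let ?K = "\<Union>x\<in>X. range (diag_point (D x))"
  have K: "bounded ?K"
  proof -
    have "bounded (\<Union>j. A j ` X)"
      using X AX by (intro bounded_UN) (auto intro!: compact_imp_bounded compact_continuous_image)
    then obtain b where "\<And>j x. x \<in> X \<Longrightarrow> norm (A j x) \<le> b"
      by (auto simp: bounded_iff)
    then show ?thesis
      using norm_diag_point_le[OF d] by (auto simp: bounded_iff) blast
  qed
  have poly: "continuous_on X (\<lambda>x. mat_calculus (U x) (D x) p)" if "real_polynomial_function p" for p
    using that
  proof (induction rule: real_polynomial_function_coordinate_induct)
    case (const r)
    then show ?case
      using U by (simp add: mat_calculus_const cong: continuous_on_cong_simp)
  next
    case (coordinate j)
    then show ?case
      using AX by (simp add: mat_calculus_coordinate[OF d sa] cong: continuous_on_cong_simp)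
  next
    case (mult f g)
    then show ?case
      using U by (simp add: mat_calculus_mult continuous_on_matrix_mult cong: continuous_on_cong_simp)
  qed (simp add: mat_calculus_add continuous_on_add)
  have cont: "continuous_on X (\<lambda>x. mat_calculus (U x) (D x) f)" if f: "continuous_on UNIV f" for f
  proof (rule continuous_on_uniform_approx)
    fix e :: real assume "e > 0"
    have "compact (closure ?K)" "continuous_on (closure ?K) f"
      using K f by (auto intro: continuous_on_subset)
    moreover have "e / (2 * real CARD('n) ^ 4) > 0"
      using \<open>e > 0\<close> by simp
    ultimately obtain p where p: "real_polynomial_function p"
        "\<And>x. x \<in> closure ?K \<Longrightarrow> \<bar>f x - p x\<bar> < e / (2 * real CARD('n) ^ 4)"
      by (rule Stone_Weierstrass_real_polynomial_function) (rule that)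
    have "dist (mat_calculus (U x) (D x) p) (mat_calculus (U x) (D x) f) < e" if x: "x \<in> X" for x
    proof -
      have K: "diag_point (D x) i \<in> closure ?K" for i
        using x closure_subset[of ?K] by blast
      have "norm (mat_calculus (U x) (D x) p - mat_calculus (U x) (D x) f)
          \<le> real CARD('n) ^ 4 * (e / (2 * real CARD('n) ^ 4))"
        using p(2)[OF K] by (intro norm_mat_calculus_diff_le U x) (simp add: abs_minus_commute less_imp_le)
      then show ?thesis
        using \<open>e > 0\<close> by (simp add: dist_norm)
    qed
    then show "\<exists>g. continuous_on X g \<and> (\<forall>x\<in>X. dist (g x) (mat_calculus (U x) (D x) f) < e)"
      using poly[OF p(1)] by blast
  qed
  then show "continuous_on X (\<lambda>x. mat_calculus (U x) (D x) f)"
    using f .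
  \<comment> \<open>Evaluation at a point followed by a diagonal entry is multiplicative on
    \<open>?C\<close>, where \<open>F x\<close> is diagonal in the basis of
    \<open>U x\<close>.\<close>
  have char: "character_on (cont_matrix_algebra X) ?C (\<lambda>F. (U x ** F x ** adjoint_mat (U x)) $ i $ i)"
    if "x \<in> X" for x i
    unfolding character_on_def
  proof (intro conjI ballI allI)
    show "(U x ** \<one>\<^bsub>cont_matrix_algebra X\<^esub> x ** adjoint_mat (U x)) $ i $ i = 1"
      using U[OF that] that by (simp add: unitary_adjoint_mult mat_one_diag)
  qed (use U[OF that] that in \<open>simp_all add: diagonal_in_def conj_mult diagonal_mat_mult conj_add conj_adjoint conj_smult\<close>)
  interpret calculus_model "cont_matrix_algebra X" A ?\<Phi> ?K ?C
    "real CARD('n) ^ 6"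
  proof
    show "bounded ?K"
      by (rule K)
    show "cstar_subalgebra (cont_matrix_algebra X) ?C"
      unfolding cstar_subalgebra_def
    proof (intro conjI ballI allI impI)
      show "\<one>\<^bsub>cont_matrix_algebra X\<^esub> \<in> ?C"
        using U by (simp add: diagonal_in_def unitary_adjoint_mult diagonal_mat_one)
      fix F assume F: "F \<in> carrier (cont_matrix_algebra X)"
        and *: "\<forall>e>0. \<exists>G\<in>?C. nrm (cont_matrix_algebra X) (F \<ominus>\<^bsub>cont_matrix_algebra X\<^esub> G) < e"
      have "F x \<in> closure (diagonal_in (U x))" if x: "x \<in> X" for x
      proof (rule onorm_closure)
        fix e :: real assume "e > 0"
        then obtain G where G: "G \<in> ?C" "nrm (cont_matrix_algebra X) (F \<ominus>\<^bsub>cont_matrix_algebra X\<^esub> G) < e"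
          using * by blast
        have "onorm ((*v) ((F \<ominus>\<^bsub>cont_matrix_algebra X\<^esub> G) x)) \<le> nrm (cont_matrix_algebra X) (F \<ominus>\<^bsub>cont_matrix_algebra X\<^esub> G)"
          using F G by (intro onorm_le_cont_norm X x) (auto simp: cont_matrix_algebra_minus extensional_def intro!: continuous_intros)
        then show "\<exists>S\<in>diagonal_in (U x). onorm ((*v) (F x - S)) < e"
          using G F x by (intro bexI[of _ "G x"]) (auto simp: cont_matrix_algebra_minus)
      qed
      then show "F \<in> ?C"
        using F by (simp add: closure_diagonal_in)
    qed (use U in \<open>auto simp: diagonal_in_def conj_mult diagonal_mat_mult conj_add conj_adjoint intro!: continuous_intros\<close>,
         auto simp: diagonal_mat_def conj_smult, auto simp: matrix_algebra_smult intro!: continuous_intros)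
    show "A j \<in> ?C" for j
      using AX diagonalization_diagonal_in[OF d, of _ j] by auto
    fix S T assume ST: "S \<in> ?C" "T \<in> ?C" and *: "\<And>h. character_on (cont_matrix_algebra X) ?C h \<Longrightarrow> h S = h T"
    have "S x = T x" if "x \<in> X" for x
      using *[OF char[OF that]] ST that by (intro diagonal_in_eqI[OF U[OF that]]) auto
    then show "S = T"
      using ST by (auto intro: extensionalityI)
  next
    fix f g :: "real^'m \<Rightarrow> real" and e :: real
    assume fg: "continuous_on UNIV f" "continuous_on UNIV g"
      and *: "\<And>x. x \<in> ?K \<Longrightarrow> \<bar>f x - g x\<bar> \<le> e" and e: "0 \<le> e"
    show "nrm (cont_matrix_algebra X) (?\<Phi> f \<ominus>\<^bsub>cont_matrix_algebra X\<^esub> ?\<Phi> g)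
      \<le> real CARD('n) ^ 6 * e"
    proof (rule cont_norm_le)
      fix x assume x: "x \<in> X"
      then have "onorm ((*v) (mat_calculus (U x) (D x) f - mat_calculus (U x) (D x) g)) \<le> real CARD('n) ^ 6 * e"
        using * by (intro onorm_mat_calculus_diff_le U) auto
      then show "onorm ((*v) ((?\<Phi> f \<ominus>\<^bsub>cont_matrix_algebra X\<^esub> ?\<Phi> g) x)) \<le> real CARD('n) ^ 6 * e"
        using x fg by (simp add: cont_matrix_algebra_minus cont)
    qed (use e in simp)
  next
    fix f g :: "real^'m \<Rightarrow> real"
    assume "\<And>x. x \<in> ?K \<Longrightarrow> f x = g x"
    then show "?\<Phi> f = ?\<Phi> g"
      by (intro restrict_ext mat_calculus_cong) blast
  qed (use U cont AX in \<open>auto simp: mat_calculus_coordinate[OF d sa] mat_calculus_const mat_calculus_add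
      mat_calculus_mult adjoint_mat_calculus extensional_def intro!: ext\<close>)
  show "functional_calculus (cont_matrix_algebra X) f A = ?\<Phi> f"
    using f by (rule functional_calculus_eq)
qed

section \<open>Hall's theorem and Birkhoff's theorem\<close>

lemma UN_fun_upd: "\<Union> ((F(k := G)) ` J) = \<Union> (F ` (J - {k})) \<union> (if k \<in> J then G else {})"
  by (auto split: if_splits)

text \<open>
  Rado's argument: as long as some \<open>F i\<close> has two elements, one of them can be removed without
  violating Hall's condition.
\<close>

theorem hall_marriage:
  fixes F :: "'a \<Rightarrow> 'b set"
  assumes "finite I" "\<And>i. i \<in> I \<Longrightarrow> finite (F i)"
    and "\<And>J. J \<subseteq> I \<Longrightarrow> card J \<le> card (\<Union> (F ` J))"
  shows "\<exists>f. inj_on f I \<and> (\<forall>i\<in>I. f i \<in> F i)"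
  using assms(2,3)
proof (induction "\<Sum>i\<in>I. card (F i)" arbitrary: F rule: less_induct)
  case (less F)
  show ?case
  proof (cases "\<forall>i\<in>I. card (F i) \<le> 1")
    case True
    have "\<exists>x. F i = {x}" if "i \<in> I" for i
    proof -
      have "1 \<le> card (F i)"
        using less.prems(2)[of "{i}"] that by simp
      then have "card (F i) = 1"
        using True that by (simp add: antisym)
      then show ?thesis
        by (rule card_1_singletonE) blast
    qed
    then obtain f where f: "\<And>i. i \<in> I \<Longrightarrow> F i = {f i}"
      by metis
    have "f i \<noteq> f k" if "i \<in> I" "k \<in> I" "i \<noteq> k" for i k
      using less.prems(2)[of "{i, k}"] that by (auto simp: f)
    then have "inj_on f I"
      by (auto simp: inj_on_def)
    then show ?thesis
      using f by auto
  next
    case False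
    then obtain k where k: "k \<in> I" "2 \<le> card (F k)"
      by auto
    then obtain x y where xy: "x \<in> F k" "y \<in> F k" "x \<noteq> y"
      using card_le_Suc0_iff_eq[OF less.prems(1)[OF k(1)]] by (metis not_less_eq_eq numeral_2_eq_2)
    have fin: "finite (\<Union> (F ` J))" if "J \<subseteq> I" for J
      using that less.prems(1) finite_subset[OF that \<open>finite I\<close>] by blast
    define hall_without where
      "hall_without z \<longleftrightarrow> (\<forall>J\<subseteq>I. card J \<le> card (\<Union> ((F(k := F k - {z})) ` J)))" for z
    have "\<exists>z\<in>{x, y}. hall_without z"
    proof (rule ccontr)
      assume contra: "\<not> ?thesis"
      have "\<exists>A\<subseteq>I - {k}. card (\<Union> (F ` A) \<union> (F k - {z})) \<le> card A" if "z \<in> {x, y}" for z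
      proof -
        have "\<not> hall_without z"
          using contra that by blast
        then have "\<exists>J\<subseteq>I. \<not> card J \<le> card (\<Union> ((F(k := F k - {z})) ` J))"
          by (simp only: hall_without_def not_all not_imp)
        then obtain J where J: "J \<subseteq> I" "card (\<Union> ((F(k := F k - {z})) ` J)) < card J"
          unfolding not_le by (elim exE conjE)
        have "k \<in> J"
        proof (rule ccontr)
          assume "k \<notin> J"
          then show False
            using less.prems(2)[OF J(1)] J(2) unfolding UN_fun_upd by simp
        qed
        moreover have "\<Union> ((F(k := F k - {z})) ` J) = \<Union> (F ` (J - {k})) \<union> (F k - {z})"
          unfolding UN_fun_upd using \<open>k \<in> J\<close> by simp
        moreover have "card J = Suc (card (J - {k}))"
          using card_Suc_Diff1[OF finite_subset[OF J(1) \<open>finite I\<close>] \<open>k \<in> J\<close>] by simp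
        ultimately show ?thesis
          using J by (intro exI[of _ "J - {k}"]) auto
      qed
      from this[of x] this[of y] obtain A B where A: "A \<subseteq> I - {k}" "card (\<Union> (F ` A) \<union> (F k - {x})) \<le> card A"
        and B: "B \<subseteq> I - {k}" "card (\<Union> (F ` B) \<union> (F k - {y})) \<le> card B"
        by auto
      let ?P = "\<Union> (F ` A) \<union> (F k - {x})" and ?Q = "\<Union> (F ` B) \<union> (F k - {y})"
      have finAB: "finite A" "finite B"
        using A B finite_subset[OF _ \<open>finite I\<close>] by blast+
      have finPQ: "finite ?P" "finite ?Q"
        using fin[of A] fin[of B] less.prems(1)[OF k(1)] A(1) B(1) by auto
      \<comment> \<open>Counting with both removals failing. As \<open>x\<close> and
        \<open>y\<close> differ, \<open>?P \<union> ?Q\<close> contains all of \<open>F k\<close>,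
        so Hall's condition applies to \<open>A \<union> B\<close> with \<open>k\<close> added;
        applying it also to \<open>A \<inter> B\<close> yields |A| + |B| + 1 \<le> |P| + |Q| \<le>
        |A| + |B|.\<close>
      have "card A + card B + 1 = card (insert k (A \<union> B)) + card (A \<inter> B)"
        using card_Un_Int[OF finAB] A(1) B(1) finAB by (subst card_insert_disjoint) auto
      also have "card (insert k (A \<union> B)) \<le> card (\<Union> (F ` insert k (A \<union> B)))"
        using A B k by (intro less.prems(2)) auto
      also have "\<Union> (F ` insert k (A \<union> B)) = ?P \<union> ?Q"
        using xy by auto
      also have "card (A \<inter> B) \<le> card (\<Union> (F ` (A \<inter> B)))"
        using A by (intro less.prems(2)) auto
      also have "card (\<Union> (F ` (A \<inter> B))) \<le> card (?P \<inter> ?Q)"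
        using finPQ by (intro card_mono) auto
      also have "card (?P \<union> ?Q) + card (?P \<inter> ?Q) = card ?P + card ?Q"
        using card_Un_Int[OF finPQ] by simp
      finally show False
        using A(2) B(2) by simp
    qed
    then obtain z where z: "z \<in> {x, y}" and hall: "\<And>J. J \<subseteq> I \<Longrightarrow> card J \<le> card (\<Union> ((F(k := F k - {z})) ` J))"
      unfolding hall_without_def by blast
    have "z \<in> F k"
      using z xy by auto
    define G where "G = F(k := F k - {z})"
    have G: "G i \<subseteq> F i" for i
      by (simp add: G_def)
    have "card (G k) < card (F k)"
      using less.prems(1)[OF k(1)] \<open>z \<in> F k\<close> by (intro psubset_card_mono) (auto simp: G_def)
    then have "(\<Sum>i\<in>I. card (G i)) < (\<Sum>i\<in>I. card (F i))"
      using \<open>finite I\<close> k(1) less.prems(1) G by (intro sum_strict_mono_ex1) (auto intro: card_mono)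
    moreover have "finite (G i)" if "i \<in> I" for i
      using less.prems(1)[OF that] G by (rule rev_finite_subset)
    ultimately obtain f where "inj_on f I" "\<forall>i\<in>I. f i \<in> G i"
      using less.hyps[of G] hall unfolding G_def[symmetric] by auto
    then show ?thesis
      using G by blast
  qed
qed

section \<open>Permutation matrices and the doubly stochastic polytope\<close>

definition permutation_matrix :: "('n \<Rightarrow> 'n) \<Rightarrow> real^'n^'n" where
  "permutation_matrix \<sigma> = (\<chi> i j. if j = \<sigma> i then 1 else 0)"

lemma doubly_stochastic_iff:
  "S \<in> doubly_stochastic \<longleftrightarrow>
    (\<forall>i j. 0 \<le> S $ i $ j) \<and> (\<forall>i. (\<Sum>j\<in>UNIV. S $ i $ j) = 1) \<and> (\<forall>j. (\<Sum>i\<in>UNIV. S $ i $ j) = 1)"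
  by (simp add: doubly_stochastic_def)

lemma sum_if_permutation: "bij \<sigma> \<Longrightarrow> (\<Sum>i\<in>UNIV. if j = \<sigma> i then c else 0) = (c::'a::comm_monoid_add)"
  for \<sigma> :: "'n::finite \<Rightarrow> 'n"
  using sum.reindex_bij_betw[of \<sigma> UNIV UNIV "\<lambda>i. if j = i then c else 0"] by simp

lemma permutation_matrix_doubly_stochastic:
  "bij \<sigma> \<Longrightarrow> permutation_matrix \<sigma> \<in> doubly_stochastic" for \<sigma> :: "'n::finite \<Rightarrow> 'n"
  by (simp add: doubly_stochastic_iff permutation_matrix_def sum_if_permutation)

text \<open>The column condition is left out because the separation argument below treats the column
  sums as part of a linear image.\<close>

definition row_stochastic :: "(real^'n^'n) set" where
  "row_stochastic = {S. (\<forall>i j. 0 \<le> S $ i $ j) \<and> (\<forall>i. (\<Sum>j\<in>UNIV. S $ i $ j) = 1)}"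

lemma convex_row_stochastic: "convex (row_stochastic :: (real^'n::finite^'n) set)"
  by (auto simp: convex_def row_stochastic_def sum.distrib simp flip: sum_distrib_left)

lemma compact_row_stochastic: "compact (row_stochastic :: (real^'n::finite^'n) set)"
proof -
  have "closed (\<Inter>i. \<Inter>j. {S :: real^'n^'n. 0 \<le> S $ i $ j})"
    by (intro closed_INT ballI closed_Collect_le continuous_intros)
  moreover have "closed (\<Inter>i. {S :: real^'n^'n. (\<Sum>j\<in>UNIV. S $ i $ j) = 1})"
    by (intro closed_INT ballI closed_Collect_eq continuous_intros)
  moreover have "row_stochastic = (\<Inter>i. \<Inter>j. {S :: real^'n^'n. 0 \<le> S $ i $ j}) \<inter>
      (\<Inter>i. {S. (\<Sum>j\<in>UNIV. S $ i $ j) = 1})"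
    by (auto simp: row_stochastic_def)
  ultimately have "closed (row_stochastic :: (real^'n^'n) set)"
    by (metis closed_Int)
  moreover have "norm S \<le> real CARD('n)" if "S \<in> row_stochastic" for S :: "real^'n^'n"
  proof -
    have "norm S \<le> (\<Sum>i\<in>UNIV. norm (S $ i))"
      unfolding norm_vec_def[of S] by (rule L2_set_le_sum) simp
    also have "\<dots> \<le> (\<Sum>i\<in>(UNIV::'n set). 1)"
    proof (rule sum_mono)
      fix i
      have "norm (S $ i) \<le> (\<Sum>j\<in>UNIV. \<bar>S $ i $ j\<bar>)"
        by (rule norm_le_l1_cart)
      then show "norm (S $ i) \<le> 1"
        using that by (simp add: row_stochastic_def)
    qed
    finally show ?thesis
      by simp
  qed
  ultimately show ?thesis
    by (auto simp: compact_eq_bounded_closed bounded_iff)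
qed

lemma doubly_stochastic_eq:
  "doubly_stochastic = row_stochastic \<inter> {S. \<forall>j. (\<Sum>i\<in>UNIV. S $ i $ j) = 1}"
  by (auto simp: doubly_stochastic_def row_stochastic_def)

lemma compact_doubly_stochastic: "compact (doubly_stochastic :: (real^'n::finite^'n) set)"
proof -
  have "closed (\<Inter>j. {S :: real^'n^'n. (\<Sum>i\<in>UNIV. S $ i $ j) = 1})"
    by (intro closed_INT ballI closed_Collect_eq continuous_intros)
  also have "(\<Inter>j. {S :: real^'n^'n. (\<Sum>i\<in>UNIV. S $ i $ j) = 1}) = {S. \<forall>j. (\<Sum>i\<in>UNIV. S $ i $ j) = 1}"
    by auto
  finally show ?thesis
    unfolding doubly_stochastic_eq by (intro compact_Int_closed compact_row_stochastic)
qed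

lemma convex_doubly_stochastic: "convex (doubly_stochastic :: (real^'n::finite^'n) set)"
  by (auto simp: convex_def doubly_stochastic_def sum.distrib simp flip: sum_distrib_left)

text \<open>Hall's condition by counting mass: the rows in \<open>J\<close> carry total mass |J|,
  all of it in the columns of \<open>?N\<close>, which carry only mass |N|.\<close>

lemma doubly_stochastic_positive_permutation:
  fixes S :: "real^'n::finite^'n"
  assumes S: "S \<in> doubly_stochastic"
  obtains \<sigma> where "bij \<sigma>" "\<And>i. 0 < S $ i $ \<sigma> i"
proof -
  let ?F = "\<lambda>i. {j. 0 < S $ i $ j}"
  have nn: "0 \<le> S $ i $ j" and row: "(\<Sum>j\<in>UNIV. S $ i $ j) = 1" and col: "(\<Sum>i\<in>UNIV. S $ i $ j) = 1" for i j
    using S by (auto simp: doubly_stochastic_iff)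
  have "card J \<le> card (\<Union> (?F ` J))" for J :: "'n set"
  proof -
    let ?N = "\<Union> (?F ` J)"
    have "real (card J) = (\<Sum>i\<in>J. \<Sum>j\<in>UNIV. S $ i $ j)"
      by (simp add: row)
    also have "\<dots> = (\<Sum>i\<in>J. \<Sum>j\<in>?N. S $ i $ j)"
    proof (rule sum.cong[OF refl], rule sum.mono_neutral_right)
      fix i assume i: "i \<in> J"
      show "\<forall>j\<in>UNIV - ?N. S $ i $ j = 0"
      proof
        fix j assume "j \<in> UNIV - ?N"
        then have "\<not> 0 < S $ i $ j"
          using i by blast
        then show "S $ i $ j = 0"
          using nn[of i j] by simp
      qed
    qed auto
    also have "\<dots> = (\<Sum>j\<in>?N. \<Sum>i\<in>J. S $ i $ j)"
      by (rule sum.swap)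
    also have "\<dots> \<le> (\<Sum>j\<in>?N. \<Sum>i\<in>UNIV. S $ i $ j)"
      by (intro sum_mono sum_mono2) (auto simp: nn)
    finally show ?thesis
      by (simp add: col)
  qed
  then obtain f where f: "inj f" "\<And>i. 0 < S $ i $ f i"
    using hall_marriage[of UNIV ?F] by auto
  then show ?thesis
    using that[of f] by (simp add: bij_def finite_UNIV_inj_surj)
qed

text \<open>By Krein-Milman it suffices to identify the extreme points. A permutation along which
  \<open>S\<close> is positive can be split off with some weight, and extremality then forces
  \<open>S\<close> to be that permutation matrix.\<close>

theorem birkhoff:
  fixes S :: "real^'n::finite^'n"
  assumes "S \<in> doubly_stochastic"
  shows "S \<in> convex hull (permutation_matrix ` {\<sigma>. bij \<sigma>})"
proof -
  have "\<exists>\<sigma>. bij \<sigma> \<and> S = permutation_matrix \<sigma>" if ext: "S extreme_point_of doubly_stochastic" for S :: "real^'n^'n"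
  proof -
    have S: "S \<in> doubly_stochastic"
      using ext by (simp add: extreme_point_of_def)
    then have nn: "0 \<le> S $ i $ j" and row: "(\<Sum>j\<in>UNIV. S $ i $ j) = 1" and col: "(\<Sum>i\<in>UNIV. S $ i $ j) = 1" for i j
      by (auto simp: doubly_stochastic_iff)
    obtain \<sigma> where \<sigma>: "bij \<sigma>" "\<And>i. 0 < S $ i $ \<sigma> i"
      using doubly_stochastic_positive_permutation[OF S] by blast
    let ?P = "permutation_matrix \<sigma>"
    \<comment> \<open>The largest multiple of \<open>?P\<close> that can be subtracted with all
      entries staying nonnegative. It lowers each row and column sum by \<open>e\<close>, whence the
      factor 1 / (1 - e) in \<open>T\<close>.\<close>
    define e where "e = Min (range (\<lambda>i. S $ i $ \<sigma> i))"
    have e: "0 < e" "\<And>i. e \<le> S $ i $ \<sigma> i"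
      using \<sigma>(2) by (auto simp: e_def)
    have le1: "S $ i $ j \<le> 1" for i j
      using member_le_sum[of j UNIV "\<lambda>j. S $ i $ j"] nn row by simp
    show ?thesis
    proof (cases "e < 1")
      case True
      define T where "T = (1 / (1 - e)) *\<^sub>R (S - e *\<^sub>R ?P)"
      have "T \<in> doubly_stochastic"
        using e True nn row col
        by (auto simp: doubly_stochastic_iff T_def permutation_matrix_def sum_subtractf
            sum_if_permutation[OF \<sigma>(1)] simp flip: sum_divide_distrib sum_distrib_left)
      moreover have "S = (1 - e) *\<^sub>R T + e *\<^sub>R ?P"
        using True by (simp add: T_def)
      ultimately have "T = ?P"
        using ext e True permutation_matrix_doubly_stochastic[OF \<sigma>(1)]
        unfolding extreme_point_of_def by (metis in_segment(2))
      then have "S = ?P"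
        using \<open>S = (1 - e) *\<^sub>R T + e *\<^sub>R ?P\<close> by (simp flip: scaleR_add_left)
      then show ?thesis
        using \<sigma> by blast
    next
      case False
      have 1: "S $ i $ \<sigma> i = 1" for i
        using e(2)[of i] le1[of i "\<sigma> i"] False by simp
      have "S $ i $ j = 0" if "j \<noteq> \<sigma> i" for i j
      proof -
        have "(\<Sum>k\<in>{j, \<sigma> i}. S $ i $ k) \<le> (\<Sum>k\<in>UNIV. S $ i $ k)"
          by (rule sum_mono2) (auto simp: nn)
        then show ?thesis
          using that nn[of i j] by (simp add: row 1)
      qed
      then have "S = ?P"
        by (auto simp: vec_eq_iff permutation_matrix_def 1)
      then show ?thesis
        using \<sigma> by blast
    qed
  qed
  then have "{S. S extreme_point_of doubly_stochastic} \<subseteq> permutation_matrix ` {\<sigma> :: 'n \<Rightarrow> 'n. bij \<sigma>}"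
    by blast
  then show ?thesis
    using assms Krein_Milman_Minkowski[OF compact_doubly_stochastic convex_doubly_stochastic]
    by (metis hull_mono subset_iff)
qed

section \<open>Majorization of point configurations\<close>

text \<open>
  If \<open>\<alpha> = S \<beta>\<close> has no doubly stochastic solution, separate \<open>(1, \<alpha>)\<close> from the pairs
  (column sums of \<open>S\<close>, \<open>S \<beta>\<close>) with \<open>S\<close> row stochastic.  The separating functional
  \<open>(q, -c)\<close> yields the convex function \<open>x \<mapsto> max\<^sub>i (c\<^sub>i \<bullet> x + p\<^sub>i)\<close> with
  \<open>p\<^sub>i = min\<^sub>k (q\<^sub>k - c\<^sub>i \<bullet> \<beta>\<^sub>k)\<close>, which is at most \<open>q\<^sub>k\<close> at \<open>\<beta>\<^sub>k\<close>.
\<close>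

theorem doubly_stochastic_majorization_iff:
  fixes \<alpha> \<beta> :: "'n::finite \<Rightarrow> 'a::euclidean_space"
  shows "(\<exists>S\<in>doubly_stochastic. \<forall>i. \<alpha> i = (\<Sum>k\<in>UNIV. S $ i $ k *\<^sub>R \<beta> k)) \<longleftrightarrow>
    (\<forall>f. continuous_on UNIV f \<longrightarrow> convex_on UNIV f \<longrightarrow> (\<Sum>i\<in>UNIV. f (\<alpha> i)) \<le> (\<Sum>i\<in>UNIV. (f (\<beta> i) :: real)))"
    (is "?L \<longleftrightarrow> ?R")
proof
  assume ?L
  then obtain S :: "real^'n^'n" where S: "S \<in> doubly_stochastic" "\<And>i. \<alpha> i = (\<Sum>k\<in>UNIV. S $ i $ k *\<^sub>R \<beta> k)"
    by blast
  show ?R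
  proof (intro allI impI)
    fix f :: "'a \<Rightarrow> real" assume f: "convex_on UNIV f"
    have "(\<Sum>i\<in>UNIV. f (\<alpha> i)) \<le> (\<Sum>i\<in>UNIV. \<Sum>k\<in>UNIV. S $ i $ k * f (\<beta> k))"
      using S(1) unfolding S(2)
      by (intro sum_mono convex_on_sum[OF _ _ f]) (auto simp: doubly_stochastic_iff)
    also have "\<dots> = (\<Sum>k\<in>UNIV. (\<Sum>i\<in>UNIV. S $ i $ k) * f (\<beta> k))"
      unfolding sum_distrib_right by (rule sum.swap)
    also have "\<dots> = (\<Sum>k\<in>UNIV. f (\<beta> k))"
      using S(1) by (simp add: doubly_stochastic_iff)
    finally show "(\<Sum>i\<in>UNIV. f (\<alpha> i)) \<le> (\<Sum>i\<in>UNIV. f (\<beta> i))" .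
  qed
next
  assume R: ?R
  define L :: "real^'n^'n \<Rightarrow> (real^'n) \<times> ('a^'n)" where
    "L S = (\<chi> k. \<Sum>i\<in>UNIV. S $ i $ k, \<chi> i. \<Sum>k\<in>UNIV. S $ i $ k *\<^sub>R \<beta> k)" for S
  have L: "linear L"
    by (rule linearI)
       (simp_all add: L_def vec_eq_iff sum.distrib scaleR_left_distrib sum_distrib_left scaleR_sum_right)
  let ?z = "(1, \<chi> i. \<alpha> i) :: (real^'n) \<times> ('a^'n)"
  show ?L
  proof (cases "?z \<in> L ` row_stochastic")
    case True
    then obtain S where "S \<in> row_stochastic" "L S = ?z"
      by force
    then show ?thesis
      by (intro bexI[of _ S]) (auto simp: L_def vec_eq_iff doubly_stochastic_eq)
  next
    case False
    have "compact (L ` row_stochastic)"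
      using L by (intro compact_continuous_image compact_row_stochastic linear_continuous_on)
        (simp add: linear_conv_bounded_linear)
    moreover have "convex (L ` row_stochastic)"
      using L convex_row_stochastic by (rule convex_linear_image)
    ultimately obtain a b where ab: "inner a ?z < b" "\<And>S. S \<in> row_stochastic \<Longrightarrow> inner a (L S) > b"
      using separating_hyperplane_closed_point[of "L ` row_stochastic" ?z] False
      by (auto simp: compact_imp_closed)
    define q where "q k = fst a $ k" for k
    define c where "c i = - (snd a $ i)" for i
    define p where "p i = Min (range (\<lambda>k. q k - inner (c i) (\<beta> k)))" for i
    have "\<exists>k. p i = q k - inner (c i) (\<beta> k)" for i
    proof -
      have "p i \<in> range (\<lambda>k. q k - inner (c i) (\<beta> k))"
        unfolding p_def by (intro Min_in) auto
      then show ?thesis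
        by blast
    qed
    then obtain \<kappa> where \<kappa>: "\<And>i. p i = q (\<kappa> i) - inner (c i) (\<beta> (\<kappa> i))"
      by metis
    have p: "p i \<le> q k - inner (c i) (\<beta> k)" for i k
      unfolding p_def by (intro Min_le) auto
    define f where "f x = Max (range (\<lambda>i. p i + inner (c i) x))" for x
    have fge: "p i + inner (c i) x \<le> f x" for i x
      unfolding f_def by (intro Max_ge) auto
    have fle: "f x \<le> r" if "\<And>i. p i + inner (c i) x \<le> r" for x r
      unfolding f_def using that by (subst Max_le_iff) auto
    have f: "convex_on UNIV f"
    proof (rule convex_onI)
      fix t :: real and x y assume t: "0 < t" "t < 1"
      show "f ((1 - t) *\<^sub>R x + t *\<^sub>R y) \<le> (1 - t) * f x + t * f y"
      proof (rule fle)
        fix i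
        have "p i + inner (c i) ((1 - t) *\<^sub>R x + t *\<^sub>R y) =
            (1 - t) * (p i + inner (c i) x) + t * (p i + inner (c i) y)"
          by (simp add: inner_add_right algebra_simps)
        also have "\<dots> \<le> (1 - t) * f x + t * f y"
          using t by (intro add_mono mult_left_mono fge) auto
        finally show "p i + inner (c i) ((1 - t) *\<^sub>R x + t *\<^sub>R y) \<le> (1 - t) * f x + t * f y" .
      qed
    qed simp
    \<comment> \<open>Row \<open>i\<close> puts all its mass on the index \<open>\<kappa> i\<close>
      that attains the minimum \<open>p i\<close>; at this matrix the separating inequality reads b
      < \<Sum> p_i.\<close>
    let ?S = "(\<chi> i k. if k = \<kappa> i then 1 else 0) :: real^'n^'n"
    have "b < inner a (L ?S)"
      by (intro ab(2)) (simp add: row_stochastic_def)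
    also have "inner a (L ?S) = (\<Sum>k\<in>UNIV. \<Sum>i\<in>UNIV. q k * (if k = \<kappa> i then 1 else 0)) - (\<Sum>i\<in>UNIV. inner (c i) (\<beta> (\<kappa> i)))"
      by (simp add: L_def inner_prod_def inner_vec_def q_def c_def sum_negf sum_distrib_left
          if_distrib[of "\<lambda>r. r *\<^sub>R _"] cong: if_cong)
    also have "(\<Sum>k\<in>UNIV. \<Sum>i\<in>UNIV. q k * (if k = \<kappa> i then 1 else 0)) = (\<Sum>i\<in>UNIV. q (\<kappa> i))"
      by (subst sum.swap) (simp add: if_distrib[of "\<lambda>r. _ * r"] cong: if_cong)
    finally have "b < (\<Sum>i\<in>UNIV. p i)"
      by (simp add: \<kappa> sum_subtractf)
    moreover have "inner a ?z = (\<Sum>k\<in>UNIV. q k) - (\<Sum>i\<in>UNIV. inner (c i) (\<alpha> i))"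
      by (simp add: inner_prod_def inner_vec_def q_def c_def sum_negf)
    ultimately have "(\<Sum>k\<in>UNIV. q k) < (\<Sum>i\<in>UNIV. p i + inner (c i) (\<alpha> i))"
      using ab(1) by (simp add: sum.distrib)
    also have "\<dots> \<le> (\<Sum>i\<in>UNIV. f (\<alpha> i))"
      by (intro sum_mono fge)
    also have "\<dots> \<le> (\<Sum>k\<in>UNIV. f (\<beta> k))"
      using R f convex_on_continuous[OF open_UNIV f] by blast
    also have "\<dots> \<le> (\<Sum>k\<in>UNIV. q k)"
    proof (intro sum_mono fle)
      fix i k show "p i + inner (c i) (\<beta> k) \<le> q k"
        using p[of i k] by simp
    qed
    finally show ?thesis
      by simp
  qed
qed

section \<open>Tracial states\<close>

lemma tracial_stateD:
  assumes "tracial_state \<AA> \<tau>"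
  shows "a \<in> carrier \<AA> \<Longrightarrow> b \<in> carrier \<AA> \<Longrightarrow> \<tau> (a \<oplus>\<^bsub>\<AA>\<^esub> b) = \<tau> a + \<tau> b"
    and "a \<in> carrier \<AA> \<Longrightarrow> \<tau> (c \<odot>\<^bsub>\<AA>\<^esub> a) = c * \<tau> a"
    and "a \<in> carrier \<AA> \<Longrightarrow> \<tau> (star \<AA> a \<otimes>\<^bsub>\<AA>\<^esub> a) \<in> \<real>\<^sub>\<ge>\<^sub>0"
    and "\<tau> \<one>\<^bsub>\<AA>\<^esub> = 1"
    and "a \<in> carrier \<AA> \<Longrightarrow> b \<in> carrier \<AA> \<Longrightarrow> \<tau> (a \<otimes>\<^bsub>\<AA>\<^esub> b) = \<tau> (b \<otimes>\<^bsub>\<AA>\<^esub> a)"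
  using assms unfolding tracial_state_def by blast+

lemma tracial_state_matrix_sum:
  fixes H :: "'i \<Rightarrow> 'x::metric_space \<Rightarrow> complex^'n::finite^'n"
  assumes \<tau>: "tracial_state (cont_matrix_algebra X) \<tau>" and "finite I"
    and "\<And>i. i \<in> I \<Longrightarrow> continuous_on X (H i)"
  shows "\<tau> (\<lambda>x\<in>X. \<Sum>i\<in>I. H i x) = (\<Sum>i\<in>I. \<tau> (\<lambda>x\<in>X. H i x))"
  using assms(2,3)
proof (induction I rule: finite_induct)
  case empty
  let ?Z = "\<lambda>x\<in>X. 0 :: complex^'n^'n"
  have "\<tau> (0 \<odot>\<^bsub>cont_matrix_algebra X\<^esub> ?Z) = 0 * \<tau> ?Z"
    by (rule tracial_stateD(2)[OF \<tau>]) simp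
  moreover have "0 \<odot>\<^bsub>cont_matrix_algebra X\<^esub> ?Z = ?Z"
    by (auto simp: matrix_algebra_smult vec_eq_iff)
  ultimately show ?case
    by (simp del: restrict_apply)
next
  case (insert i I)
  have "\<tau> (\<lambda>x\<in>X. \<Sum>i\<in>insert i I. H i x) =
      \<tau> ((\<lambda>x\<in>X. H i x) \<oplus>\<^bsub>cont_matrix_algebra X\<^esub> (\<lambda>x\<in>X. \<Sum>i\<in>I. H i x))"
    using insert.hyps by (intro arg_cong[of _ _ \<tau>]) auto
  also have "\<dots> = \<tau> (\<lambda>x\<in>X. H i x) + \<tau> (\<lambda>x\<in>X. \<Sum>i\<in>I. H i x)"
    using insert.prems by (intro tracial_stateD(1)[OF \<tau>]) (auto intro!: continuous_intros)
  finally show ?case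
    using insert by (simp del: restrict_apply)
qed

text \<open>
  With matrix units \<open>E\<^sub>i\<^sub>j\<close>, a trace kills \<open>c E\<^sub>i\<^sub>j = (c E\<^sub>i\<^sub>i) E\<^sub>i\<^sub>j\<close> for \<open>i \<noteq> j\<close> and
  takes the same value at \<open>c E\<^sub>i\<^sub>i = (c E\<^sub>i\<^sub>j) E\<^sub>j\<^sub>i\<close> and \<open>c E\<^sub>j\<^sub>j = E\<^sub>j\<^sub>i (c E\<^sub>i\<^sub>j)\<close>.
\<close>

definition scaled_unit :: "'n \<Rightarrow> 'n \<Rightarrow> complex \<Rightarrow> complex^'n^'n" where
  "scaled_unit i j c = (\<chi> k l. if k = i \<and> l = j then c else 0)"

lemma scaled_unit_mult:
  "scaled_unit i j c ** scaled_unit k l d = (if j = k then scaled_unit i l (c * d) else 0)"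
  for i :: "'n::finite"
  by (auto simp: vec_eq_iff matrix_matrix_mult_def scaled_unit_def if_distrib[of "\<lambda>x. x * _"] if_distrib[of "\<lambda>x. _ * x"]
      simp flip: if_bool_eq_conj cong: if_cong conj_cong)

lemma continuous_on_scaled_unit [continuous_intros]:
  assumes "continuous_on X c"
  shows "continuous_on X (\<lambda>x. scaled_unit i j (c x))"
proof -
  have "continuous_on X (\<lambda>x. if k = i \<and> l = j then c x else 0)" for k l
    using assms by (cases "k = i"; cases "l = j") simp_all
  then show ?thesis
    unfolding scaled_unit_def by (intro continuous_on_vec_lambda)
qed

lemma matrix_eq_sum_scaled_unit: "M = (\<Sum>(i, j)\<in>UNIV. scaled_unit i j (M $ i $ j))"
  for M :: "complex^'n::finite^'n"
proof -
  have "(case p of (i, j) \<Rightarrow> scaled_unit i j (M $ i $ j)) $ k $ l = (if p = (k, l) then M $ k $ l else 0)" for p k l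
    by (cases p) (auto simp: scaled_unit_def)
  then show ?thesis
    by (simp add: vec_eq_iff sum_component)
qed

lemma tracial_state_cong_trace:
  fixes F G :: "'x::metric_space \<Rightarrow> complex^'n::finite^'n"
  assumes \<tau>: "tracial_state (cont_matrix_algebra X) \<tau>"
    and F: "F \<in> carrier (cont_matrix_algebra X)" and G: "G \<in> carrier (cont_matrix_algebra X)"
    and eq: "\<And>x. x \<in> X \<Longrightarrow> trace (F x) = trace (G x)"
  shows "\<tau> F = \<tau> G"
proof -
  let ?E = "\<lambda>i j c. \<lambda>x\<in>X. scaled_unit i j (c x) :: complex^'n^'n"
  have comm: "\<tau> (\<lambda>x\<in>X. F x ** G x) = \<tau> (\<lambda>x\<in>X. G x ** F x)"
    if "continuous_on X F" "continuous_on X G" for F G :: "'x \<Rightarrow> complex^'n^'n"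
  proof -
    have "\<tau> (restrict F X \<otimes>\<^bsub>cont_matrix_algebra X\<^esub> restrict G X) =
        \<tau> (restrict G X \<otimes>\<^bsub>cont_matrix_algebra X\<^esub> restrict F X)"
      using that by (intro tracial_stateD(5)[OF \<tau>]) simp_all
    then show ?thesis
      by (simp cong: restrict_cong)
  qed
  have off: "\<tau> (?E i j c) = 0" if c: "continuous_on X c" and "i \<noteq> j" for i j c
  proof -
    have "\<tau> (?E i j c) = \<tau> (\<lambda>x\<in>X. scaled_unit i i (c x) ** scaled_unit i j 1)"
      by (simp add: scaled_unit_mult)
    also have "\<dots> = \<tau> (\<lambda>x\<in>X. scaled_unit i j 1 ** scaled_unit i i (c x))"
      using c by (intro comm continuous_intros)
    also have "\<dots> = 0"
      using tracial_state_matrix_sum[OF \<tau>, of "{}"] that by (simp add: scaled_unit_mult)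
    finally show ?thesis .
  qed
  have diag: "\<tau> (?E i i c) = \<tau> (?E j j c)" if c: "continuous_on X c" for i j c
  proof -
    have "\<tau> (?E i i c) = \<tau> (\<lambda>x\<in>X. scaled_unit i j (c x) ** scaled_unit j i 1)"
      by (simp add: scaled_unit_mult)
    also have "\<dots> = \<tau> (\<lambda>x\<in>X. scaled_unit j i 1 ** scaled_unit i j (c x))"
      using c by (intro comm continuous_intros)
    finally show ?thesis
      by (simp add: scaled_unit_mult)
  qed
  \<comment> \<open>All diagonal parts are moved into one fixed corner, where they add up to the
    trace; \<open>undefined\<close> is just a name for that index.\<close>
  have main: "\<tau> F = \<tau> (?E undefined undefined (\<lambda>x. trace (F x)))"
    if F: "F \<in> carrier (cont_matrix_algebra X)" for F
  proof -
    have c: "continuous_on X (\<lambda>x. F x $ i $ j)" for i j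
      using F by (auto intro!: continuous_intros)
    have "F = (\<lambda>x\<in>X. \<Sum>p\<in>UNIV. scaled_unit (fst p) (snd p) (F x $ fst p $ snd p))"
      using F matrix_eq_sum_scaled_unit by (intro extensionalityI[of _ X]) (auto simp: case_prod_unfold)
    then have "\<tau> F = \<tau> (\<lambda>x\<in>X. \<Sum>p\<in>UNIV. scaled_unit (fst p) (snd p) (F x $ fst p $ snd p))"
      by (rule arg_cong)
    also have "\<dots> = (\<Sum>p\<in>UNIV. \<tau> (?E (fst p) (snd p) (\<lambda>x. F x $ fst p $ snd p)))"
      by (intro tracial_state_matrix_sum[OF \<tau>] continuous_on_scaled_unit c finite)
    also have "\<dots> = (\<Sum>i\<in>UNIV. \<Sum>j\<in>UNIV. \<tau> (?E i j (\<lambda>x. F x $ i $ j)))"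
      by (simp add: sum.cartesian_product case_prod_unfold flip: UNIV_Times_UNIV)
    also have "\<dots> = (\<Sum>i\<in>UNIV. \<Sum>j\<in>UNIV. if i = j then \<tau> (?E undefined undefined (\<lambda>x. F x $ i $ i)) else 0)"
      using off[OF c] diag[OF c] by (intro sum.cong refl) auto
    also have "\<dots> = (\<Sum>i\<in>UNIV. \<tau> (?E undefined undefined (\<lambda>x. F x $ i $ i)))"
      by simp
    also have "\<dots> = \<tau> (\<lambda>x\<in>X. \<Sum>i\<in>UNIV. scaled_unit undefined undefined (F x $ i $ i))"
      by (intro tracial_state_matrix_sum[OF \<tau>, symmetric] continuous_on_scaled_unit c finite)
    also have "(\<lambda>x\<in>X. \<Sum>i\<in>UNIV. scaled_unit undefined undefined (F x $ i $ i)) = ?E undefined undefined (\<lambda>x. trace (F x))"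
      by (intro restrict_ext) (auto simp: scaled_unit_def trace_def vec_eq_iff sum_component)
    finally show ?thesis .
  qed
  show ?thesis
    using eq by (simp add: main[OF F] main[OF G] cong: restrict_cong)
qed

lemma trace_adjoint_mult: "trace (adjoint_mat M ** M) = of_real (\<Sum>i\<in>UNIV. \<Sum>j\<in>UNIV. (norm (M $ j $ i))\<^sup>2)"
  for M :: "complex^'n::finite^'n"
  unfolding trace_def matrix_matrix_mult_def of_real_sum complex_norm_square by (simp add: mult.commute)

section \<open>The normalized trace and its evaluations at points\<close>

lemma normalized_trace:
  fixes M N :: "complex^'n::finite^'n"
  shows "trace (M + N) / of_nat CARD('n) = trace M / of_nat CARD('n) + trace N / of_nat CARD('n)"
    and "trace (c \<odot>\<^bsub>matrix_algebra\<^esub> M) / of_nat CARD('n) = c * (trace M / of_nat CARD('n))"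
    and "trace (adjoint_mat M ** M) / of_nat CARD('n) \<in> \<real>\<^sub>\<ge>\<^sub>0"
    and "trace (mat 1 :: complex^'n^'n) / of_nat CARD('n) = 1"
    and "trace (M ** N) / of_nat CARD('n) = trace (N ** M) / of_nat CARD('n)"
proof -
  have "trace (adjoint_mat M ** M) / of_nat CARD('n) =
      of_real ((\<Sum>i\<in>UNIV. \<Sum>j\<in>UNIV. (norm (M $ j $ i))\<^sup>2) / real CARD('n))"
    by (simp add: trace_adjoint_mult)
  then show "trace (adjoint_mat M ** M) / of_nat CARD('n) \<in> \<real>\<^sub>\<ge>\<^sub>0"
    by (simp only: nonneg_Reals_of_real_iff) (simp add: sum_nonneg)
  show "trace (M ** N) / of_nat CARD('n) = trace (N ** M) / of_nat CARD('n)"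
    by (subst trace_mul_sym) simp
qed (simp_all add: trace_add add_divide_distrib trace_I, simp add: trace_def matrix_algebra_smult sum_distrib_left)

lemma tracial_state_at:
  assumes "x \<in> X"
  shows "tracial_state (cont_matrix_algebra X) (\<lambda>F :: 'x::metric_space \<Rightarrow> complex^'n::finite^'n. trace (F x) / of_nat CARD('n))"
  unfolding tracial_state_def using assms
  by (intro conjI ballI allI) (simp_all only: cont_matrix_algebra_simps restrict_apply if_True normalized_trace(1-4),
      rule normalized_trace(5))

lemma tracial_state_matrix:
  "tracial_state matrix_algebra (\<lambda>M :: complex^'n::finite^'n. trace M / of_nat CARD('n))"
  unfolding tracial_state_def
  by (intro conjI ballI allI) (simp_all only: matrix_algebra_simps normalized_trace(1-4), rule normalized_trace(5))

text \<open>Uniqueness is read off from the algebra of functions on a one-point space.\<close>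

lemma tracial_state_matrix_unique:
  fixes M :: "complex^'n::finite^'n"
  assumes \<tau>: "tracial_state matrix_algebra \<tau>"
  shows "\<tau> M = trace M / of_nat CARD('n)"
proof -
  have \<tau>': "\<tau> (M + N) = \<tau> M + \<tau> N" "\<tau> (c \<odot>\<^bsub>matrix_algebra\<^esub> M) = c * \<tau> M"
    "\<tau> (adjoint_mat M ** M) \<in> \<real>\<^sub>\<ge>\<^sub>0" "\<tau> (mat 1) = 1" "\<tau> (M ** N) = \<tau> (N ** M)" for M N c
    using \<tau>[unfolded tracial_state_def matrix_algebra_simps] by blast+
  let ?X = "{0::real}"
  let ?N = "(trace M / of_nat CARD('n)) \<odot>\<^bsub>matrix_algebra\<^esub> mat 1 :: complex^'n^'n"
  have "tracial_state (cont_matrix_algebra ?X) (\<lambda>F. \<tau> (F 0))"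
    unfolding tracial_state_def
    by (intro conjI ballI allI)
      (simp_all only: cont_matrix_algebra_simps restrict_apply if_True singleton_iff simp_thms \<tau>'(1-4), rule \<tau>'(5))
  moreover have "trace M = trace ?N"
    by (simp add: trace_def matrix_algebra_smult mat_def)
  ultimately have "\<tau> ((\<lambda>x\<in>?X. M) 0) = \<tau> ((\<lambda>x\<in>?X. ?N) 0)"
    by (intro tracial_state_cong_trace[of ?X "\<lambda>F. \<tau> (F 0)"]) (simp_all del: restrict_apply, simp)
  also have "\<dots> = trace M / of_nat CARD('n)"
    by (simp add: \<tau>'(2,4))
  finally show ?thesis
    by simp
qed

section \<open>Tracial and pointwise majorization\<close>

text \<open>\<open>tr_majorized\<close> on M_n without the quantifier over tracial states: the
  normalized trace is the only one, and the factor 1/n does not affect an inequality.\<close>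

definition trace_majorized :: "('m::finite \<Rightarrow> complex^'n::finite^'n) \<Rightarrow> ('m \<Rightarrow> complex^'n^'n) \<Rightarrow> bool" where
  "trace_majorized a b \<longleftrightarrow> (\<forall>f :: real^'m \<Rightarrow> real. continuous_on UNIV f \<longrightarrow> convex_on UNIV f \<longrightarrow>
     Re (trace (functional_calculus matrix_algebra f a)) \<le> Re (trace (functional_calculus matrix_algebra f b)))"

lemma tr_majorized_matrix_iff:
  "tr_majorized matrix_algebra a b \<longleftrightarrow> trace_majorized a b"
  for a b :: "'m::finite \<Rightarrow> complex^'n::finite^'n"
proof -
  have Re: "Re (z / of_nat CARD('n)) = Re z / real CARD('n)" for z
    by (metis Re_divide_of_real of_real_of_nat_eq)
  have "Re (\<tau> M) = Re (trace M) / real CARD('n)"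
    if "tracial_state matrix_algebra \<tau>" for \<tau> and M :: "complex^'n^'n"
    using tracial_state_matrix_unique[OF that] Re by simp
  then show ?thesis
    using tracial_state_matrix unfolding tr_majorized_def trace_majorized_def
    by (auto simp: divide_le_cancel)
qed

lemma diag_columns_eq_iff:
  fixes a b :: "'m::finite \<Rightarrow> complex^'n::finite^'n"
  assumes "diagonalization a U D" "diagonalization b V D'"
    and "\<And>j. adjoint_mat (a j) = a j" "\<And>j. adjoint_mat (b j) = b j"
  shows "map_matrix complex_of_real S ** diag_columns D' = diag_columns D \<longleftrightarrow>
    (\<forall>i. diag_point D i = (\<Sum>k\<in>UNIV. S $ i $ k *\<^sub>R diag_point D' k))"
proof -
  have D: "D j $ i $ i = of_real (diag_point D i $ j)" "D' j $ i $ i = of_real (diag_point D' i $ j)" for i j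
    using diagonalization_real[OF assms(1,3), of j] diagonalization_real[OF assms(2,4), of j]
    by (simp_all add: diag_point_def) (metis diag_matrix_nth)+
  show ?thesis
    by (auto simp: vec_eq_iff matrix_matrix_mult_def map_matrix_def diag_columns_def D sum_component
        simp flip: of_real_mult of_real_sum)
qed

text \<open>One side does not mention the diagonalizations, so this also shows that the choice made
  in \<open>ds_majorized\<close> is immaterial.\<close>

lemma trace_majorized_iff_diag_points:
  fixes a b :: "'m::finite \<Rightarrow> complex^'n::finite^'n"
  assumes ab: "abelian_family matrix_algebra a" "abelian_family matrix_algebra b"
    and d: "diagonalization a U D" "diagonalization b V D'"
  shows "trace_majorized a b \<longleftrightarrow>
    (\<exists>S\<in>doubly_stochastic. map_matrix complex_of_real S ** diag_columns D' = diag_columns D)"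
proof -
  have sa: "adjoint_mat (a j) = a j" "adjoint_mat (b j) = b j" for j
    using ab by (auto simp: abelian_family_def)
  have "trace_majorized a b \<longleftrightarrow> (\<forall>f. continuous_on UNIV f \<longrightarrow> convex_on UNIV f \<longrightarrow>
      (\<Sum>i\<in>UNIV. f (diag_point D i)) \<le> (\<Sum>i\<in>UNIV. f (diag_point D' i)))"
    unfolding trace_majorized_def
    using ab d by (auto simp: matrix_functional_calculus[where ?U = U and D = D] matrix_functional_calculus[where ?U = V and D = D']
        trace_mat_calculus diagonalization_unitary)
  also have "\<dots> \<longleftrightarrow> (\<exists>S\<in>doubly_stochastic. \<forall>i. diag_point D i = (\<Sum>k\<in>UNIV. S $ i $ k *\<^sub>R diag_point D' k))"
    by (rule doubly_stochastic_majorization_iff[symmetric])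
  finally show ?thesis
    by (simp add: diag_columns_eq_iff[OF d sa])
qed

lemma ds_majorized_iff_trace_majorized:
  fixes a b :: "'m::finite \<Rightarrow> complex^'n::finite^'n"
  assumes ab: "abelian_family matrix_algebra a" "abelian_family matrix_algebra b"
  shows "ds_majorized a b \<longleftrightarrow> trace_majorized a b"
proof -
  obtain U D where "diagonalization a U D"
    using ab(1) by (rule simultaneous_diagonalization)
  moreover obtain V D' where "diagonalization b V D'"
    using ab(2) by (rule simultaneous_diagonalization)
  ultimately show ?thesis
    unfolding ds_majorized_def using trace_majorized_iff_diag_points[OF ab] by metis
qed

text \<open>Evaluation traces give the pointwise inequality. Conversely, f(B) has the same pointwise
  trace as f(A) + R*R for a scalar function R, so every tracial state takes on f(B) its value on
  f(A) plus a nonnegative number.\<close>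

theorem tr_majorized_cont_iff:
  fixes A B :: "'m::finite \<Rightarrow> 'x::metric_space \<Rightarrow> complex^'n::finite^'n"
  assumes X: "compact X" and A: "abelian_family (cont_matrix_algebra X) A"
    and B: "abelian_family (cont_matrix_algebra X) B"
  shows "tr_majorized (cont_matrix_algebra X) A B \<longleftrightarrow> (\<forall>x\<in>X. trace_majorized (\<lambda>j. A j x) (\<lambda>j. B j x))"
proof -
  have at: "functional_calculus (cont_matrix_algebra X) f A = (\<lambda>x\<in>X. functional_calculus matrix_algebra f (\<lambda>j. A j x))"
      "functional_calculus (cont_matrix_algebra X) f A \<in> carrier (cont_matrix_algebra X)"
    if A: "abelian_family (cont_matrix_algebra X) A" and f: "continuous_on UNIV f"
    for A :: "'m \<Rightarrow> 'x \<Rightarrow> complex^'n^'n" and f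
  proof -
    have "\<forall>x\<in>X. \<exists>U D. diagonalization (\<lambda>j. A j x) U D"
      using simultaneous_diagonalization[OF cont_abelian_family_at[OF A]] by metis
    then obtain U D where d: "\<And>x. x \<in> X \<Longrightarrow> diagonalization (\<lambda>j. A j x) (U x) (D x)"
      by metis
    have eq: "functional_calculus (cont_matrix_algebra X) f A = (\<lambda>x\<in>X. mat_calculus (U x) (D x) f)"
      and cont: "continuous_on X (\<lambda>x. mat_calculus (U x) (D x) f)"
      using cont_functional_calculus[OF X A d f] by auto
    show "functional_calculus (cont_matrix_algebra X) f A = (\<lambda>x\<in>X. functional_calculus matrix_algebra f (\<lambda>j. A j x))"
      unfolding eq using matrix_functional_calculus[OF cont_abelian_family_at[OF A] d f]
      by (auto intro!: restrict_ext)
    show "functional_calculus (cont_matrix_algebra X) f A \<in> carrier (cont_matrix_algebra X)"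
      using cont by (simp add: eq)
  qed
  have real: "Im (trace (functional_calculus matrix_algebra f (\<lambda>j. A j x))) = 0"
    if A: "abelian_family (cont_matrix_algebra X) A" and x: "x \<in> X" and f: "continuous_on UNIV f"
    for A :: "'m \<Rightarrow> 'x \<Rightarrow> complex^'n^'n" and f x
  proof -
    obtain U D where "diagonalization (\<lambda>j. A j x) U D"
      using cont_abelian_family_at[OF A x] by (rule simultaneous_diagonalization)
    then show ?thesis
      using matrix_functional_calculus[OF cont_abelian_family_at[OF A x] _ f]
      by (simp add: trace_mat_calculus diagonalization_unitary)
  qed
  show ?thesis
  proof
    assume tr: "tr_majorized (cont_matrix_algebra X) A B"
    show "\<forall>x\<in>X. trace_majorized (\<lambda>j. A j x) (\<lambda>j. B j x)"
      unfolding trace_majorized_def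
    proof (intro ballI allI impI)
      fix x and f :: "real^'m \<Rightarrow> real"
      assume x: "x \<in> X" and f: "continuous_on UNIV f" "convex_on UNIV f"
      have Re: "Re (z / of_nat CARD('n)) = Re z / real CARD('n)" for z
        by (metis Re_divide_of_real of_real_of_nat_eq)
      show "Re (trace (functional_calculus matrix_algebra f (\<lambda>j. A j x)))
          \<le> Re (trace (functional_calculus matrix_algebra f (\<lambda>j. B j x)))"
        using tr tracial_state_at[OF x] f x unfolding tr_majorized_def
        by (force simp: at(1)[OF A f(1)] at(1)[OF B f(1)] Re divide_le_cancel)
    qed
  next
    assume tr: "\<forall>x\<in>X. trace_majorized (\<lambda>j. A j x) (\<lambda>j. B j x)"
    show "tr_majorized (cont_matrix_algebra X) A B"
      unfolding tr_majorized_def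
    proof (intro allI impI)
      fix \<tau> :: "('x \<Rightarrow> complex^'n^'n) \<Rightarrow> complex" and f :: "real^'m \<Rightarrow> real"
      assume \<tau>: "tracial_state (cont_matrix_algebra X) \<tau>" and f: "continuous_on UNIV f" "convex_on UNIV f"
      let ?A = "functional_calculus (cont_matrix_algebra X) f A"
      let ?B = "functional_calculus (cont_matrix_algebra X) f B"
      have AB: "continuous_on X ?A" "continuous_on X ?B"
        "?A \<in> carrier (cont_matrix_algebra X)" "?B \<in> carrier (cont_matrix_algebra X)"
        using at(2)[OF A f(1)] at(2)[OF B f(1)] by auto
      \<comment> \<open>Dividing by n makes \<open>g x\<close> times the unit have the trace that
        f(A) lacks.\<close>
      define g where "g x = (Re (trace (?B x)) - Re (trace (?A x))) / real CARD('n)" for x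
      have g: "continuous_on X g"
        unfolding g_def trace_def using AB by (intro continuous_intros) auto
      have g0: "0 \<le> g x" if "x \<in> X" for x
        using tr that f by (simp add: g_def at(1)[OF A f(1)] at(1)[OF B f(1)] trace_majorized_def)
      \<comment> \<open>A square root is taken so that positivity of \<open>\<tau>\<close>, which is
        stated for products a* a, becomes applicable.\<close>
      define R :: "'x \<Rightarrow> complex^'n^'n" where "R = (\<lambda>x\<in>X. sqrt (g x) *\<^sub>R mat 1)"
      have R: "R \<in> carrier (cont_matrix_algebra X)"
        using g by (auto simp: R_def intro!: continuous_intros)
      let ?RR = "star (cont_matrix_algebra X) R \<otimes>\<^bsub>cont_matrix_algebra X\<^esub> R"
      have RR: "?RR = (\<lambda>x\<in>X. g x *\<^sub>R mat 1)"
        using g0 by (auto simp: R_def adjoint_mat_scaleR matrix_mult_scaleR intro!: restrict_ext)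
      have RRc: "?RR \<in> carrier (cont_matrix_algebra X)"
        unfolding RR using g by (auto intro!: continuous_intros)
      have "trace (?B x) = trace ((?A \<oplus>\<^bsub>cont_matrix_algebra X\<^esub> ?RR) x)" if x: "x \<in> X" for x
      proof -
        have "trace (g x *\<^sub>R mat 1 :: complex^'n^'n) = of_real (g x * real CARD('n))"
          by (simp add: trace_def mat_def scaleR_conv_of_real[where 'a=complex])
        also have "g x * real CARD('n) = Re (trace (?B x)) - Re (trace (?A x))"
          by (simp add: g_def)
        finally show ?thesis
          unfolding RR using x real[OF A x f(1)] real[OF B x f(1)]
          by (simp add: trace_add complex_eq_iff at(1)[OF A f(1)] at(1)[OF B f(1)])
      qed
      then have "\<tau> ?B = \<tau> (?A \<oplus>\<^bsub>cont_matrix_algebra X\<^esub> ?RR)"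
        using AB RRc by (intro tracial_state_cong_trace[OF \<tau>]) (auto intro!: continuous_intros)
      also have "\<dots> = \<tau> ?A + \<tau> ?RR"
        using \<tau> AB RRc unfolding tracial_state_def by blast
      finally have "\<tau> ?B = \<tau> ?A + \<tau> ?RR" .
      moreover have "\<tau> ?RR \<in> \<real>\<^sub>\<ge>\<^sub>0"
        using \<tau> R unfolding tracial_state_def by blast
      ultimately show "Re (\<tau> ?A) \<le> Re (\<tau> ?B)"
        by (simp add: complex_nonneg_Reals_iff)
    qed
  qed
qed

section \<open>Closed convex hulls of unitary orbits\<close>

lemma unitary_cont_iff:
  "W \<in> unitaries (cont_matrix_algebra X) \<longleftrightarrow>
    W \<in> extensional X \<and> continuous_on X W \<and> (\<forall>x\<in>X. W x \<in> unitaries matrix_algebra)"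
proof -
  have "F = G \<longleftrightarrow> (\<forall>x\<in>X. F x = G x)" if "F \<in> extensional X" "G \<in> extensional X" for F G :: "'a \<Rightarrow> complex^'b^'b"
    using that by (auto intro: extensionalityI)
  then show ?thesis
    by (auto simp: unitaries_def[of "cont_matrix_algebra X"] unitary_matrix_iff)
qed

lemma tuple_convex_tuple_conv: "tuple_convex \<AA> (tuple_conv \<AA> S)"
  unfolding tuple_conv_def
  by (rule hull_in) (unfold tuple_convex_def, blast)

lemma tuple_conv_subset: "S \<subseteq> T \<Longrightarrow> tuple_convex \<AA> T \<Longrightarrow> tuple_conv \<AA> S \<subseteq> T"
  unfolding tuple_conv_def by (rule hull_minimal)

lemma tuple_conv_mono: "S \<subseteq> T \<Longrightarrow> tuple_conv \<AA> S \<subseteq> tuple_conv \<AA> T"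
  unfolding tuple_conv_def by (rule hull_mono)

lemma tuple_conv_inc: "Q \<in> S \<Longrightarrow> Q \<in> tuple_conv \<AA> S"
  unfolding tuple_conv_def by (rule hull_inc)

abbreviation cont_tuples :: "'x::metric_space set \<Rightarrow> ('m::finite \<Rightarrow> 'x \<Rightarrow> complex^'n::finite^'n) set" where
  "cont_tuples X \<equiv> {Q. \<forall>j. Q j \<in> carrier (cont_matrix_algebra X)}"

lemma tuple_combination_cont:
  "(\<lambda>j. (complex_of_real u \<odot>\<^bsub>cont_matrix_algebra X\<^esub> P j) \<oplus>\<^bsub>cont_matrix_algebra X\<^esub>
      (complex_of_real v \<odot>\<^bsub>cont_matrix_algebra X\<^esub> Q j)) =
    (\<lambda>j. \<lambda>x\<in>X. u *\<^sub>R P j x + v *\<^sub>R Q j x)"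
  by (intro ext) simp

lemma tuple_convex_cont_iff:
  "tuple_convex (cont_matrix_algebra X) S \<longleftrightarrow>
    (\<forall>P\<in>S. \<forall>Q\<in>S. \<forall>u v. 0 \<le> u \<longrightarrow> 0 \<le> v \<longrightarrow> u + v = 1 \<longrightarrow> (\<lambda>j. \<lambda>x\<in>X. u *\<^sub>R P j x + v *\<^sub>R Q j x) \<in> S)"
  unfolding tuple_convex_def tuple_combination_cont ..

lemma tuple_convex_cont_tuples: "tuple_convex (cont_matrix_algebra X) (cont_tuples X)"
  unfolding tuple_convex_cont_iff by (auto intro!: continuous_intros)

text \<open>Equivalence of norms turns closeness in the C*-norm into uniform closeness in the
  library norm; \<open>S\<close> consists of continuous tuples so that \<ominus> can be computed
  pointwise.\<close>

lemma tuple_closure_cont_iff: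
  fixes P :: "'m::finite \<Rightarrow> 'x::metric_space \<Rightarrow> complex^'n::finite^'n"
  assumes X: "compact X" and S: "S \<subseteq> cont_tuples X"
  shows "P \<in> tuple_closure (cont_matrix_algebra X) S \<longleftrightarrow>
    P \<in> cont_tuples X \<and> (\<forall>e>0. \<exists>Q\<in>S. \<forall>j. \<forall>x\<in>X. norm (P j x - Q j x) < e)"
proof -
  let ?c = "real CARD('n) * real CARD('n)"
  have minus: "P j \<ominus>\<^bsub>cont_matrix_algebra X\<^esub> Q j = (\<lambda>x\<in>X. P j x - Q j x)"
    "P j \<ominus>\<^bsub>cont_matrix_algebra X\<^esub> Q j \<in> carrier (cont_matrix_algebra X)"
    if "P \<in> cont_tuples X" "Q \<in> S" for j Q
  proof -
    have "P j \<in> carrier (cont_matrix_algebra X)" "Q j \<in> carrier (cont_matrix_algebra X)"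
      using that S by auto
    then show "P j \<ominus>\<^bsub>cont_matrix_algebra X\<^esub> Q j = (\<lambda>x\<in>X. P j x - Q j x)"
      "P j \<ominus>\<^bsub>cont_matrix_algebra X\<^esub> Q j \<in> carrier (cont_matrix_algebra X)"
      by (simp_all only: cont_matrix_algebra_minus) (auto intro!: continuous_intros)
  qed
  have 1: "\<exists>Q\<in>S. \<forall>j. \<forall>x\<in>X. norm (P j x - Q j x) < e"
    if P: "P \<in> tuple_closure (cont_matrix_algebra X) S" and e: "e > 0" for e
  proof -
    have PX: "P \<in> cont_tuples X"
      using P by (simp add: tuple_closure_def)
    have "e / ?c > 0"
      using e by simp
    then obtain Q where Q: "Q \<in> S" "\<And>j. nrm (cont_matrix_algebra X) (P j \<ominus>\<^bsub>cont_matrix_algebra X\<^esub> Q j) < e / ?c"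
      using P unfolding tuple_closure_def by blast
    have "norm (P j x - Q j x) < e" if x: "x \<in> X" for j x
    proof -
      have "onorm ((*v) (P j x - Q j x)) < e / ?c"
        using onorm_le_cont_norm[OF X minus(2)[OF PX Q(1), of j] x] Q(2)[of j] minus(1)[OF PX Q(1), of j] x
        by simp
      then have "?c * onorm ((*v) (P j x - Q j x)) < e"
        by (simp add: field_simps)
      then show ?thesis
        using norm_le_onorm_mult[of "P j x - Q j x"] by linarith
    qed
    then show ?thesis
      using Q(1) by blast
  qed
  have 2: "\<exists>Q\<in>S. \<forall>j. nrm (cont_matrix_algebra X) (P j \<ominus>\<^bsub>cont_matrix_algebra X\<^esub> Q j) < e"
    if PX: "P \<in> cont_tuples X" and *: "\<forall>e>0. \<exists>Q\<in>S. \<forall>j. \<forall>x\<in>X. norm (P j x - Q j x) < e" and e: "e > 0" for e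
  proof -
    have "e / (2 * ?c) > 0"
      using e by simp
    then obtain Q where Q: "Q \<in> S" "\<And>j x. x \<in> X \<Longrightarrow> norm (P j x - Q j x) < e / (2 * ?c)"
      using * by blast
    have le: "nrm (cont_matrix_algebra X) (P j \<ominus>\<^bsub>cont_matrix_algebra X\<^esub> Q j) \<le> e / 2" for j
    proof (rule cont_norm_le)
      fix x assume x: "x \<in> X"
      have "?c * norm (P j x - Q j x) \<le> ?c * (e / (2 * ?c))"
        using Q(2)[OF x, of j] by (intro mult_left_mono) (auto simp: less_imp_le)
      then show "onorm ((*v) ((P j \<ominus>\<^bsub>cont_matrix_algebra X\<^esub> Q j) x)) \<le> e / 2"
        using onorm_le_norm_mult[of "P j x - Q j x"] x by (simp add: minus(1)[OF PX Q(1)])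
    qed (use e in simp)
    have "nrm (cont_matrix_algebra X) (P j \<ominus>\<^bsub>cont_matrix_algebra X\<^esub> Q j) < e" for j
      by (rule le_less_trans[OF le]) (use e in simp)
    then show ?thesis
      using Q(1) by blast
  qed
  have "P \<in> tuple_closure (cont_matrix_algebra X) S \<Longrightarrow> P \<in> cont_tuples X"
    by (simp add: tuple_closure_def)
  then show ?thesis
    using 1 2 unfolding tuple_closure_def[of "cont_matrix_algebra X" S] by blast
qed

lemma unitary_orbit_cont_tuples:
  "abelian_family (cont_matrix_algebra X) B \<Longrightarrow> unitary_orbit (cont_matrix_algebra X) B \<subseteq> cont_tuples X"
  by (auto simp: unitary_orbit_def abelian_family_def unitary_cont_iff intro!: continuous_intros)

text \<open>The matrix \<open>S\<^sub>i\<^sub>k = |Z\<^sub>i\<^sub>k|\<^sup>2\<close> is doubly stochastic for unitary \<open>Z\<close>.\<close>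

lemma unitary_conj_diagonal:
  fixes Z :: "complex^'n::finite^'n"
  assumes Z: "Z \<in> unitaries matrix_algebra"
  obtains S where "S \<in> doubly_stochastic"
    "\<And>d i. (Z ** diag_matrix d ** adjoint_mat Z) $ i $ i = (\<Sum>k\<in>UNIV. of_real (S $ i $ k) * d k)"
proof -
  define S :: "real^'n^'n" where "S = (\<chi> i k. (norm (Z $ i $ k))\<^sup>2)"
  have S: "complex_of_real (S $ i $ k) = Z $ i $ k * cnj (Z $ i $ k)" for i k
    by (simp only: S_def vec_lambda_beta complex_norm_square)
  have "(\<Sum>k\<in>UNIV. S $ i $ k) = 1" for i
  proof -
    have "complex_of_real (\<Sum>k\<in>UNIV. S $ i $ k) = (Z ** adjoint_mat Z) $ i $ i"
      by (simp only: of_real_sum S) (simp add: matrix_matrix_mult_def)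
    then have "complex_of_real (\<Sum>k\<in>UNIV. S $ i $ k) = of_real 1"
      using Z by (simp only: unitary_adjoint_mult mat_one_diag of_real_1)
    then show ?thesis
      by (simp only: of_real_eq_iff)
  qed
  moreover have "(\<Sum>i\<in>UNIV. S $ i $ k) = 1" for k
  proof -
    have "complex_of_real (\<Sum>i\<in>UNIV. S $ i $ k) = (adjoint_mat Z ** Z) $ k $ k"
      by (simp only: of_real_sum S) (simp add: matrix_matrix_mult_def mult.commute)
    then have "complex_of_real (\<Sum>i\<in>UNIV. S $ i $ k) = of_real 1"
      using Z by (simp only: unitary_adjoint_mult mat_one_diag of_real_1)
    then show ?thesis
      by (simp only: of_real_eq_iff)
  qed
  ultimately have "S \<in> doubly_stochastic"
    by (simp add: doubly_stochastic_iff) (simp add: S_def)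
  moreover have "(Z ** diag_matrix d ** adjoint_mat Z) $ i $ i = (\<Sum>k\<in>UNIV. of_real (S $ i $ k) * d k)" for d i
    unfolding S matrix_matrix_mult_def[of "Z ** diag_matrix d"] by (simp add: diag_matrix_mult_right mult_ac)
  ultimately show ?thesis
    using that by blast
qed

lemma ds_majorized_of_closure:
  fixes A B :: "'m::finite \<Rightarrow> 'x::metric_space \<Rightarrow> complex^'n::finite^'n"
  assumes X: "compact X" and A: "abelian_family (cont_matrix_algebra X) A"
    and B: "abelian_family (cont_matrix_algebra X) B"
    and cl: "A \<in> tuple_closure (cont_matrix_algebra X)
      (tuple_conv (cont_matrix_algebra X) (unitary_orbit (cont_matrix_algebra X) B))"
    and x: "x \<in> X"
  shows "ds_majorized (\<lambda>j. A j x) (\<lambda>j. B j x)"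
proof -
  let ?orb = "unitary_orbit (cont_matrix_algebra X) B"
  obtain U D where dA: "diagonalization (\<lambda>j. A j x) U D"
    using cont_abelian_family_at[OF A x] by (rule simultaneous_diagonalization)
  obtain V D' where dB: "diagonalization (\<lambda>j. B j x) V D'"
    using cont_abelian_family_at[OF B x] by (rule simultaneous_diagonalization)
  have U: "U \<in> unitaries matrix_algebra" and V: "V \<in> unitaries matrix_algebra"
    using dA dB by (auto intro: diagonalization_unitary)
  define v :: "('m \<Rightarrow> 'x \<Rightarrow> complex^'n^'n) \<Rightarrow> complex^'m^'n" where
    "v Q = diag_columns (\<lambda>j. U ** Q j x ** adjoint_mat U)" for Q
  define L :: "real^'n^'n \<Rightarrow> complex^'m^'n" where
    "L S = map_matrix complex_of_real S ** diag_columns D'" for S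
  have L_nth: "L S $ i $ j = (\<Sum>k\<in>UNIV. of_real (S $ i $ k) * D' j $ k $ k)" for S i j
    by (simp add: L_def matrix_matrix_mult_def map_matrix_def diag_columns_def)
  have lin: "linear L"
    by (rule linearI)
      (simp_all add: vec_eq_iff L_nth ring_distribs sum.distrib scaleR_conv_of_real[where 'a=complex] sum_distrib_left mult.assoc)
  then have cpt: "compact (L ` doubly_stochastic)"
    by (intro compact_continuous_image compact_doubly_stochastic linear_continuous_on)
      (simp add: linear_conv_bounded_linear)
  have cvx: "convex (L ` doubly_stochastic)"
    using lin convex_doubly_stochastic by (rule convex_linear_image)
  have "?orb \<subseteq> {Q. v Q \<in> L ` doubly_stochastic}"
  proof
    fix Q assume "Q \<in> ?orb"
    then obtain W where W: "W \<in> unitaries (cont_matrix_algebra X)"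
      and Q: "Q = (\<lambda>j. star (cont_matrix_algebra X) W \<otimes>\<^bsub>cont_matrix_algebra X\<^esub> B j \<otimes>\<^bsub>cont_matrix_algebra X\<^esub> W)"
      by (auto simp: unitary_orbit_def)
    \<comment> \<open>The change from the eigenbasis of \<open>B x\<close>, rotated by
      \<open>W x\<close>, to that of \<open>A x\<close>. It is the same for every \<open>j\<close>,
      so a single doubly stochastic matrix serves the whole tuple.\<close>
    define Z where "Z = U ** adjoint_mat (W x) ** adjoint_mat V"
    have "Z \<in> unitaries matrix_algebra"
      using U V W x unfolding Z_def
      by (intro unitary_matrix_mult unitary_matrix_adjoint) (auto simp: unitary_cont_iff)
    then obtain S where S: "S \<in> doubly_stochastic"
      "\<And>d i. (Z ** diag_matrix d ** adjoint_mat Z) $ i $ i = (\<Sum>k\<in>UNIV. of_real (S $ i $ k) * d k)"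
      using unitary_conj_diagonal by blast
    have conj: "U ** Q j x ** adjoint_mat U = Z ** D' j ** adjoint_mat Z" for j
      using dB x by (simp add: Q Z_def diagonalization_def adjoint_mat_mult matrix_mul_assoc)
    have diag: "D' j = diag_matrix (\<lambda>k. D' j $ k $ k)" for j
      using dB by (intro diagonal_mat_eq) (simp add: diagonalization_def)
    have "v Q $ i $ j = L S $ i $ j" for i j
    proof -
      have "v Q $ i $ j = (Z ** D' j ** adjoint_mat Z) $ i $ i"
        by (simp add: v_def diag_columns_def conj)
      also have "\<dots> = (Z ** diag_matrix (\<lambda>k. D' j $ k $ k) ** adjoint_mat Z) $ i $ i"
        using diag[of j] by (rule arg_cong)
      finally show ?thesis
        by (simp only: S(2) L_nth)
    qed
    then have "v Q = L S"
      by (simp add: vec_eq_iff)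
    then show "Q \<in> {Q. v Q \<in> L ` doubly_stochastic}"
      using S(1) by blast
  qed
  \<comment> \<open>\<open>v\<close> respects convex combinations and \<open>L\<close> maps onto a
    convex set, so what holds on the orbit extends to its hull.\<close>
  moreover have "tuple_convex (cont_matrix_algebra X) {Q. v Q \<in> L ` doubly_stochastic}"
    unfolding tuple_convex_cont_iff
  proof (intro ballI allI impI)
    fix P Q and r s :: real
    assume PQ: "P \<in> {Q. v Q \<in> L ` doubly_stochastic}" "Q \<in> {Q. v Q \<in> L ` doubly_stochastic}"
      and rs: "0 \<le> r" "0 \<le> s" "r + s = 1"
    have "v (\<lambda>j. \<lambda>x\<in>X. r *\<^sub>R P j x + s *\<^sub>R Q j x) = r *\<^sub>R v P + s *\<^sub>R v Q"
      using x by (simp add: vec_eq_iff v_def diag_columns_def matrix_add_ldistrib matrix_add_rdistrib matrix_mult_scaleR)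
    then show "(\<lambda>j. \<lambda>x\<in>X. r *\<^sub>R P j x + s *\<^sub>R Q j x) \<in> {Q. v Q \<in> L ` doubly_stochastic}"
      using PQ rs convexD[OF cvx] by simp
  qed
  ultimately have conv: "v Q \<in> L ` doubly_stochastic" if "Q \<in> tuple_conv (cont_matrix_algebra X) ?orb" for Q
    using tuple_conv_subset that by blast
  have sub: "tuple_conv (cont_matrix_algebra X) ?orb \<subseteq> cont_tuples X"
    by (intro tuple_conv_subset unitary_orbit_cont_tuples B tuple_convex_cont_tuples)
  have "v A \<in> closure (L ` doubly_stochastic)"
    unfolding closure_approachable
  proof (intro allI impI)
    fix e :: real assume e: "e > 0"
    \<comment> \<open>There are n m entries, each costing n^2 for the conjugation by
      \<open>U\<close>; the 2 makes the final estimate strict.\<close>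
    define d where "d = e / (2 * (real CARD('n) * real CARD('m) * (real CARD('n) * real CARD('n))))"
    have "d > 0"
      using e by (simp add: d_def)
    then obtain Q where Q: "Q \<in> tuple_conv (cont_matrix_algebra X) ?orb"
      "\<And>j. norm (A j x - Q j x) < d"
      using cl x unfolding tuple_closure_cont_iff[OF X sub] by blast
    have "norm ((v Q - v A) $ i $ j) \<le> real CARD('n) * (real CARD('n) * (1 * d) * 1)" for i j
    proof -
      have "(v Q - v A) $ i $ j = (U ** (Q j x - A j x) ** adjoint_mat U) $ i $ i"
        using conj_add[of U "Q j x - A j x" "A j x"] by (simp add: v_def diag_columns_def vec_eq_iff)
      moreover have "norm ((U ** (Q j x - A j x) ** adjoint_mat U) $ i $ i) \<le> real CARD('n) * (real CARD('n) * (1 * d) * 1)"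
      proof (intro norm_matrix_mult_entry_le)
        show "norm ((Q j x - A j x) $ k $ l) \<le> d" for k l
          using matrix_entry_norm_le[of "Q j x - A j x" k l] Q(2)[of j] by (simp add: norm_minus_commute)
      qed (use norm_unitary_entry_le[OF U] in auto)
      ultimately show ?thesis
        by simp
    qed
    then have "(\<Sum>i\<in>UNIV. \<Sum>j\<in>UNIV. norm ((v Q - v A) $ i $ j)) \<le>
        (\<Sum>i\<in>(UNIV::'n set). \<Sum>j\<in>(UNIV::'m set). real CARD('n) * (real CARD('n) * (1 * d) * 1))"
      by (intro sum_mono)
    also have "\<dots> = e / 2"
      by (simp add: d_def)
    finally have "norm (v Q - v A) \<le> e / 2"
      using norm_matrix_le_sum[of "v Q - v A"] by linarith
    then show "\<exists>y\<in>L ` doubly_stochastic. dist y (v A) < e"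
      using conv[OF Q(1)] e by (intro bexI[of _ "v Q"]) (auto simp: dist_norm)
  qed
  then have "v A \<in> L ` doubly_stochastic"
    using cpt by (simp add: compact_imp_closed closure_closed)
  then obtain S where S: "S \<in> doubly_stochastic" "v A = L S"
    by blast
  have "U ** A j x ** adjoint_mat U = D j" for j
    using dA by (simp add: diagonalization_def matrix_mul_assoc[symmetric] unitary_adjoint_mult)
  then have "v A = diag_columns D"
    by (simp add: v_def)
  then show ?thesis
    using dA dB S unfolding ds_majorized_def L_def by metis
qed

section \<open>Averaging by unitaries at a point\<close>

lemma permutation_unitary:
  fixes \<sigma> :: "'n::finite \<Rightarrow> 'n"
  assumes "bij \<sigma>"
  defines "P \<equiv> map_matrix complex_of_real (permutation_matrix \<sigma>)"
  shows "P \<in> unitaries matrix_algebra"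
    "P ** diag_matrix d ** adjoint_mat P = diag_matrix (\<lambda>i. d (\<sigma> i))"
proof -
  have P: "P $ i $ k = (if k = \<sigma> i then 1 else 0)" for i k
    by (simp add: P_def map_matrix_def permutation_matrix_def)
  have \<sigma>: "\<sigma> i = \<sigma> j \<longleftrightarrow> i = j" for i j
    using assms(1) by (simp add: bij_def inj_eq)
  show *: "P ** diag_matrix d ** adjoint_mat P = diag_matrix (\<lambda>i. d (\<sigma> i))" for d
    unfolding vec_eq_iff matrix_matrix_mult_def[of "P ** diag_matrix d"]
    by (simp add: diag_matrix_mult_right P diag_matrix_nth \<sigma> if_distrib[of "\<lambda>x. x * _"] if_distrib[of "\<lambda>x. _ * x"]
        if_distrib[of cnj] cong: if_cong)
  from *[of "\<lambda>_. 1"] show "P \<in> unitaries matrix_algebra"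
    by (intro unitary_matrixI) (simp add: diag_matrix_one)
qed

lemma ds_majorized_unitary_average:
  fixes a b :: "'m::finite \<Rightarrow> complex^'n::finite^'n"
  assumes "ds_majorized a b"
  obtains I :: "(real^'n^'n) set" and t W where "finite I" "\<And>p. p \<in> I \<Longrightarrow> 0 \<le> t p" "sum t I = 1"
    "\<And>p. p \<in> I \<Longrightarrow> W p \<in> unitaries matrix_algebra"
    "\<And>j. a j = (\<Sum>p\<in>I. t p *\<^sub>R (adjoint_mat (W p) ** b j ** W p))"
proof -
  obtain U V D D' S where dA: "diagonalization a U D" and dB: "diagonalization b V D'"
    and S: "S \<in> doubly_stochastic" "map_matrix complex_of_real S ** diag_columns D' = diag_columns D"
    using assms unfolding ds_majorized_def by blast
  have U: "U \<in> unitaries matrix_algebra" and V: "V \<in> unitaries matrix_algebra"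
    using dA dB by (auto intro: diagonalization_unitary)
  \<comment> \<open>The permutation matrices index themselves, which is the form in which
    \<open>convex_hull_finite\<close> delivers the weights.\<close>
  let ?I = "permutation_matrix ` {\<sigma> :: 'n \<Rightarrow> 'n. bij \<sigma>}"
  have "S \<in> convex hull ?I"
    using S(1) by (rule birkhoff)
  then obtain t where t: "\<And>p. p \<in> ?I \<Longrightarrow> 0 \<le> t p" "sum t ?I = 1" "(\<Sum>p\<in>?I. t p *\<^sub>R p) = S"
    unfolding convex_hull_finite[OF finite_imageI[OF finite]] by blast
  \<comment> \<open>Chosen so that conjugating \<open>b j\<close> by \<open>W p\<close> gives
    \<open>D' j\<close> with its diagonal permuted by \<open>p\<close>, expressed in the eigenbasis
    of \<open>a\<close>.\<close>
  define W where "W p = adjoint_mat V ** adjoint_mat (map_matrix complex_of_real p) ** U" for p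
  have W: "W p \<in> unitaries matrix_algebra" if "p \<in> ?I" for p
    using that U V permutation_unitary(1) unfolding W_def
    by (intro unitary_matrix_mult unitary_matrix_adjoint) auto
  have diagD: "D j = diag_matrix (\<lambda>i. D j $ i $ i)" "D' j = diag_matrix (\<lambda>i. D' j $ i $ i)" for j
    using dA dB by (auto simp: diagonalization_def intro: diagonal_mat_eq)
  have "a j = (\<Sum>p\<in>?I. t p *\<^sub>R (adjoint_mat (W p) ** b j ** W p))" for j
  proof -
    let ?c = "map_matrix complex_of_real"
    have WbW: "adjoint_mat (W p) ** b j ** W p = adjoint_mat U ** (?c p ** D' j ** adjoint_mat (?c p)) ** U" for p
      using dB V by (simp add: W_def diagonalization_def adjoint_mat_mult matrix_mul_assoc[symmetric] unitary_adjoint_mult)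
    \<comment> \<open>For permutation matrices the conjugate of a diagonal matrix is diagonal, and
      its diagonal is \<open>p\<close> applied to the old one. This expression is linear in
      \<open>p\<close>, so the weights recombine to \<open>S\<close>.\<close>
    have pDp: "(?c p ** D' j ** adjoint_mat (?c p)) $ i $ k =
        (if i = k then \<Sum>l\<in>UNIV. of_real (p $ i $ l) * D' j $ l $ l else 0)" if "p \<in> ?I" for p i k
    proof -
      obtain \<sigma> where \<sigma>: "bij \<sigma>" "p = permutation_matrix \<sigma>"
        using \<open>p \<in> ?I\<close> by blast
      have "?c p ** D' j ** adjoint_mat (?c p) = diag_matrix (\<lambda>i. D' j $ \<sigma> i $ \<sigma> i)"
        using permutation_unitary(2)[OF \<sigma>(1), of "\<lambda>i. D' j $ i $ i"] \<sigma>(2) diagD(2)[of j] by metis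
      then show ?thesis
        by (simp add: \<sigma>(2) diag_matrix_nth permutation_matrix_def if_distrib[of "\<lambda>x. x * _"]
            if_distrib[of complex_of_real] cong: if_cong)
    qed
    have "D j = (\<Sum>p\<in>?I. t p *\<^sub>R (?c p ** D' j ** adjoint_mat (?c p)))"
    proof -
      have "D j $ i $ k = (\<Sum>p\<in>?I. t p *\<^sub>R (?c p ** D' j ** adjoint_mat (?c p)) $ i $ k)" for i k
      proof (cases "i = k")
        case True
        have "D j $ i $ i = (map_matrix complex_of_real S ** diag_columns D') $ i $ j"
          by (simp add: S(2)) (simp add: diag_columns_def)
        also have "\<dots> = (\<Sum>l\<in>UNIV. of_real (\<Sum>p\<in>?I. t p * p $ i $ l) * D' j $ l $ l)"
          by (simp add: matrix_matrix_mult_def map_matrix_def diag_columns_def sum_component flip: t(3))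
        also have "\<dots> = (\<Sum>l\<in>UNIV. \<Sum>p\<in>?I. of_real (t p) * (of_real (p $ i $ l) * D' j $ l $ l))"
          by (simp add: sum_distrib_right mult.assoc)
        also have "\<dots> = (\<Sum>p\<in>?I. of_real (t p) * (\<Sum>l\<in>UNIV. of_real (p $ i $ l) * D' j $ l $ l))"
          unfolding sum_distrib_left by (rule sum.swap)
        also have "\<dots> = (\<Sum>p\<in>?I. t p *\<^sub>R (?c p ** D' j ** adjoint_mat (?c p)) $ i $ i)"
          using pDp by (intro sum.cong refl) (simp add: scaleR_conv_of_real[where 'a=complex])
        finally show ?thesis
          using True by simp
      next
        case False
        then show ?thesis
          using pDp diagD(1)[of j] by (simp add: diag_matrix_def vec_eq_iff)
      qed
      then show ?thesis
        by (simp add: vec_eq_iff sum_component)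
    qed
    then have "a j = adjoint_mat U ** (\<Sum>p\<in>?I. t p *\<^sub>R (?c p ** D' j ** adjoint_mat (?c p))) ** U"
      using dA by (metis diagonalization_def)
    also have "\<dots> = (\<Sum>p\<in>?I. t p *\<^sub>R (adjoint_mat (W p) ** b j ** W p))"
    proof -
      have lin: "linear (\<lambda>M. adjoint_mat U ** M ** U)"
        by (rule linearI) (simp_all add: matrix_add_ldistrib matrix_add_rdistrib matrix_mult_scaleR)
      show ?thesis
        unfolding linear_sum[OF lin] by (simp add: WbW matrix_mult_scaleR)
    qed
    finally show ?thesis .
  qed
  then show ?thesis
    using that[of ?I t W] t W by simp
qed

section \<open>Null-homotopic unitaries\<close>

text \<open>The class from which the conjugating functions are taken: it contains the constants, any
  two members are joined by a path, and the functions read off along such a path belong to it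
  again.\<close>

definition null_homotopic_unitary :: "'x::metric_space set \<Rightarrow> ('x \<Rightarrow> complex^'n::finite^'n) \<Rightarrow> bool" where
  "null_homotopic_unitary X W \<longleftrightarrow> (\<exists>H. continuous_on ({0..1::real} \<times> X) (\<lambda>(t, x). H t x) \<and>
     (\<forall>t\<in>{0..1}. \<forall>x\<in>X. H t x \<in> unitaries matrix_algebra) \<and>
     (\<forall>x\<in>X. H 0 x = mat 1 \<and> H 1 x = W x))"

lemma smult_matrix_mult:
  fixes M N :: "complex^'n::finite^'n"
  shows "(c \<odot>\<^bsub>matrix_algebra\<^esub> M) ** N = c \<odot>\<^bsub>matrix_algebra\<^esub> (M ** N)"
    "M ** (c \<odot>\<^bsub>matrix_algebra\<^esub> N) = c \<odot>\<^bsub>matrix_algebra\<^esub> (M ** N)"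
  by (simp_all add: matrix_algebra_smult vec_eq_iff matrix_matrix_mult_def sum_distrib_left mult_ac)

lemma adjoint_mat_smult: "adjoint_mat (c \<odot>\<^bsub>matrix_algebra\<^esub> M) = cnj c \<odot>\<^bsub>matrix_algebra\<^esub> adjoint_mat M"
  by (simp add: matrix_algebra_smult vec_eq_iff)

lemma matrix_diff_distrib:
  fixes M N P :: "complex^'n::finite^'n"
  shows "(M - N) ** P = M ** P - N ** P" "P ** (M - N) = P ** M - P ** N"
  by (simp_all add: vec_eq_iff matrix_matrix_mult_def ring_distribs sum_subtractf)

text \<open>Diagonalize the commuting hermitian matrices \<open>W + W\<^sup>*\<close> and \<open>i (W\<^sup>* - W)\<close>.\<close>

lemma unitary_diagonalization:
  fixes W :: "complex^'n::finite^'n"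
  assumes W: "W \<in> unitaries matrix_algebra"
  obtains U \<theta> where "U \<in> unitaries matrix_algebra"
    "W = adjoint_mat U ** diag_matrix (\<lambda>k. cis (\<theta> k)) ** U"
proof -
  \<comment> \<open>The index type is \<open>bool\<close>, so the two hermitian matrices form a
    family to which \<open>simultaneous_diagonalization\<close> applies.\<close>
  define a where "a s = (if s then W + adjoint_mat W else \<i> \<odot>\<^bsub>matrix_algebra\<^esub> (adjoint_mat W - W))" for s
  have "abelian_family matrix_algebra a"
    using unitary_adjoint_mult(1,2)[OF W]
    by (auto simp: abelian_family_def a_def adjoint_mat_smult adjoint_mat_add adjoint_mat_diff smult_matrix_mult
        matrix_add_ldistrib matrix_add_rdistrib matrix_diff_distrib)
      (auto simp: matrix_algebra_smult vec_eq_iff algebra_simps)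
  then obtain U D where d: "diagonalization a U D"
    by (rule simultaneous_diagonalization)
  then have U: "U \<in> unitaries matrix_algebra"
    by (rule diagonalization_unitary)
  let ?Z = "U ** W ** adjoint_mat U"
  have "2 \<odot>\<^bsub>matrix_algebra\<^esub> W = a True + \<i> \<odot>\<^bsub>matrix_algebra\<^esub> a False"
    by (simp add: a_def matrix_algebra_smult vec_eq_iff algebra_simps)
  then have "(U ** (2 \<odot>\<^bsub>matrix_algebra\<^esub> W) ** adjoint_mat U) $ i $ k =
      (U ** (a True + \<i> \<odot>\<^bsub>matrix_algebra\<^esub> a False) ** adjoint_mat U) $ i $ k" for i k
    by (simp only:)
  then have Z2: "2 * ?Z $ i $ k = (U ** a True ** adjoint_mat U) $ i $ k + \<i> * (U ** a False ** adjoint_mat U) $ i $ k" for i k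
    by (simp only: conj_add conj_smult vector_add_component)
  have "diagonal_mat ?Z"
    unfolding diagonal_mat_def
  proof (intro allI impI)
    fix i k :: 'n assume "i \<noteq> k"
    then have "(U ** a s ** adjoint_mat U) $ i $ k = 0" for s
      using diagonalization_diagonal_in[OF d, of s] by (simp add: diagonal_mat_def diagonal_in_def)
    then show "?Z $ i $ k = 0"
      using Z2[of i k] by simp
  qed
  then have Z: "?Z = diag_matrix (\<lambda>k. ?Z $ k $ k)"
    by (rule diagonal_mat_eq)
  have "?Z \<in> unitaries matrix_algebra"
    using U W by (intro unitary_matrix_mult unitary_matrix_adjoint)
  then have "?Z ** adjoint_mat ?Z = mat 1"
    by (rule unitary_adjoint_mult)
  then have "(diag_matrix (\<lambda>k. ?Z $ k $ k) ** adjoint_mat (diag_matrix (\<lambda>k. ?Z $ k $ k))) $ k $ k = 1" for k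
    unfolding Z[symmetric] by (simp only: mat_one_diag)
  then have "?Z $ k $ k * cnj (?Z $ k $ k) = 1" for k
    unfolding adjoint_diag_matrix diag_matrix_mult by (simp add: diag_matrix_nth)
  then have "complex_of_real ((norm (?Z $ k $ k))\<^sup>2) = of_real 1" for k
    by (simp only: complex_norm_square of_real_1)
  then have "(norm (?Z $ k $ k))\<^sup>2 = 1\<^sup>2" for k
    by (simp only: of_real_eq_iff) simp
  then have "norm (?Z $ k $ k) = 1" for k
    by (rule power2_eq_imp_eq) simp_all
  then have cis: "cis (Arg (?Z $ k $ k)) = ?Z $ k $ k" for k
    by (metis mult_1 of_real_1 rcis_cmod_Arg rcis_def)
  have "W = adjoint_mat U ** ?Z ** U"
    using U by (simp add: matrix_mul_assoc[symmetric] unitary_adjoint_mult)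
  also have "\<dots> = adjoint_mat U ** diag_matrix (\<lambda>k. cis (Arg (?Z $ k $ k))) ** U"
    unfolding cis Z[symmetric] ..
  finally show ?thesis
    by (rule that[OF U])
qed

text \<open>Multiplying the angles of the eigenvalues by \<open>t\<close> contracts \<open>W\<close>
  through unitaries.\<close>

lemma null_homotopic_unitary_const:
  fixes W :: "complex^'n::finite^'n"
  assumes "W \<in> unitaries matrix_algebra"
  shows "null_homotopic_unitary X (\<lambda>x. W)"
proof -
  obtain U \<theta> where U: "U \<in> unitaries matrix_algebra"
    and W: "W = adjoint_mat U ** diag_matrix (\<lambda>k. cis (\<theta> k)) ** U"
    using unitary_diagonalization[OF assms] by blast
  let ?H = "\<lambda>t (x :: 'a). adjoint_mat U ** diag_matrix (\<lambda>k. cis (t * \<theta> k)) ** U"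
  have "continuous_on T (\<lambda>p. cis (fst p * \<theta> k))" for k and T :: "(real \<times> 'a) set"
    by (intro continuous_intros)
  then have "continuous_on T (\<lambda>p. if k = l then cis (fst p * \<theta> k) else 0)" for k l and T :: "(real \<times> 'a) set"
    by (cases "k = l") simp_all
  then have "continuous_on T (\<lambda>p. diag_matrix (\<lambda>k. cis (fst p * \<theta> k)))" for T :: "(real \<times> 'a) set"
    unfolding diag_matrix_def by (intro continuous_on_vec_lambda)
  then have "continuous_on ({0..1} \<times> X) (\<lambda>(t, x). ?H t x)"
    unfolding case_prod_unfold by (intro continuous_intros)
  moreover have "diag_matrix (\<lambda>k. cis (t * \<theta> k)) \<in> unitaries matrix_algebra" for t
    by (rule unitary_matrixI) (simp add: adjoint_diag_matrix diag_matrix_mult cis_cnj cis_mult diag_matrix_one)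
  then have "?H t x \<in> unitaries matrix_algebra" for t x
    using U by (intro unitary_matrix_mult unitary_matrix_adjoint)
  moreover have "?H 0 x = mat 1 \<and> ?H 1 x = W" for x
    using U by (simp add: W diag_matrix_one unitary_adjoint_mult)
  ultimately show ?thesis
    unfolding null_homotopic_unitary_def by (intro exI[of _ ?H]) simp
qed

lemma null_homotopic_unitaryD:
  assumes "null_homotopic_unitary X W"
  shows "continuous_on X W" "x \<in> X \<Longrightarrow> W x \<in> unitaries matrix_algebra"
proof -
  obtain H where H: "continuous_on ({0..1::real} \<times> X) (\<lambda>(t, x). H t x)"
     "\<And>t x. t \<in> {0..1} \<Longrightarrow> x \<in> X \<Longrightarrow> H t x \<in> unitaries matrix_algebra"
     "\<And>x. x \<in> X \<Longrightarrow> H 1 x = W x"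
    using assms unfolding null_homotopic_unitary_def by blast
  have "continuous_on X (\<lambda>x. (\<lambda>(t, x). H t x) (1, x))"
    by (rule continuous_on_compose2[OF H(1)]) (auto intro!: continuous_intros)
  then show "continuous_on X W"
    by (simp add: H(3) cong: continuous_on_cong)
  show "W x \<in> unitaries matrix_algebra" if "x \<in> X"
    using H(2)[of 1 x] H(3) that by simp
qed

text \<open>The path \<open>s \<mapsto> V(1 - s) U(s)\<close> built from the two contractions runs from \<open>V\<close> to \<open>U\<close>.\<close>

lemma null_homotopic_unitary_path:
  assumes "null_homotopic_unitary X U" "null_homotopic_unitary X V"
  obtains \<gamma> :: "real \<Rightarrow> 'x::metric_space \<Rightarrow> complex^'n::finite^'n" where
    "\<And>x. x \<in> X \<Longrightarrow> \<gamma> 0 x = V x" "\<And>x. x \<in> X \<Longrightarrow> \<gamma> 1 x = U x"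
    "\<And>c. continuous_on X c \<Longrightarrow> c ` X \<subseteq> {0..1} \<Longrightarrow> null_homotopic_unitary X (\<lambda>x. \<gamma> (c x) x)"
proof -
  obtain H where H: "continuous_on ({0..1::real} \<times> X) (\<lambda>(t, x). H t x)"
     "\<And>t x. t \<in> {0..1} \<Longrightarrow> x \<in> X \<Longrightarrow> H t x \<in> unitaries matrix_algebra"
     "\<And>x. x \<in> X \<Longrightarrow> H 0 x = mat 1" "\<And>x. x \<in> X \<Longrightarrow> H 1 x = U x"
    using assms(1) unfolding null_homotopic_unitary_def by blast
  obtain G where G: "continuous_on ({0..1::real} \<times> X) (\<lambda>(t, x). G t x)"
     "\<And>t x. t \<in> {0..1} \<Longrightarrow> x \<in> X \<Longrightarrow> G t x \<in> unitaries matrix_algebra"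
     "\<And>x. x \<in> X \<Longrightarrow> G 0 x = mat 1" "\<And>x. x \<in> X \<Longrightarrow> G 1 x = V x"
    using assms(2) unfolding null_homotopic_unitary_def by blast
  have "null_homotopic_unitary X (\<lambda>x. G (1 - c x) x ** H (c x) x)"
    if c: "continuous_on X c" "c ` X \<subseteq> {0..1}" for c
    unfolding null_homotopic_unitary_def
  \<comment> \<open>Both factors are contracted at once by scaling their parameters with
    \<open>t\<close>; these stay in [0, 1].\<close>
  proof (intro exI[of _ "\<lambda>t x. G (t * (1 - c x)) x ** H (t * c x) x"] conjI ballI)
    have c': "continuous_on ({0..1} \<times> X) (\<lambda>p. c (snd p))"
      by (rule continuous_on_compose2[OF c(1)]) (auto intro!: continuous_intros)
    have tc: "t * c x \<in> {0..1}" "t * (1 - c x) \<in> {0..1}" if "t \<in> {0..1}" "x \<in> X" for t x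
    proof -
      have "0 \<le> c x" "c x \<le> 1"
        using c(2) that(2) by auto
      then show "t * c x \<in> {0..1}" "t * (1 - c x) \<in> {0..1}"
        using that(1) mult_mono[of t 1 "c x" 1] mult_mono[of t 1 "1 - c x" 1] by auto
    qed
    have "continuous_on ({0..1} \<times> X) (\<lambda>p. (\<lambda>(t, x). G t x) (fst p * (1 - c (snd p)), snd p))"
      by (intro continuous_on_compose2[OF G(1)] continuous_intros c') (auto simp del: atLeastAtMost_iff intro: tc)
    moreover have "continuous_on ({0..1} \<times> X) (\<lambda>p. (\<lambda>(t, x). H t x) (fst p * c (snd p), snd p))"
      by (intro continuous_on_compose2[OF H(1)] continuous_intros c') (auto simp del: atLeastAtMost_iff intro: tc)
    ultimately show "continuous_on ({0..1} \<times> X) (\<lambda>(t, x). G (t * (1 - c x)) x ** H (t * c x) x)"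
      by (auto simp: case_prod_unfold intro: continuous_on_matrix_mult)
    fix x assume x: "x \<in> X"
    show "G (t * (1 - c x)) x ** H (t * c x) x \<in> unitaries matrix_algebra" if "t \<in> {0..1}" for t
      using that x by (intro unitary_matrix_mult G(2) H(2) tc)
    show "G (0 * (1 - c x)) x ** H (0 * c x) x = mat 1"
      using x G(3) H(3) by simp
    show "G (1 * (1 - c x)) x ** H (1 * c x) x = G (1 - c x) x ** H (c x) x"
      by simp
  qed
  then show ?thesis
    using that[of "\<lambda>s x. G (1 - s) x ** H s x"] G(3,4) H(3,4) by simp
qed

section \<open>Gluing local averages\<close>

lemma tuple_convex_contD:
  assumes "tuple_convex (cont_matrix_algebra X) C" "P \<in> C" "Q \<in> C" "0 \<le> u" "0 \<le> v" "u + v = 1"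
  shows "(\<lambda>j. \<lambda>x\<in>X. u *\<^sub>R P j x + v *\<^sub>R Q j x) \<in> C"
  using assms unfolding tuple_convex_cont_iff by (elim ballE allE impE) auto

text \<open>\<open>tuple_convex\<close> is binary, so the weights of the remaining indices are
  renormalized in each step. If they sum to zero, the combination is \<open>q i\<close> itself;
  extensionality gives this equality off \<open>X\<close>.\<close>

lemma tuple_convex_sum:
  fixes q :: "'i \<Rightarrow> 'm::finite \<Rightarrow> 'x::metric_space \<Rightarrow> complex^'n::finite^'n"
  assumes C: "tuple_convex (cont_matrix_algebra X) C" and "finite I"
    and "\<And>i. i \<in> I \<Longrightarrow> 0 \<le> t i" "sum t I = 1"
    and "\<And>i. i \<in> I \<Longrightarrow> q i \<in> C" "\<And>i j. i \<in> I \<Longrightarrow> q i j \<in> extensional X"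
  shows "(\<lambda>j. \<lambda>x\<in>X. \<Sum>i\<in>I. t i *\<^sub>R q i j x) \<in> C"
  using assms(2-)
proof (induction I arbitrary: t rule: finite_induct)
  case (insert i I)
  have ti: "0 \<le> t i" "t i + sum t I = 1" "0 \<le> sum t I"
    using insert.prems(1,2) insert.hyps by (auto intro: sum_nonneg)
  have qi: "q i \<in> C"
    using insert.prems(3) by blast
  show ?case
  proof (cases "sum t I = 0")
    case True
    then have "t k = 0" if "k \<in> I" for k
      using that insert.prems(1) insert.hyps(1) by (simp add: sum_nonneg_eq_0_iff)
    then have "(\<lambda>j. \<lambda>x\<in>X. \<Sum>k\<in>insert i I. t k *\<^sub>R q k j x) = q i"
      using insert.hyps insert.prems(4)[of i] ti True by (intro ext) (auto simp: extensional_def)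
    then show ?thesis
      using qi by (simp only:)
  next
    case False
    let ?r = "\<lambda>k. t k / sum t I"
    let ?R = "\<lambda>j. \<lambda>x\<in>X. \<Sum>k\<in>I. ?r k *\<^sub>R q k j x"
    have "?R \<in> C"
    proof (rule insert.IH)
      show "sum ?r I = 1"
        using False by (simp flip: sum_divide_distrib)
      show "0 \<le> ?r k" if "k \<in> I" for k
        using insert.prems(1)[of k] ti(3) that by simp
    qed (use insert.prems in blast)+
    then have "(\<lambda>j. \<lambda>x\<in>X. t i *\<^sub>R q i j x + sum t I *\<^sub>R ?R j x) \<in> C"
      by (intro tuple_convex_contD[OF C] qi ti)
    also have "(\<lambda>j. \<lambda>x\<in>X. t i *\<^sub>R q i j x + sum t I *\<^sub>R ?R j x) =
        (\<lambda>j. \<lambda>x\<in>X. \<Sum>k\<in>insert i I. t k *\<^sub>R q k j x)"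
      using insert.hyps False by (intro ext) (auto simp: scaleR_sum_right)
    finally show ?thesis .
  qed
qed simp

definition conj_tuple ::
    "'x::metric_space set \<Rightarrow> ('m::finite \<Rightarrow> 'x \<Rightarrow> complex^'n::finite^'n) \<Rightarrow> ('x \<Rightarrow> complex^'n^'n) \<Rightarrow> 'm \<Rightarrow> 'x \<Rightarrow> complex^'n^'n"
  where "conj_tuple X B W = (\<lambda>j. \<lambda>x\<in>X. adjoint_mat (W x) ** B j x ** W x)"

definition null_homotopic_hull ::
    "'x::metric_space set \<Rightarrow> ('m::finite \<Rightarrow> 'x \<Rightarrow> complex^'n::finite^'n) \<Rightarrow> ('m \<Rightarrow> 'x \<Rightarrow> complex^'n^'n) set" where
  "null_homotopic_hull X B =
     tuple_conv (cont_matrix_algebra X) (conj_tuple X B ` {W. null_homotopic_unitary X W})"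

text \<open>The closure is taken by values on \<open>X\<close> only, with no continuity demanded of
  \<open>P\<close>, so that membership of a glued tuple is purely a matter of estimates.\<close>

definition approximable ::
    "'x::metric_space set \<Rightarrow> ('m::finite \<Rightarrow> 'x \<Rightarrow> complex^'n::finite^'n) \<Rightarrow> ('m \<Rightarrow> 'x \<Rightarrow> complex^'n^'n) set" where
  "approximable X B =
     {P. \<forall>e>0. \<exists>Q\<in>null_homotopic_hull X B. \<forall>j. \<forall>x\<in>X. norm (P j x - Q j x) < e}"

text \<open>The weight varies with \<open>x\<close>, so \<open>tuple_convex\<close> says nothing
  about this operation; stability under it is what gluing requires.\<close>

definition combine ::
    "'x set \<Rightarrow> ('x \<Rightarrow> real) \<Rightarrow> ('m \<Rightarrow> 'x \<Rightarrow> 'b::real_vector) \<Rightarrow> ('m \<Rightarrow> 'x \<Rightarrow> 'b) \<Rightarrow> 'm \<Rightarrow> 'x \<Rightarrow> 'b" where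
  "combine X \<phi> P Q = (\<lambda>j. \<lambda>x\<in>X. \<phi> x *\<^sub>R P j x + (1 - \<phi> x) *\<^sub>R Q j x)"

lemma null_homotopic_hull_subset:
  fixes B :: "'m::finite \<Rightarrow> 'x::metric_space \<Rightarrow> complex^'n::finite^'n"
  shows "null_homotopic_hull X B \<subseteq>
    tuple_conv (cont_matrix_algebra X) (unitary_orbit (cont_matrix_algebra X) B)"
  unfolding null_homotopic_hull_def
proof (rule tuple_conv_mono, safe)
  fix W :: "'x \<Rightarrow> complex^'n^'n" assume W: "null_homotopic_unitary X W"
  have "restrict W X \<in> unitaries (cont_matrix_algebra X)"
    using null_homotopic_unitaryD[OF W] by (simp add: unitary_cont_iff)
  moreover have "conj_tuple X B W = (\<lambda>j. star (cont_matrix_algebra X) (restrict W X)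
      \<otimes>\<^bsub>cont_matrix_algebra X\<^esub> B j \<otimes>\<^bsub>cont_matrix_algebra X\<^esub> restrict W X)"
    by (intro ext) (simp add: conj_tuple_def)
  ultimately show "conj_tuple X B W \<in> unitary_orbit (cont_matrix_algebra X) B"
    unfolding unitary_orbit_def by blast
qed

lemma tuple_convex_null_homotopic_hull: "tuple_convex (cont_matrix_algebra X) (null_homotopic_hull X B)"
  unfolding null_homotopic_hull_def by (rule tuple_convex_tuple_conv)

lemma conj_tuple_in_hull: "null_homotopic_unitary X W \<Longrightarrow> conj_tuple X B W \<in> null_homotopic_hull X B"
  unfolding null_homotopic_hull_def by (intro tuple_conv_inc) blast

lemma conj_tuple_extensional: "conj_tuple X B W j \<in> extensional X"
  by (simp add: conj_tuple_def del: restrict_apply)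

lemma hull_approximable: "null_homotopic_hull X B \<subseteq> approximable X B"
  by (auto simp: approximable_def intro!: bexI)

lemma approximable_closed:
  assumes "\<And>e. e > 0 \<Longrightarrow> \<exists>Q\<in>approximable X B. \<forall>j. \<forall>x\<in>X. norm (P j x - Q j x) < e"
  shows "P \<in> approximable X B"
  unfolding approximable_def
proof (intro CollectI allI impI)
  fix e :: real assume "e > 0"
  then obtain Q where Q: "Q \<in> approximable X B" "\<And>j x. x \<in> X \<Longrightarrow> norm (P j x - Q j x) < e / 2"
    using assms[of "e / 2"] by auto
  obtain R where R: "R \<in> null_homotopic_hull X B" "\<And>j x. x \<in> X \<Longrightarrow> norm (Q j x - R j x) < e / 2"
    using Q(1) half_gt_zero[OF \<open>e > 0\<close>] unfolding approximable_def by blast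
  have "norm (P j x - R j x) < e" if "x \<in> X" for j x
    using norm_triangle_lt[of "P j x - Q j x" "Q j x - R j x" e] Q(2)[OF that, of j] R(2)[OF that, of j]
    by simp
  then show "\<exists>R\<in>null_homotopic_hull X B. \<forall>j. \<forall>x\<in>X. norm (P j x - R j x) < e"
    using R(1) by blast
qed

lemma norm_convex_combination_diff_lt:
  fixes a b c d :: "'b::real_normed_vector"
  assumes "norm (a - c) < e" "norm (b - d) < e" "0 \<le> u" "u \<le> 1"
  shows "norm ((u *\<^sub>R a + (1 - u) *\<^sub>R b) - (u *\<^sub>R c + (1 - u) *\<^sub>R d)) < e"
proof -
  have "(u *\<^sub>R a + (1 - u) *\<^sub>R b) - (u *\<^sub>R c + (1 - u) *\<^sub>R d) = (1 - u) *\<^sub>R (b - d) + u *\<^sub>R (a - c)"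
    by (simp add: algebra_simps)
  moreover have "(1 - u) *\<^sub>R (b - d) + u *\<^sub>R (a - c) \<in> ball 0 e"
    using assms by (intro convexD_alt[OF convex_ball]) (auto simp: dist_norm norm_minus_commute)
  ultimately show ?thesis
    by simp
qed

lemma tuple_convex_approximable: "tuple_convex (cont_matrix_algebra X) (approximable X B)"
  unfolding tuple_convex_cont_iff
proof (intro ballI allI impI)
  fix P Q and u v :: real
  assume PQ: "P \<in> approximable X B" "Q \<in> approximable X B" and uv: "0 \<le> u" "0 \<le> v" "u + v = 1"
  have v: "v = 1 - u"
    using uv by simp
  show "(\<lambda>j. \<lambda>x\<in>X. u *\<^sub>R P j x + v *\<^sub>R Q j x) \<in> approximable X B"
    unfolding approximable_def
  proof (intro CollectI allI impI)
    fix e :: real assume e: "e > 0"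
    obtain P' where P': "P' \<in> null_homotopic_hull X B" "\<And>j x. x \<in> X \<Longrightarrow> norm (P j x - P' j x) < e"
      using PQ(1) e unfolding approximable_def by blast
    obtain Q' where Q': "Q' \<in> null_homotopic_hull X B" "\<And>j x. x \<in> X \<Longrightarrow> norm (Q j x - Q' j x) < e"
      using PQ(2) e unfolding approximable_def by blast
    have hull: "(\<lambda>j. \<lambda>x\<in>X. u *\<^sub>R P' j x + v *\<^sub>R Q' j x) \<in> null_homotopic_hull X B"
      by (intro tuple_convex_contD[OF tuple_convex_null_homotopic_hull] P' Q' uv)
    have close: "norm ((\<lambda>x\<in>X. u *\<^sub>R P j x + v *\<^sub>R Q j x) x - (\<lambda>x\<in>X. u *\<^sub>R P' j x + v *\<^sub>R Q' j x) x) < e"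
      if "x \<in> X" for j x
      using norm_convex_combination_diff_lt[OF P'(2)[OF that] Q'(2)[OF that]] that uv by (simp add: v)
    show "\<exists>R\<in>null_homotopic_hull X B. \<forall>j. \<forall>x\<in>X.
        norm ((\<lambda>x\<in>X. u *\<^sub>R P j x + v *\<^sub>R Q j x) x - R j x) < e"
      by (rule bexI[OF _ hull]) (intro allI ballI close)
  qed
qed

section \<open>Replacing a weight function by positions on a path\<close>

definition clamp01 :: "real \<Rightarrow> real" where
  "clamp01 s = max 0 (min 1 s)"

lemma clamp01_range: "0 \<le> clamp01 s" "clamp01 s \<le> 1"
  by (auto simp: clamp01_def)

lemma continuous_on_clamp01 [continuous_intros]:
  "continuous_on S f \<Longrightarrow> continuous_on S (\<lambda>x. clamp01 (f x))"
  unfolding clamp01_def by (intro continuous_intros)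

text \<open>\<open>clamp01 (y - real l)\<close> is the length of the part of [l, l + 1] below
  \<open>y\<close>; the first N unit intervals make up [0, N].\<close>

lemma sum_clamp01: "0 \<le> y \<Longrightarrow> (\<Sum>l<N. clamp01 (y - real l)) = min (real N) y"
  by (induction N) (auto simp: clamp01_def min_def max_def)

lemma norm_conj_unitary_le:
  fixes W M :: "complex^'n::finite^'n"
  assumes W: "W \<in> unitaries matrix_algebra"
  shows "norm (adjoint_mat W ** M ** W) \<le> real CARD('n) ^ 4 * norm M"
proof -
  have "norm ((adjoint_mat W ** M ** W) $ i $ j) \<le> real CARD('n) * (real CARD('n) * (1 * norm M) * 1)" for i j
    using norm_unitary_entry_le[OF W] by (intro norm_matrix_mult_entry_le) (auto simp: matrix_entry_norm_le)
  then have "(\<Sum>i\<in>UNIV. \<Sum>j\<in>UNIV. norm ((adjoint_mat W ** M ** W) $ i $ j)) \<le>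
      (\<Sum>i\<in>(UNIV::'n set). \<Sum>j\<in>(UNIV::'n set). real CARD('n) * (real CARD('n) * (1 * norm M) * 1))"
    by (intro sum_mono)
  then show ?thesis
    using norm_matrix_le_sum[of "adjoint_mat W ** M ** W"] by (simp add: eval_nat_numeral mult_ac)
qed

text \<open>
  Let \<open>\<gamma>\<close> run from \<open>V\<close> to \<open>U\<close> and put \<open>c\<^sub>l = clamp01 (N \<phi> - l)\<close>, so that the \<open>c\<^sub>l\<close> with \<open>l < N\<close> add up to \<open>N \<phi>\<close>.
  At each point all but one of the \<open>c\<^sub>l\<close> are \<open>0\<close> or \<open>1\<close>, hence the uniform average of the
  conjugates by \<open>\<gamma>(c\<^sub>l)\<close> differs from the target by \<open>O(1/N)\<close>.
\<close>

lemma combine_conj_tuple_approximable: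
  fixes B :: "'m::finite \<Rightarrow> 'x::metric_space \<Rightarrow> complex^'n::finite^'n"
  assumes X: "compact X" and B: "\<And>j. continuous_on X (B j)"
    and U: "null_homotopic_unitary X U" and V: "null_homotopic_unitary X V"
    and \<phi>: "continuous_on X \<phi>" "\<phi> ` X \<subseteq> {0..1}"
  shows "combine X \<phi> (conj_tuple X B U) (conj_tuple X B V) \<in> approximable X B"
  unfolding approximable_def
proof (intro CollectI allI impI)
  fix e :: real assume e: "e > 0"
  obtain \<gamma> :: "real \<Rightarrow> 'x \<Rightarrow> complex^'n^'n" where \<gamma>: "\<And>x. x \<in> X \<Longrightarrow> \<gamma> 0 x = V x" "\<And>x. x \<in> X \<Longrightarrow> \<gamma> 1 x = U x"
    "\<And>c. continuous_on X c \<Longrightarrow> c ` X \<subseteq> {0..1} \<Longrightarrow> null_homotopic_unitary X (\<lambda>x. \<gamma> (c x) x)"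
    using null_homotopic_unitary_path[OF U V] by blast
  have "bounded (\<Union>j. B j ` X)"
    using X B by (intro bounded_UN) (auto intro!: compact_imp_bounded compact_continuous_image)
  then obtain b where b: "\<And>j x. x \<in> X \<Longrightarrow> norm (B j x) \<le> b"
    by (auto simp: bounded_iff)
  \<comment> \<open>Half of \<open>M\<close> bounds each conjugate of \<open>B j x\<close>, so
    \<open>M\<close> bounds the error of a single term. The \<open>max\<close> is there because
    \<open>b\<close> may be negative when \<open>X\<close> is empty.\<close>
  define M where "M = 2 * (real CARD('n) ^ 4 * max b 0)"
  have M: "0 \<le> M"
    by (simp add: M_def)
  obtain N :: nat where N: "N > 0" "M / real N < e"
  proof -
    obtain N :: nat where "M / e < real N"
      using reals_Archimedean2 by blast
    then show thesis
      using that[of "Suc N"] e M by (simp add: field_simps)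
  qed
  define c where "c l x = clamp01 (real N * \<phi> x - real l)" for l :: nat and x
  define W where "W l x = \<gamma> (c l x) x" for l x
  have W: "null_homotopic_unitary X (W l)" for l
    unfolding W_def c_def using clamp01_range by (intro \<gamma>(3) continuous_intros \<phi>) auto
  let ?Q = "\<lambda>j. \<lambda>x\<in>X. \<Sum>l<N. (1 / real N) *\<^sub>R conj_tuple X B (W l) j x"
  have hull: "?Q \<in> null_homotopic_hull X B"
    using N(1)
    by (intro tuple_convex_sum[OF tuple_convex_null_homotopic_hull] conj_tuple_in_hull conj_tuple_extensional W)
      auto
  have close: "norm (combine X \<phi> (conj_tuple X B U) (conj_tuple X B V) j x - ?Q j x) < e" if x: "x \<in> X" for j x
  proof -
    let ?F = "\<lambda>W. adjoint_mat (W x) ** B j x ** W x"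
    define T where "T l = c l x *\<^sub>R ?F U + (1 - c l x) *\<^sub>R ?F V - ?F (W l)" for l
    have bF: "norm (?F W) \<le> M / 2" if "null_homotopic_unitary X W" for W
    proof -
      have "norm (?F W) \<le> real CARD('n) ^ 4 * norm (B j x)"
        using null_homotopic_unitaryD(2)[OF that x] by (rule norm_conj_unitary_le)
      also have "\<dots> \<le> real CARD('n) ^ 4 * max b 0"
        using b[OF x, of j] by (intro mult_left_mono) auto
      finally show ?thesis
        by (simp add: M_def)
    qed
    have \<phi>x: "0 \<le> \<phi> x" "\<phi> x \<le> 1"
      using \<phi>(2) x by auto
    have "(\<Sum>l<N. c l x) = real N * \<phi> x"
      unfolding c_def using \<phi>x by (subst sum_clamp01) (auto simp: mult_left_le)
    then have "(\<Sum>l<N. c l x *\<^sub>R ?F U + (1 - c l x) *\<^sub>R ?F V) =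
        (real N * \<phi> x) *\<^sub>R ?F U + (real N * (1 - \<phi> x)) *\<^sub>R ?F V"
      unfolding sum.distrib by (simp add: sum_subtractf right_diff_distrib flip: scaleR_sum_left)
    then have comb: "\<phi> x *\<^sub>R ?F U + (1 - \<phi> x) *\<^sub>R ?F V = (1 / real N) *\<^sub>R (\<Sum>l<N. c l x *\<^sub>R ?F U + (1 - c l x) *\<^sub>R ?F V)"
      using N(1) by (simp add: scaleR_add_right)
    have "combine X \<phi> (conj_tuple X B U) (conj_tuple X B V) j x - ?Q j x = (1 / real N) *\<^sub>R (\<Sum>l<N. T l)"
      using x comb by (simp add: combine_def conj_tuple_def T_def sum_subtractf scaleR_diff_right scaleR_sum_right)
    moreover have "norm (\<Sum>l<N. T l) \<le> M"
    proof -
      \<comment> \<open>Only for l equal to the integer part of N \<phi>(x) can \<open>c l x\<close>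
        lie strictly between 0 and 1; otherwise the path is at one of its ends and the term is
        exact.\<close>
      have T0: "T l = 0" if "l \<noteq> nat \<lfloor>real N * \<phi> x\<rfloor>" for l
      proof -
        have "real N * \<phi> x - real l \<le> 0 \<or> 1 \<le> real N * \<phi> x - real l"
          using that \<phi>x by linarith
        then have "c l x = 0 \<or> c l x = 1"
          by (auto simp: c_def clamp01_def)
        then show ?thesis
          using \<gamma>(1,2)[OF x] by (auto simp: T_def W_def)
      qed
      have TM: "norm (T l) \<le> M" for l
      proof -
        have c: "0 \<le> c l x" "c l x \<le> 1"
          using clamp01_range by (auto simp: c_def)
        have "norm (c l x *\<^sub>R ?F U + (1 - c l x) *\<^sub>R ?F V) \<le> c l x * (M / 2) + (1 - c l x) * (M / 2)"
          using c mult_left_mono[OF bF[OF U], of "c l x"] mult_left_mono[OF bF[OF V], of "1 - c l x"]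
          by (intro norm_triangle_le add_mono) simp_all
        also have "\<dots> = M / 2"
          by (simp flip: distrib_right)
        finally show ?thesis
          unfolding T_def using bF[OF W[of l]] norm_triangle_ineq4 by (smt (verit) field_sum_of_halves)
      qed
      have "(\<Sum>l<N. T l) = (\<Sum>l<N. if l = nat \<lfloor>real N * \<phi> x\<rfloor> then T l else 0)"
        using T0 by (intro sum.cong) auto
      then show ?thesis
        using TM M by simp
    qed
    ultimately have "norm (combine X \<phi> (conj_tuple X B U) (conj_tuple X B V) j x - ?Q j x) \<le> M / real N"
      using N(1) by (simp add: field_simps)
    then show ?thesis
      using N(2) by simp
  qed
  show "\<exists>Q\<in>null_homotopic_hull X B. \<forall>j. \<forall>x\<in>X.
      norm (combine X \<phi> (conj_tuple X B U) (conj_tuple X B V) j x - Q j x) < e"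
    by (rule bexI[OF _ hull]) (intro allI ballI close)
qed

text \<open>With one argument fixed, \<open>combine\<close> is affine in the other, so the good
  arguments form a convex set. Hence the result for two conjugates extends to the hull in the first
  argument, then in the second, and finally to uniform limits.\<close>

lemma combine_approximable:
  fixes B :: "'m::finite \<Rightarrow> 'x::metric_space \<Rightarrow> complex^'n::finite^'n"
  assumes X: "compact X" and B: "\<And>j. continuous_on X (B j)"
    and \<phi>: "continuous_on X \<phi>" "\<phi> ` X \<subseteq> {0..1}"
    and PQ: "P \<in> approximable X B" "Q \<in> approximable X B"
  shows "combine X \<phi> P Q \<in> approximable X B"
proof -
  let ?S = "conj_tuple X B ` {W. null_homotopic_unitary X W}"
  have left: "combine X \<phi> (\<lambda>j. \<lambda>x\<in>X. u *\<^sub>R P j x + v *\<^sub>R P' j x) Q =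
      (\<lambda>j. \<lambda>x\<in>X. u *\<^sub>R combine X \<phi> P Q j x + v *\<^sub>R combine X \<phi> P' Q j x)"
    and right: "combine X \<phi> P (\<lambda>j. \<lambda>x\<in>X. u *\<^sub>R Q j x + v *\<^sub>R Q' j x) =
      (\<lambda>j. \<lambda>x\<in>X. u *\<^sub>R combine X \<phi> P Q j x + v *\<^sub>R combine X \<phi> P Q' j x)"
    if "u + v = 1" for u v and P P' Q Q' :: "'m \<Rightarrow> 'x \<Rightarrow> complex^'n^'n"
  proof -
    have v: "v = 1 - u"
      using that by simp
    show "combine X \<phi> (\<lambda>j. \<lambda>x\<in>X. u *\<^sub>R P j x + v *\<^sub>R P' j x) Q =
        (\<lambda>j. \<lambda>x\<in>X. u *\<^sub>R combine X \<phi> P Q j x + v *\<^sub>R combine X \<phi> P' Q j x)"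
      "combine X \<phi> P (\<lambda>j. \<lambda>x\<in>X. u *\<^sub>R Q j x + v *\<^sub>R Q' j x) =
        (\<lambda>j. \<lambda>x\<in>X. u *\<^sub>R combine X \<phi> P Q j x + v *\<^sub>R combine X \<phi> P Q' j x)"
      unfolding v by (intro ext, simp add: combine_def algebra_simps)+
  qed
  have convex: "tuple_convex (cont_matrix_algebra X) {P. combine X \<phi> P Q \<in> approximable X B}"
    "tuple_convex (cont_matrix_algebra X) {Q. combine X \<phi> P Q \<in> approximable X B}" for P Q
    unfolding tuple_convex_cont_iff
    by (auto simp only: left right mem_Collect_eq intro!: tuple_convex_contD[OF tuple_convex_approximable])
  have 1: "combine X \<phi> P Q \<in> approximable X B" if "P \<in> null_homotopic_hull X B" "Q \<in> ?S" for P Q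
  proof -
    have "?S \<subseteq> {P. combine X \<phi> P Q \<in> approximable X B}"
      using that(2) combine_conj_tuple_approximable[OF X B _ _ \<phi>] by auto
    from tuple_conv_subset[OF this convex(1)] show ?thesis
      using that(1) unfolding null_homotopic_hull_def by blast
  qed
  have 2: "combine X \<phi> P Q \<in> approximable X B" if "P \<in> null_homotopic_hull X B" "Q \<in> null_homotopic_hull X B" for P Q
  proof -
    have "?S \<subseteq> {Q. combine X \<phi> P Q \<in> approximable X B}"
      using that(1) 1 by blast
    from tuple_conv_subset[OF this convex(2)] show ?thesis
      using that(2) unfolding null_homotopic_hull_def by blast
  qed
  show ?thesis
  proof (rule approximable_closed)
    fix e :: real assume e: "e > 0"
    obtain P' where P': "P' \<in> null_homotopic_hull X B" "\<And>j x. x \<in> X \<Longrightarrow> norm (P j x - P' j x) < e"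
      using PQ(1) e unfolding approximable_def by blast
    obtain Q' where Q': "Q' \<in> null_homotopic_hull X B" "\<And>j x. x \<in> X \<Longrightarrow> norm (Q j x - Q' j x) < e"
      using PQ(2) e unfolding approximable_def by blast
    have "norm (combine X \<phi> P Q j x - combine X \<phi> P' Q' j x) < e" if x: "x \<in> X" for j x
      using norm_convex_combination_diff_lt[OF P'(2)[OF x] Q'(2)[OF x]] \<phi>(2) x
      by (auto simp: combine_def)
    then show "\<exists>R\<in>approximable X B. \<forall>j. \<forall>x\<in>X. norm (combine X \<phi> P Q j x - R j x) < e"
      using 2[OF P'(1) Q'(1)] by blast
  qed
qed

lemma local_approximation:
  fixes A B :: "'m::finite \<Rightarrow> 'x::metric_space \<Rightarrow> complex^'n::finite^'n"
  assumes AB: "\<And>j. continuous_on X (A j)" "\<And>j. continuous_on X (B j)"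
    and x0: "x0 \<in> X" and ds: "ds_majorized (\<lambda>j. A j x0) (\<lambda>j. B j x0)" and e: "e > 0"
  shows "\<exists>P\<in>approximable X B. \<exists>r>0. \<forall>x\<in>X. dist x x0 < r \<longrightarrow> (\<forall>j. norm (A j x - P j x) < e)"
proof -
  obtain I :: "(real^'n^'n) set" and t W where I: "finite I" and t: "\<And>p. p \<in> I \<Longrightarrow> 0 \<le> t p" "sum t I = 1"
    and W: "\<And>p. p \<in> I \<Longrightarrow> W p \<in> unitaries matrix_algebra"
    and eq: "\<And>j. A j x0 = (\<Sum>p\<in>I. t p *\<^sub>R (adjoint_mat (W p) ** B j x0 ** W p))"
    by (rule ds_majorized_unitary_average[OF ds]) (rule that)
  define P where "P = (\<lambda>j. \<lambda>x\<in>X. \<Sum>p\<in>I. t p *\<^sub>R conj_tuple X B (\<lambda>x. W p) j x)"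
  have "P \<in> null_homotopic_hull X B"
    unfolding P_def using I t W
    by (intro tuple_convex_sum[OF tuple_convex_null_homotopic_hull] conj_tuple_in_hull conj_tuple_extensional
        null_homotopic_unitary_const)
  then have P: "P \<in> approximable X B"
    using hull_approximable by blast
  \<comment> \<open>Summing over \<open>j\<close> gives one radius for all members of the
    tuple.\<close>
  define g where "g x = (\<Sum>j\<in>UNIV. norm (A j x - (\<Sum>p\<in>I. t p *\<^sub>R (adjoint_mat (W p) ** B j x ** W p))))" for x
  have "continuous_on X g"
    unfolding g_def by (intro continuous_intros AB)
  moreover have g0: "g x0 = 0"
    by (simp add: g_def eq)
  ultimately obtain r where r: "r > 0" "\<And>x. x \<in> X \<Longrightarrow> dist x x0 < r \<Longrightarrow> dist (g x) (g x0) < e"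
    using x0 e unfolding continuous_on_iff by blast
  have "norm (A j x - P j x) < e" if x: "x \<in> X" "dist x x0 < r" for j x
  proof -
    have "norm (A j x - P j x) \<le> g x"
      using x member_le_sum[of j UNIV "\<lambda>j. norm (A j x - (\<Sum>p\<in>I. t p *\<^sub>R (adjoint_mat (W p) ** B j x ** W p)))"]
      by (simp add: g_def P_def conj_tuple_def)
    also have "g x < e"
      using r(2)[OF x] g0 by (simp add: dist_real_def)
    finally show ?thesis .
  qed
  then show ?thesis
    using P r(1) by blast
qed

text \<open>
  Local approximants are merged one centre at a time, using a bump function that is \<open>1\<close> on
  \<open>cball c (r c)\<close> and \<open>0\<close> outside \<open>ball c (2 * r c)\<close>.
\<close>

lemma glue_approximations:
  fixes A B :: "'m::finite \<Rightarrow> 'x::metric_space \<Rightarrow> complex^'n::finite^'n"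
  assumes X: "compact X" and B: "\<And>j. continuous_on X (B j)" and "finite C"
    and "\<And>c. c \<in> C \<Longrightarrow> P c \<in> approximable X B" "\<And>c. c \<in> C \<Longrightarrow> 0 < r c"
    and "\<And>c x j. c \<in> C \<Longrightarrow> x \<in> X \<Longrightarrow> dist x c < 2 * r c \<Longrightarrow> norm (A j x - P c j x) < e"
  shows "\<exists>Q\<in>approximable X B. \<forall>x\<in>X. (\<exists>c\<in>C. dist x c \<le> r c) \<longrightarrow> (\<forall>j. norm (A j x - Q j x) < e)"
  using assms(3-)
proof (induction C rule: finite_induct)
  case empty
  have "conj_tuple X B (\<lambda>x. mat 1) \<in> approximable X B"
    using conj_tuple_in_hull[OF null_homotopic_unitary_const[OF unitary_matrix_one]] hull_approximable by blast
  then show ?case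
    by blast
next
  case (insert c C)
  then obtain Q where Q: "Q \<in> approximable X B"
    "\<And>x j. x \<in> X \<Longrightarrow> \<exists>c\<in>C. dist x c \<le> r c \<Longrightarrow> norm (A j x - Q j x) < e"
    by auto
  have rc: "r c > 0"
    using insert.prems(2) by simp
  define \<psi> where "\<psi> x = clamp01 (2 - dist x c / r c)" for x
  have \<psi>: "continuous_on X \<psi>" "\<psi> ` X \<subseteq> {0..1}"
    using clamp01_range rc by (auto simp: \<psi>_def intro!: continuous_intros)
  have "norm (A j x - combine X \<psi> (P c) Q j x) < e" if x: "x \<in> X" "\<exists>d\<in>insert c C. dist x d \<le> r d" for x j
  proof -
    \<comment> \<open>\<open>P c\<close> is good wherever its weight is nonzero. Outside
      \<open>cball c (r c)\<close> the point is near an older centre, so \<open>Q\<close> is good;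
      inside, \<open>Q\<close> has weight zero.\<close>
    have P: "norm (A j x - P c j x) < e" if "\<psi> x \<noteq> 0"
    proof -
      have "dist x c < 2 * r c"
      proof (rule ccontr)
        assume "\<not> dist x c < 2 * r c"
        then have "2 \<le> dist x c / r c"
          using rc by (simp add: field_simps)
        then show False
          using that by (simp add: \<psi>_def clamp01_def)
      qed
      then show ?thesis
        using insert.prems(3) x(1) by blast
    qed
    show ?thesis
    proof (cases "dist x c \<le> r c")
      case True
      then have "\<psi> x = 1"
        using rc by (simp add: \<psi>_def clamp01_def field_simps)
      then show ?thesis
        using P x(1) by (simp add: combine_def)
    next
      case False
      then have AQ: "norm (A j x - Q j x) < e"
        using Q(2) x by blast
      show ?thesis
      proof (cases "\<psi> x = 0")
        case True
        then show ?thesis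
          using AQ x(1) by (simp add: combine_def)
      next
        case False
        have "norm ((\<psi> x *\<^sub>R A j x + (1 - \<psi> x) *\<^sub>R A j x) - (\<psi> x *\<^sub>R P c j x + (1 - \<psi> x) *\<^sub>R Q j x)) < e"
          using P[OF False] AQ \<psi>(2) x(1) by (intro norm_convex_combination_diff_lt) auto
        then show ?thesis
          using x(1) by (simp add: combine_def flip: scaleR_add_left)
      qed
    qed
  qed
  moreover have "combine X \<psi> (P c) Q \<in> approximable X B"
    using insert.prems(1) Q(1) by (intro combine_approximable X B \<psi>) auto
  ultimately show ?case
    by blast
qed

lemma closure_of_pt_majorized:
  fixes A B :: "'m::finite \<Rightarrow> 'x::metric_space \<Rightarrow> complex^'n::finite^'n"
  assumes X: "compact X" and A: "abelian_family (cont_matrix_algebra X) A"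
    and B: "abelian_family (cont_matrix_algebra X) B" and pt: "pt_majorized X A B"
  shows "A \<in> tuple_closure (cont_matrix_algebra X)
    (tuple_conv (cont_matrix_algebra X) (unitary_orbit (cont_matrix_algebra X) B))"
proof -
  have AB: "\<And>j. continuous_on X (A j)" "\<And>j. continuous_on X (B j)" "A \<in> cont_tuples X"
    using A B by (auto simp: abelian_family_def)
  have "A \<in> approximable X B"
  proof (rule approximable_closed)
    fix e :: real assume e: "e > 0"
    have "\<forall>c\<in>X. \<exists>P r. P \<in> approximable X B \<and> 0 < r \<and> (\<forall>x\<in>X. dist x c < 2 * r \<longrightarrow> (\<forall>j. norm (A j x - P j x) < e))"
    proof
      fix c assume c: "c \<in> X"
      obtain P r where "P \<in> approximable X B" "r > 0"
        "\<forall>x\<in>X. dist x c < r \<longrightarrow> (\<forall>j. norm (A j x - P j x) < e)"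
        using local_approximation[of X A B c e, OF AB(1,2) c _ e] pt c unfolding pt_majorized_def by blast
      then show "\<exists>P r. P \<in> approximable X B \<and> 0 < r \<and> (\<forall>x\<in>X. dist x c < 2 * r \<longrightarrow> (\<forall>j. norm (A j x - P j x) < e))"
        \<comment> \<open>Halving leaves room for the bump function to fall from 1 to 0 between the
          radii r/2 and r.\<close>
        by (intro exI[of _ P] exI[of _ "r / 2"]) simp
    qed
    then obtain P r where P: "\<And>c. c \<in> X \<Longrightarrow> P c \<in> approximable X B" and r: "\<And>c. c \<in> X \<Longrightarrow> 0 < r c"
      and le: "\<And>c x j. c \<in> X \<Longrightarrow> x \<in> X \<Longrightarrow> dist x c < 2 * r c \<Longrightarrow> norm (A j x - P c j x) < e"
      by metis
    have "X \<subseteq> (\<Union>c\<in>X. ball c (r c))"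
      using r by (auto intro!: bexI)
    then obtain C where C: "C \<subseteq> X" "finite C" "X \<subseteq> (\<Union>c\<in>C. ball c (r c))"
      using compactE_image[OF X, of X "\<lambda>c. ball c (r c)"] by (metis open_ball)
    have "\<exists>Q\<in>approximable X B. \<forall>x\<in>X. (\<exists>c\<in>C. dist x c \<le> r c) \<longrightarrow> (\<forall>j. norm (A j x - Q j x) < e)"
      using C P r le by (intro glue_approximations[of X B C P r]) (auto intro: X AB)
    moreover have "\<exists>c\<in>C. dist x c \<le> r c" if "x \<in> X" for x
      using C(3) that by (force simp: dist_commute less_imp_le)
    ultimately show "\<exists>Q\<in>approximable X B. \<forall>j. \<forall>x\<in>X. norm (A j x - Q j x) < e"
      by blast
  qed
  moreover have "tuple_conv (cont_matrix_algebra X) (unitary_orbit (cont_matrix_algebra X) B) \<subseteq> cont_tuples X"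
    by (intro tuple_conv_subset unitary_orbit_cont_tuples B tuple_convex_cont_tuples)
  ultimately show ?thesis
    using AB(3) null_homotopic_hull_subset[of X B] unfolding tuple_closure_cont_iff[OF X] approximable_def
    by (simp add: tuple_closure_cont_iff[OF X]) blast
qed

theorem theorem1p1:
  fixes X :: "'x::metric_space set"
    and A B :: "'m::finite \<Rightarrow> 'x \<Rightarrow> complex^'n::finite^'n"
  assumes "compact X"
    and "abelian_family (cont_matrix_algebra X) A"
    and "abelian_family (cont_matrix_algebra X) B"
  shows "(pt_majorized X A B \<longleftrightarrow> tr_majorized (cont_matrix_algebra X) A B) \<and>
         (tr_majorized (cont_matrix_algebra X) A B \<longleftrightarrow> tr_pt_majorized X A B) \<and>
         (tr_pt_majorized X A B \<longleftrightarrow>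
            A \<in> tuple_closure (cont_matrix_algebra X)
                  (tuple_conv (cont_matrix_algebra X)
                    (unitary_orbit (cont_matrix_algebra X) B)))"
proof -
  have "ds_majorized (\<lambda>j. A j x) (\<lambda>j. B j x) \<longleftrightarrow> trace_majorized (\<lambda>j. A j x) (\<lambda>j. B j x)" if "x \<in> X" for x
    by (intro ds_majorized_iff_trace_majorized cont_abelian_family_at[OF assms(2) that]
        cont_abelian_family_at[OF assms(3) that])
  then have "pt_majorized X A B \<longleftrightarrow> tr_pt_majorized X A B"
    unfolding pt_majorized_def tr_pt_majorized_def tr_majorized_matrix_iff by blast
  moreover have "tr_majorized (cont_matrix_algebra X) A B \<longleftrightarrow> tr_pt_majorized X A B"
    unfolding tr_pt_majorized_def tr_majorized_matrix_iff by (rule tr_majorized_cont_iff[OF assms])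
  moreover have "pt_majorized X A B \<longleftrightarrow> A \<in> tuple_closure (cont_matrix_algebra X)
      (tuple_conv (cont_matrix_algebra X) (unitary_orbit (cont_matrix_algebra X) B))"
    using closure_of_pt_majorized[OF assms] ds_majorized_of_closure[OF assms] unfolding pt_majorized_def by blast
  ultimately show ?thesis
    by blast
qed

end
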